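(* For every prime $p$, each of the finite groups $K=\mathrm{SL}_2(\mathbb{F}_p)$, $K=\mathrm{PSL}_2(\mathbb{F}_p)$ and $K=\mathrm{PGL}_2(\mathbb{F}_p)$ is rigid relative to its automorphism group $\operatorname{Aut}K$.
   Context: $\mathbb{F}_p$ is the field of order $p$. A compact quantum group is a pair $(A,\Delta)$ where $A$ is a von Neumann algebra and $\Delta:A\to A\overline{\otimes}A$ is a faithful normal unital $*$-homomorphism with $(\Delta\otimes\mathrm{id})\Delta=(\mathrm{id}\otimes\Delta)\Delta$, such that there is a faithful normal state $\varphi$ with $(\mathrm{id}\otimes\varphi)\Delta(a)=\varphi(a)1=(\varphi\otimes\mathrm{id})\Delta(a)$ for all $a$. This state is unique (Haar state); $(A,\Delta)$ is of Kac type if it is a trace. Quantum group isomorphisms $(A,\Delta_A)\to(B,\Delta_B)$ are $*$-isomorphisms $\pi:A\to B$ with $\Delta_B\circ\pi=(\pi\otimes\pi)\circ\Delta_A$. A Kac type $(A,\Delta_A)$ is rigid relative to an action $\mathcal{G}\curvearrowright^\alpha(A,\Delta_A)$ by quantum group automorphisms if whenever $(B,\Delta_B)$ is a Kac type compact quantum group, $\mathcal{G}\curvearrowright^\beta(B,\Delta_B)$ is an action by quantum group automorphisms and $\pi:A\to B$ is a Haar state preserving von Neumann algebra isomorphism with $\beta_g\circ\pi=\pi\circ\alpha_g$ for all $g\in\mathcal{G}$, there exist a quantum group isomorphism $\pi_0:(A,\Delta_A)\to(B,\Delta_B)$ and $\zeta\in\operatorname{Aut}\mathcal{G}$ with $\beta_{\zeta(g)}\circ\pi_0=\pi_0\circ\alpha_g$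 for all $g\in\mathcal{G}$. A finite group $K$ is regarded as the compact quantum group $(L^\infty(K),\Delta_K)$ with $\Delta_K(F)(k_1,k_2)=F(k_1k_2)$ and Haar state given by the normalized counting measure. "$K$ is rigid relative to $\operatorname{Aut}K$" means that $(L^\infty(K),\Delta_K)$ is rigid relative to the action $\alpha\cdot F=F\circ\alpha^{-1}$ of $\operatorname{Aut}K$. (For finite $K$ this is equivalent to: whenever $\Lambda$ is a group and $\pi:K\to\Lambda$ is a bijection with $\pi\circ\alpha\circ\pi^{-1}\in\operatorname{Aut}\Lambda$ for all $\alpha\in\operatorname{Aut}K$, then $\Lambda\cong K$.) *)

theory Defs
  imports "HOL-Analysis.Analysis" "HOL-Algebra.Coset" "HOL-Algebra.Bij"
begin

section \<open>Bounded operators on \<open>\<ell>\<^sup>2(I)\<close>\<close>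

text \<open>
  Every Hilbert space is isomorphic to some \<open>\<ell>\<^sup>2(I)\<close>, so von Neumann algebras are taken to
  act on these spaces; the Hilbert space tensor product of \<open>\<ell>\<^sup>2(I)\<close> and \<open>\<ell>\<^sup>2(J)\<close> is
  \<open>\<ell>\<^sup>2(I \<times> J)\<close>. Vectors are functions that vanish off \<open>I\<close>. Operators are functions on all
  of \<open>'i \<Rightarrow> complex\<close> that are zero off \<open>\<ell>\<^sup>2(I)\<close>, so that operators agree iff they are equal as
  functions, and the product of operators is \<open>\<circ>\<close>.
\<close>

type_synonym 'i operator = "('i \<Rightarrow> complex) \<Rightarrow> ('i \<Rightarrow> complex)"

definition ell2 :: "'i set \<Rightarrow> ('i \<Rightarrow> complex) set" where
  "ell2 I = {x. (\<forall>i. i \<notin> I \<longrightarrow> x i = 0) \<and> (\<lambda>i. (cmod (x i))\<^sup>2) summable_on UNIV}"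

definition l2_inner :: "('i \<Rightarrow> complex) \<Rightarrow> ('i \<Rightarrow> complex) \<Rightarrow> complex" where
  "l2_inner x y = (\<Sum>\<^sub>\<infinity>i. cnj (x i) * y i)"

definition l2_norm :: "('i \<Rightarrow> complex) \<Rightarrow> real" where
  "l2_norm x = sqrt (\<Sum>\<^sub>\<infinity>i. (cmod (x i))\<^sup>2)"

definition delta_vec :: "'i \<Rightarrow> 'i \<Rightarrow> complex" where
  "delta_vec k = (\<lambda>i. if i = k then 1 else 0)"

definition bounded_operators :: "'i set \<Rightarrow> 'i operator set" where
  "bounded_operators I = {T.
     (\<forall>x\<in>ell2 I. T x \<in> ell2 I) \<and>
     (\<forall>x\<in>ell2 I. \<forall>y\<in>ell2 I. \<forall>c. T (\<lambda>i. c * x i + y i) = (\<lambda>i. c * T x i + T y i)) \<and>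
     (\<exists>C. \<forall>x\<in>ell2 I. l2_norm (T x) \<le> C * l2_norm x) \<and>
     (\<forall>x. x \<notin> ell2 I \<longrightarrow> T x = (\<lambda>_. 0))}"

definition id_operator :: "'i set \<Rightarrow> 'i operator" where
  "id_operator I = (\<lambda>x. if x \<in> ell2 I then x else (\<lambda>_. 0))"

definition zero_operator :: "'i operator" where
  "zero_operator = (\<lambda>_ _. 0)"

definition add_operator :: "'i operator \<Rightarrow> 'i operator \<Rightarrow> 'i operator" where
  "add_operator S T = (\<lambda>x i. S x i + T x i)"

definition scale_operator :: "complex \<Rightarrow> 'i operator \<Rightarrow> 'i operator" where
  "scale_operator c T = (\<lambda>x i. c * T x i)"

text \<open>\<open>is_adjoint I T S\<close> says that \<open>S = T\<^sup>*\<close>.\<close>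

definition is_adjoint :: "'i set \<Rightarrow> 'i operator \<Rightarrow> 'i operator \<Rightarrow> bool" where
  "is_adjoint I T S \<longleftrightarrow> (\<forall>x\<in>ell2 I. \<forall>y\<in>ell2 I. l2_inner (T x) y = l2_inner x (S y))"

definition commutant :: "'i set \<Rightarrow> 'i operator set \<Rightarrow> 'i operator set" where
  "commutant I X = {S \<in> bounded_operators I. \<forall>T\<in>X. S \<circ> T = T \<circ> S}"

text \<open>
  \<open>S \<otimes> T = (S \<otimes> 1)(1 \<otimes> T)\<close>: first \<open>T\<close> is applied to the second variable of
  \<open>x \<in> \<ell>\<^sup>2(I \<times> J)\<close>, then \<open>S\<close> to the first one.
\<close>

definition tensor_operator ::
    "'i set \<Rightarrow> 'j set \<Rightarrow> 'i operator \<Rightarrow> 'j operator \<Rightarrow> ('i \<times> 'j) operator" where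
  "tensor_operator I J S T = (\<lambda>x. if x \<in> ell2 (I \<times> J)
     then (\<lambda>(i, j). S (\<lambda>i'. T (\<lambda>j'. x (i', j')) j) i) else (\<lambda>_. 0))"

lemma tensor_operator_elementary:
  assumes S: "S \<in> bounded_operators I" and T: "T \<in> bounded_operators J"
    and x: "x \<in> ell2 I" and y: "y \<in> ell2 J" and xy: "(\<lambda>(i, j). x i * y j) \<in> ell2 (I \<times> J)"
  shows "tensor_operator I J S T (\<lambda>(i, j). x i * y j) = (\<lambda>(i, j). S x i * T y j)"
proof -
  have z: "(\<lambda>_. 0) \<in> ell2 K" for K :: "'c set"
    by (simp add: ell2_def)
  have scale: "R (\<lambda>i. c * v i) = (\<lambda>i. c * R v i)"
    if R: "R \<in> bounded_operators K" and v: "v \<in> ell2 K" for R c v and K :: "'c set"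
  proof -
    have lin: "R (\<lambda>i. d * u i + w i) = (\<lambda>i. d * R u i + R w i)"
      if "u \<in> ell2 K" "w \<in> ell2 K" for u w d
      using R that by (simp add: bounded_operators_def)
    have "R (\<lambda>_. 0) i = 0" for i
      using fun_cong[OF lin[OF z z, of 1], of i] by simp
    then show ?thesis
      using lin[OF v z, of c] by simp
  qed
  have "S (\<lambda>i'. T (\<lambda>j'. x i' * y j') j) i = S x i * T y j" for i j
    using scale[OF T y] scale[OF S x, of "T y j"] by (simp add: mult.commute)
  then show ?thesis
    using xy by (simp add: tensor_operator_def)
qed

text \<open>The identification of \<open>\<ell>\<^sup>2(I \<times> (J \<times> K))\<close> with \<open>\<ell>\<^sup>2((I \<times> J) \<times> K)\<close>, on operators.\<close>

definition assoc_operator :: "('i \<times> 'j \<times> 'k) operator \<Rightarrow> (('i \<times> 'j) \<times> 'k) operator" where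
  "assoc_operator T = (\<lambda>x ((i, j), k). T (\<lambda>(i', j', k'). x ((i', j'), k')) (i, j, k))"


section \<open>Von Neumann algebras\<close>

record 'i vn =
  index :: "'i set"
  elems :: "'i operator set"

definition von_neumann_algebra :: "('i, 'x) vn_scheme \<Rightarrow> bool" where
  "von_neumann_algebra M \<longleftrightarrow>
     elems M \<subseteq> bounded_operators (index M) \<and>
     (\<forall>T\<in>elems M. \<exists>S\<in>elems M. is_adjoint (index M) T S) \<and>
     commutant (index M) (commutant (index M) (elems M)) = elems M"

definition vn_tensor ::
    "('i, 'x) vn_scheme \<Rightarrow> ('j, 'y) vn_scheme \<Rightarrow> ('i \<times> 'j) vn" where
  "vn_tensor M N = (let I = index M; J = index N in
     \<lparr>index = I \<times> J,
      elems = commutant (I \<times> J) (commutant (I \<times> J)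
        {tensor_operator I J S T | S T. S \<in> elems M \<and> T \<in> elems N})\<rparr>)"

text \<open>
  The normal functionals on a von Neumann algebra are the \<open>\<sigma>\<close>-weakly continuous ones, i.e.
  those of the form \<open>T \<mapsto> \<Sum>n. \<langle>\<xi>\<^sub>n, T \<eta>\<^sub>n\<rangle>\<close> with square summable \<open>\<xi>\<close> and \<open>\<eta>\<close>. A linear map is
  normal (\<open>\<sigma>\<close>-weakly continuous) iff it pulls normal functionals back to normal functionals.
\<close>

definition normal_functional :: "('i, 'x) vn_scheme \<Rightarrow> ('i operator \<Rightarrow> complex) \<Rightarrow> bool" where
  "normal_functional M \<omega> \<longleftrightarrow> (\<exists>\<xi> \<eta> :: nat \<Rightarrow> 'i \<Rightarrow> complex.
     (\<forall>n. \<xi> n \<in> ell2 (index M) \<and> \<eta> n \<in> ell2 (index M)) \<and>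
     summable (\<lambda>n. (l2_norm (\<xi> n))\<^sup>2) \<and> summable (\<lambda>n. (l2_norm (\<eta> n))\<^sup>2) \<and>
     (\<forall>T\<in>elems M. (\<lambda>n. l2_inner (\<xi> n) (T (\<eta> n))) sums \<omega> T))"

definition vn_linear ::
    "('i, 'x) vn_scheme \<Rightarrow> ('j, 'y) vn_scheme \<Rightarrow> ('i operator \<Rightarrow> 'j operator) \<Rightarrow> bool" where
  "vn_linear M N \<theta> \<longleftrightarrow>
     \<theta> ` elems M \<subseteq> elems N \<and>
     (\<forall>S\<in>elems M. \<forall>T\<in>elems M. \<theta> (add_operator S T) = add_operator (\<theta> S) (\<theta> T)) \<and>
     (\<forall>T\<in>elems M. \<forall>c. \<theta> (scale_operator c T) = scale_operator c (\<theta> T))"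

definition vn_normal ::
    "('i, 'x) vn_scheme \<Rightarrow> ('j, 'y) vn_scheme \<Rightarrow> ('i operator \<Rightarrow> 'j operator) \<Rightarrow> bool" where
  "vn_normal M N \<theta> \<longleftrightarrow> (\<forall>\<omega>. normal_functional N \<omega> \<longrightarrow> normal_functional M (\<omega> \<circ> \<theta>))"

definition unital_star_hom ::
    "('i, 'x) vn_scheme \<Rightarrow> ('j, 'y) vn_scheme \<Rightarrow> ('i operator \<Rightarrow> 'j operator) \<Rightarrow> bool" where
  "unital_star_hom M N \<theta> \<longleftrightarrow>
     vn_linear M N \<theta> \<and>
     (\<forall>S\<in>elems M. \<forall>T\<in>elems M. \<theta> (S \<circ> T) = \<theta> S \<circ> \<theta> T) \<and>
     (\<forall>S\<in>elems M. \<forall>T\<in>elems M. is_adjoint (index M) S T \<longrightarrow> is_adjoint (index N) (\<theta> S) (\<theta> T)) \<and>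
     \<theta> (id_operator (index M)) = id_operator (index N)"

definition star_iso ::
    "('i, 'x) vn_scheme \<Rightarrow> ('j, 'y) vn_scheme \<Rightarrow> ('i operator \<Rightarrow> 'j operator) \<Rightarrow> bool" where
  "star_iso M N \<theta> \<longleftrightarrow> unital_star_hom M N \<theta> \<and> bij_betw \<theta> (elems M) (elems N)"

text \<open>
  For normal unital \<open>*\<close>-homomorphisms \<open>f : M \<rightarrow> P\<close> and \<open>g : N \<rightarrow> Q\<close>, the normal unital
  \<open>*\<close>-homomorphism \<open>f \<otimes> g\<close> from \<open>M \<otimes> N\<close> to \<open>P \<otimes> Q\<close>. It exists, and is unique on
  \<open>elems (vn_tensor M N)\<close> by normality; off that set its values are irrelevant.
\<close>

definition tensor_hom ::
    "('i, 'x) vn_scheme \<Rightarrow> ('j, 'y) vn_scheme \<Rightarrow> ('k, 'z) vn_scheme \<Rightarrow> ('l, 'w) vn_scheme \<Rightarrow>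
     ('i operator \<Rightarrow> 'k operator) \<Rightarrow> ('j operator \<Rightarrow> 'l operator) \<Rightarrow>
     ('i \<times> 'j) operator \<Rightarrow> ('k \<times> 'l) operator" where
  "tensor_hom M N P Q f g = (SOME \<theta>.
     unital_star_hom (vn_tensor M N) (vn_tensor P Q) \<theta> \<and>
     vn_normal (vn_tensor M N) (vn_tensor P Q) \<theta> \<and>
     (\<forall>S\<in>elems M. \<forall>T\<in>elems N.
        \<theta> (tensor_operator (index M) (index N) S T) =
        tensor_operator (index P) (index Q) (f S) (g T)))"

text \<open>
  The slice maps \<open>id \<otimes> \<phi>\<close> and \<open>\<phi> \<otimes> id\<close> of a normal functional \<open>\<phi>\<close>, again determined on
  \<open>elems (vn_tensor M N)\<close> by normality.
\<close>

definition slice_snd ::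
    "('i, 'x) vn_scheme \<Rightarrow> ('j, 'y) vn_scheme \<Rightarrow> ('j operator \<Rightarrow> complex) \<Rightarrow>
     ('i \<times> 'j) operator \<Rightarrow> 'i operator" where
  "slice_snd M N \<phi> = (SOME E.
     vn_linear (vn_tensor M N) M E \<and> vn_normal (vn_tensor M N) M E \<and>
     (\<forall>S\<in>elems M. \<forall>T\<in>elems N.
        E (tensor_operator (index M) (index N) S T) = scale_operator (\<phi> T) S))"

definition slice_fst ::
    "('i, 'x) vn_scheme \<Rightarrow> ('j, 'y) vn_scheme \<Rightarrow> ('i operator \<Rightarrow> complex) \<Rightarrow>
     ('i \<times> 'j) operator \<Rightarrow> 'j operator" where
  "slice_fst M N \<phi> = (SOME E.
     vn_linear (vn_tensor M N) N E \<and> vn_normal (vn_tensor M N) N E \<and>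
     (\<forall>S\<in>elems M. \<forall>T\<in>elems N.
        E (tensor_operator (index M) (index N) S T) = scale_operator (\<phi> S) T))"

definition faithful_normal_state :: "('i, 'x) vn_scheme \<Rightarrow> ('i operator \<Rightarrow> complex) \<Rightarrow> bool" where
  "faithful_normal_state M \<phi> \<longleftrightarrow>
     normal_functional M \<phi> \<and>
     \<phi> (id_operator (index M)) = 1 \<and>
     (\<forall>T\<in>elems M. \<forall>S\<in>elems M. is_adjoint (index M) T S \<longrightarrow>
        \<phi> (S \<circ> T) \<in> \<real>\<^sub>\<ge>\<^sub>0 \<and> (\<phi> (S \<circ> T) = 0 \<longrightarrow> T = zero_operator))"


section \<open>Compact quantum groups\<close>

record 'i qgroup = "'i vn" +
  comult :: "'i operator \<Rightarrow> ('i \<times> 'i) operator"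

definition is_haar_state :: "('i, 'x) qgroup_scheme \<Rightarrow> ('i operator \<Rightarrow> complex) \<Rightarrow> bool" where
  "is_haar_state A \<phi> \<longleftrightarrow>
     faithful_normal_state A \<phi> \<and>
     (\<forall>T\<in>elems A.
        slice_snd A A \<phi> (comult A T) = scale_operator (\<phi> T) (id_operator (index A)) \<and>
        slice_fst A A \<phi> (comult A T) = scale_operator (\<phi> T) (id_operator (index A)))"

definition compact_quantum_group :: "('i, 'x) qgroup_scheme \<Rightarrow> bool" where
  "compact_quantum_group A \<longleftrightarrow>
     von_neumann_algebra A \<and>
     unital_star_hom A (vn_tensor A A) (comult A) \<and>
     vn_normal A (vn_tensor A A) (comult A) \<and>
     inj_on (comult A) (elems A) \<and>
     (\<forall>T\<in>elems A.
        tensor_hom A A (vn_tensor A A) A (comult A) id (comult A T) =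
        assoc_operator (tensor_hom A A A (vn_tensor A A) id (comult A) (comult A T))) \<and>
     (\<exists>\<phi>. is_haar_state A \<phi>)"

text \<open>The Haar state is unique as a function on \<open>elems A\<close>.\<close>

definition haar_state :: "('i, 'x) qgroup_scheme \<Rightarrow> 'i operator \<Rightarrow> complex" where
  "haar_state A = (SOME \<phi>. is_haar_state A \<phi>)"

definition kac_type :: "('i, 'x) qgroup_scheme \<Rightarrow> bool" where
  "kac_type A \<longleftrightarrow>
     compact_quantum_group A \<and>
     (\<forall>S\<in>elems A. \<forall>T\<in>elems A. haar_state A (S \<circ> T) = haar_state A (T \<circ> S))"

definition qgroup_iso ::
    "('i, 'x) qgroup_scheme \<Rightarrow> ('j, 'y) qgroup_scheme \<Rightarrow>
     ('i operator \<Rightarrow> 'j operator) \<Rightarrow> bool" where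
  "qgroup_iso A B \<theta> \<longleftrightarrow>
     star_iso A B \<theta> \<and>
     (\<forall>T\<in>elems A. comult B (\<theta> T) = tensor_hom A A B B \<theta> \<theta> (comult A T))"

definition qgroup_action ::
    "('g, 'm) monoid_scheme \<Rightarrow> ('i, 'x) qgroup_scheme \<Rightarrow>
     ('g \<Rightarrow> 'i operator \<Rightarrow> 'i operator) \<Rightarrow> bool" where
  "qgroup_action G A \<alpha> \<longleftrightarrow>
     (\<forall>g\<in>carrier G. qgroup_iso A A (\<alpha> g)) \<and>
     (\<forall>g\<in>carrier G. \<forall>h\<in>carrier G. \<forall>T\<in>elems A. \<alpha> (g \<otimes>\<^bsub>G\<^esub> h) T = \<alpha> g (\<alpha> h T))"

text \<open>
  The type argument is the index type of the Hilbert spaces on which the competitors \<open>B\<close> act;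
  HOL cannot quantify over it here, so a theorem about all \<open>B\<close> leaves it a free type variable.
\<close>

definition rigid_relative_to ::
    "'j itself \<Rightarrow> ('g, 'm) monoid_scheme \<Rightarrow> 'i qgroup \<Rightarrow>
     ('g \<Rightarrow> 'i operator \<Rightarrow> 'i operator) \<Rightarrow> bool" where
  "rigid_relative_to (_ :: 'j itself) G A \<alpha> \<longleftrightarrow>
     kac_type A \<and> qgroup_action G A \<alpha> \<and>
     (\<forall>(B :: 'j qgroup) \<beta> \<pi>.
        kac_type B \<and> qgroup_action G B \<beta> \<and>
        star_iso A B \<pi> \<and> (\<forall>T\<in>elems A. haar_state B (\<pi> T) = haar_state A T) \<and>
        (\<forall>g\<in>carrier G. \<forall>T\<in>elems A. \<beta> g (\<pi> T) = \<pi> (\<alpha> g T))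
        \<longrightarrow> (\<exists>\<pi>\<^sub>0 \<zeta>. qgroup_iso A B \<pi>\<^sub>0 \<and> \<zeta> \<in> auto G \<and>
              (\<forall>g\<in>carrier G. \<forall>T\<in>elems A. \<beta> (\<zeta> g) (\<pi>\<^sub>0 T) = \<pi>\<^sub>0 (\<alpha> g T))))"


section \<open>Finite groups as compact quantum groups\<close>

text \<open>\<open>L\<^sup>\<infinity>(K)\<close> consists of the multiplication operators on \<open>\<ell>\<^sup>2(K)\<close>; \<open>symbol T\<close> recovers \<open>F\<close> on
  \<open>K\<close> from the operator \<open>T\<close> of multiplication by \<open>F\<close>.\<close>

definition mult_operator :: "'i set \<Rightarrow> ('i \<Rightarrow> complex) \<Rightarrow> 'i operator" where
  "mult_operator I F = (\<lambda>x. if x \<in> ell2 I then (\<lambda>i. F i * x i) else (\<lambda>_. 0))"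

definition symbol :: "'i operator \<Rightarrow> 'i \<Rightarrow> complex" where
  "symbol T i = T (delta_vec i) i"

definition finite_qgroup :: "('k, 'm) monoid_scheme \<Rightarrow> 'k qgroup" where
  "finite_qgroup K =
     \<lparr>index = carrier K,
      elems = range (mult_operator (carrier K)),
      comult = (\<lambda>T. mult_operator (carrier K \<times> carrier K)
                       (\<lambda>(k1, k2). symbol T (k1 \<otimes>\<^bsub>K\<^esub> k2)))\<rparr>"

definition aut_action ::
    "('k, 'm) monoid_scheme \<Rightarrow> ('k \<Rightarrow> 'k) \<Rightarrow> 'k operator \<Rightarrow> 'k operator" where
  "aut_action K \<alpha> T =
     mult_operator (carrier K) (symbol T \<circ> inv_into (carrier K) \<alpha>)"

definition rigid_relative_to_Aut :: "'j itself \<Rightarrow> ('k, 'm) monoid_scheme \<Rightarrow> bool" where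
  "rigid_relative_to_Aut TJ K \<longleftrightarrow>
     rigid_relative_to TJ (AutoGroup K) (finite_qgroup K) (aut_action K)"


section \<open>The groups \<open>SL\<^sub>2\<close>, \<open>PSL\<^sub>2\<close> and \<open>PGL\<^sub>2\<close>\<close>

definition GL2 :: "('f::field ^ 2 ^ 2) monoid" where
  "GL2 = \<lparr>carrier = {A. invertible A}, mult = (**), one = mat 1\<rparr>"

definition SL2 :: "('f::field ^ 2 ^ 2) monoid" where
  "SL2 = \<lparr>carrier = {A. det A = 1}, mult = (**), one = mat 1\<rparr>"

definition scalar_matrices :: "('f::field ^ 2 ^ 2) set" where
  "scalar_matrices = range mat"

definition PGL2 :: "('f::field ^ 2 ^ 2) set monoid" where
  "PGL2 = GL2 Mod (carrier GL2 \<inter> scalar_matrices)"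

definition PSL2 :: "('f::field ^ 2 ^ 2) set monoid" where
  "PSL2 = SL2 Mod (carrier SL2 \<inter> scalar_matrices)"

end

theory Submission
  imports Defs "HOL-Algebra.Sylow" "HOL-Algebra.Group_Action" "HOL-Algebra.Multiplicative_Group"
begin

text \<open>
  A competitor \<open>B\<close> is isomorphic to \<open>L\<^sup>\<infinity>(K)\<close> as a von Neumann algebra, so it is spanned by finitely
  many orthogonal projections indexed by \<open>K\<close>. Normal \<open>*\<close>-homomorphisms between such algebras are dual
  to maps between the index sets, and therefore \<open>B\<close> amounts to a second group law \<open>\<Lambda>\<close> on the set \<open>K\<close>
  with \<open>Aut K \<subseteq> Aut \<Lambda>\<close>; it suffices to prove \<open>\<Lambda> \<cong> K\<close>.

  Conjugation gives an action of \<open>GL\<^sub>2\<close> on \<open>\<Lambda>\<close> by automorphisms. As \<open>p\<^sup>2\<close> does not divide the order of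
  \<open>\<Lambda>\<close>, counting fixed points shows that every element of order \<open>p\<close> lies in one of the conjugates \<open>V z\<close>,
  with \<open>z\<close> in the projective line, of the subgroup of order \<open>p\<close> in the group of fixed points of the
  unipotent matrix with upper right entry \<open>1\<close>. The group \<open>\<Lambda>\<close> permutes these subgroups, and the
  resulting equivariant representation \<open>rho\<close> on the projective line has an image between \<open>PSL\<^sub>2\<close> and
  \<open>PGL\<^sub>2\<close>. Comparing orders then settles \<open>PSL\<^sub>2\<close>, \<open>PGL\<^sub>2\<close>, and \<open>SL\<^sub>2\<close> for \<open>p = 2\<close>.

  For \<open>SL\<^sub>2\<close> and odd \<open>p\<close> the kernel of \<open>rho\<close> has order two. The unipotent matrices have unique lifts
  \<open>X t\<close>, \<open>Y t\<close> of order dividing \<open>p\<close>, and the lifts \<open>H t\<close> of the diagonal matrices built from them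
  are diagonal matrices as elements of the set \<open>K\<close>. Hence they are fixed by conjugation with diagonal
  matrices, which makes \<open>H\<close> multiplicative, and the Bruhat decomposition yields an isomorphism.
\<close>


section \<open>Square summable families and bounded operators\<close>

text \<open>The product of the competitor \<open>\<Lambda>\<close> is unknown, but the fixed points
  of an automorphism in \<open>auto K\<close> are the same set for both products and form a subgroup
  for both. Their number, computed with matrices, therefore restricts \<open>\<Lambda>\<close>: if
  \<open>x\<close> has order \<open>p\<close> in \<open>\<Lambda>\<close> and is fixed by
  \<open>A\<close>, then \<open>p\<close> divides \<open>card (Fix A)\<close>. Every
  \<open>x\<close> is fixed by its own conjugation in \<open>K\<close>, so such an \<open>x\<close>
  has a centralizer in \<open>K\<close> of order divisible by \<open>p\<close>, which makes it
  conjugate to an element commuting with the unipotent matrix. That \<open>p\<^sup>2\<close> does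
  not divide the order is needed a second time: no \<open>V z\<close> can normalize a different
  \<open>V w\<close>, so \<open>rho\<close> is injective on each \<open>V z\<close>. The orders
  alone leave room for a kernel of order two. In \<open>PGL2\<close> its nontrivial element would be
  fixed by all of \<open>GL\<close>, like the neutral element, and there is only one such point. In
  \<open>SL2\<close> the order does not tell the group from \<open>PSL2\<close> times a group of
  order two; the lift of the Weyl element decides this, for a lift of order two would be a diagonal
  matrix.\<close>

lemma ell2_iff:
  "x \<in> ell2 I \<longleftrightarrow> (\<forall>i. i \<notin> I \<longrightarrow> x i = 0) \<and> (\<lambda>i. (cmod (x i))\<^sup>2) summable_on UNIV"
  by (simp add: ell2_def)

lemma l2_norm_sq: "(l2_norm x)\<^sup>2 = (\<Sum>\<^sub>\<infinity>i. (cmod (x i))\<^sup>2)"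
  by (simp add: l2_norm_def infsum_nonneg)

lemma l2_norm_nonneg [simp]: "l2_norm x \<ge> 0"
  by (simp add: l2_norm_def infsum_nonneg)

lemma zero_in_ell2 [simp]: "(\<lambda>_. 0) \<in> ell2 I"
  by (simp add: ell2_def)

lemma cmod_sum_sq_le: "(cmod (a + b))\<^sup>2 \<le> 2 * (cmod a)\<^sup>2 + 2 * (cmod b)\<^sup>2"
proof -
  have "(cmod (a + b))\<^sup>2 \<le> (cmod a + cmod b)\<^sup>2"
    by (simp add: norm_triangle_ineq power_mono)
  also have "\<dots> \<le> 2 * (cmod a)\<^sup>2 + 2 * (cmod b)\<^sup>2"
    using sum_squares_bound[of "cmod a" "cmod b"] by (simp add: power2_sum)
  finally show ?thesis .
qed

lemma summable_on_cmod_sq_scale: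
  assumes "(\<lambda>i. (cmod (x i))\<^sup>2) summable_on A"
  shows "(\<lambda>i. (cmod (c * x i))\<^sup>2) summable_on A"
  using summable_on_cmult_right[OF assms, of "(cmod c)\<^sup>2"]
  by (simp add: norm_mult power_mult_distrib)

lemma summable_on_cmod_sq_add:
  assumes "(\<lambda>i. (cmod (x i))\<^sup>2) summable_on A" "(\<lambda>i. (cmod (y i))\<^sup>2) summable_on A"
  shows "(\<lambda>i. (cmod (x i + y i))\<^sup>2) summable_on A"
proof (rule summable_on_comparison_test)
  show "(\<lambda>i. 2 * (cmod (x i))\<^sup>2 + 2 * (cmod (y i))\<^sup>2) summable_on A"
    by (intro summable_on_add summable_on_cmult_right assms)
qed (auto simp: cmod_sum_sq_le)

lemma ell2_scale: "x \<in> ell2 I \<Longrightarrow> (\<lambda>i. c * x i) \<in> ell2 I"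
  using summable_on_cmod_sq_scale[of x UNIV c] by (simp add: ell2_iff)

lemma ell2_add: "x \<in> ell2 I \<Longrightarrow> y \<in> ell2 I \<Longrightarrow> (\<lambda>i. x i + y i) \<in> ell2 I"
  using summable_on_cmod_sq_add[of x UNIV y] by (simp add: ell2_iff)

lemma ell2_sum:
  assumes "\<And>k. k \<in> K \<Longrightarrow> x k \<in> ell2 I"
  shows "(\<lambda>i. \<Sum>k\<in>K. x k i) \<in> ell2 I"
  using assms by (induction K rule: infinite_finite_induct) (auto intro: ell2_add)

lemma delta_vec_in_ell2: "k \<in> I \<Longrightarrow> delta_vec k \<in> ell2 I"
proof -
  have "(\<lambda>i. (cmod (delta_vec k i))\<^sup>2) summable_on UNIV"
    by (rule summable_on_cong_neutral[THEN iffD1, of _ "{k}"])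
      (auto simp: delta_vec_def)
  then show "k \<in> I \<Longrightarrow> ?thesis"
    by (auto simp: ell2_iff delta_vec_def)
qed

lemma inner_abs_summable:
  assumes "(\<lambda>i. (cmod (x i))\<^sup>2) summable_on UNIV" "(\<lambda>i. (cmod (y i))\<^sup>2) summable_on UNIV"
  shows "(\<lambda>i. norm (cnj (x i) * y i)) summable_on UNIV"
proof (rule summable_on_comparison_test)
  show "(\<lambda>i. (cmod (x i))\<^sup>2 + (cmod (y i))\<^sup>2) summable_on UNIV"
    by (intro summable_on_add assms)
  show "norm (cnj (x i) * y i) \<le> (cmod (x i))\<^sup>2 + (cmod (y i))\<^sup>2" for i
  proof -
    have "2 * (cmod (x i) * cmod (y i)) \<le> (cmod (x i))\<^sup>2 + (cmod (y i))\<^sup>2"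
      using sum_squares_bound[of "cmod (x i)" "cmod (y i)"] by simp
    moreover have "0 \<le> cmod (x i) * cmod (y i)" by simp
    ultimately show ?thesis
      unfolding norm_mult complex_mod_cnj by linarith
  qed
qed auto

lemma inner_summable:
  assumes "x \<in> ell2 I" "y \<in> ell2 J"
  shows "(\<lambda>i. cnj (x i) * y i) summable_on UNIV"
  using assms by (auto simp: ell2_iff intro: abs_summable_summable inner_abs_summable)

lemma l2_inner_add_right:
  assumes "x \<in> ell2 I" "y \<in> ell2 I" "z \<in> ell2 I"
  shows "l2_inner x (\<lambda>i. y i + z i) = l2_inner x y + l2_inner x z"
  using infsum_add[OF inner_summable[OF assms(1,2)] inner_summable[OF assms(1,3)]]
  by (simp add: l2_inner_def distrib_left)

lemma l2_inner_scale_right: "l2_inner x (\<lambda>i. c * y i) = c * l2_inner x y"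
proof -
  have "(\<lambda>i. cnj (x i) * (c * y i)) = (\<lambda>i. c * (cnj (x i) * y i))"
    by (auto simp: mult_ac)
  then show ?thesis
    by (simp only: l2_inner_def infsum_cmult_right')
qed

lemma l2_inner_zero_right [simp]: "l2_inner x (\<lambda>_. 0) = 0"
  by (simp add: l2_inner_def)

lemma l2_inner_zero_left [simp]: "l2_inner (\<lambda>_. 0) x = 0"
  by (simp add: l2_inner_def)

lemma l2_inner_commute: "l2_inner y x = cnj (l2_inner x y)"
  by (simp add: l2_inner_def flip: infsum_cnj) (simp add: mult.commute)

lemma l2_inner_scale_left: "l2_inner (\<lambda>i. c * x i) y = cnj c * l2_inner x y"
  using l2_inner_commute[of "\<lambda>i. c * x i" y] l2_inner_scale_right[of y c x]
    l2_inner_commute[of y x] by simp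

lemma l2_inner_sum_right:
  assumes "x \<in> ell2 I" "\<And>k. k \<in> K \<Longrightarrow> y k \<in> ell2 I"
  shows "l2_inner x (\<lambda>i. \<Sum>k\<in>K. y k i) = (\<Sum>k\<in>K. l2_inner x (y k))"
  using assms(2)
proof (induction K rule: infinite_finite_induct)
  case (insert k K)
  then show ?case
    using l2_inner_add_right[OF assms(1), of "y k" "\<lambda>i. \<Sum>k\<in>K. y k i"] ell2_sum[of K y I]
    by simp
qed auto

lemma l2_inner_sum_left:
  assumes "y \<in> ell2 I" "\<And>k. k \<in> K \<Longrightarrow> x k \<in> ell2 I"
  shows "l2_inner (\<lambda>i. \<Sum>k\<in>K. x k i) y = (\<Sum>k\<in>K. l2_inner (x k) y)"
  by (subst l2_inner_commute)
    (simp add: l2_inner_sum_right[OF assms] flip: l2_inner_commute)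

lemma l2_inner_self:
  assumes "x \<in> ell2 I"
  shows "l2_inner x x = of_real ((l2_norm x)\<^sup>2)"
proof -
  have "((\<lambda>i. (cmod (x i))\<^sup>2) has_sum (l2_norm x)\<^sup>2) UNIV"
    using assms by (simp add: ell2_iff l2_norm_sq summable_iff_has_sum_infsum)
  from has_sum_of_real[OF this, where ?'a = complex]
  have "((\<lambda>i. cnj (x i) * x i) has_sum of_real ((l2_norm x)\<^sup>2)) UNIV"
    unfolding complex_norm_square by (simp add: mult.commute)
  then show ?thesis
    unfolding l2_inner_def by (rule infsumI)
qed

lemma cmod_le_l2_norm:
  assumes "x \<in> ell2 I"
  shows "cmod (x i) \<le> l2_norm x"
proof -
  have "(\<Sum>\<^sub>\<infinity>j\<in>{i}. (cmod (x j))\<^sup>2) \<le> (\<Sum>\<^sub>\<infinity>j. (cmod (x j))\<^sup>2)"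
    using assms by (intro infsum_mono_neutral) (auto simp: ell2_iff)
  then show ?thesis
    by (simp add: l2_norm_def real_le_rsqrt)
qed

lemma l2_norm_eq_0_iff:
  assumes "x \<in> ell2 I"
  shows "l2_norm x = 0 \<longleftrightarrow> x = (\<lambda>_. 0)"
  using cmod_le_l2_norm[OF assms] by (force simp: l2_norm_def)

lemma l2_norm_scale: "l2_norm (\<lambda>i. c * x i) = cmod c * l2_norm x"
  by (simp add: l2_norm_def norm_mult power_mult_distrib infsum_cmult_right' real_sqrt_mult)

lemma l2_norm_sq_add_le:
  assumes "x \<in> ell2 I" "y \<in> ell2 I"
  shows "(l2_norm (\<lambda>i. x i + y i))\<^sup>2 \<le> 2 * (l2_norm x)\<^sup>2 + 2 * (l2_norm y)\<^sup>2"
proof -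
  have sx: "(\<lambda>i. (cmod (x i))\<^sup>2) summable_on UNIV" and sy: "(\<lambda>i. (cmod (y i))\<^sup>2) summable_on UNIV"
    using assms by (auto simp: ell2_iff)
  have "(\<Sum>\<^sub>\<infinity>i. (cmod (x i + y i))\<^sup>2) \<le> (\<Sum>\<^sub>\<infinity>i. 2 * (cmod (x i))\<^sup>2 + 2 * (cmod (y i))\<^sup>2)"
    by (intro infsum_mono summable_on_cmod_sq_add summable_on_add summable_on_cmult_right sx sy
        cmod_sum_sq_le)
  also have "\<dots> = 2 * (\<Sum>\<^sub>\<infinity>i. (cmod (x i))\<^sup>2) + 2 * (\<Sum>\<^sub>\<infinity>i. (cmod (y i))\<^sup>2)"
    by (subst infsum_add) (auto intro!: summable_on_cmult_right sx sy simp: infsum_cmult_right')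
  finally show ?thesis
    by (simp add: l2_norm_sq)
qed

text \<open>Squared norms are sums over the index set, hence additive over the slices of a product;
  in this form bounds for sums, compositions and tensor products need no square roots, and the
  constant can be taken nonnegative.\<close>

lemma bounded_operators_iff_sq:
  "T \<in> bounded_operators I \<longleftrightarrow>
     (\<forall>x\<in>ell2 I. T x \<in> ell2 I) \<and>
     (\<forall>x\<in>ell2 I. \<forall>y\<in>ell2 I. \<forall>c. T (\<lambda>i. c * x i + y i) = (\<lambda>i. c * T x i + T y i)) \<and>
     (\<exists>C\<ge>0. \<forall>x\<in>ell2 I. (l2_norm (T x))\<^sup>2 \<le> C * (l2_norm x)\<^sup>2) \<and>
     (\<forall>x. x \<notin> ell2 I \<longrightarrow> T x = (\<lambda>_. 0))"
proof -
  have "(\<exists>C. \<forall>x\<in>ell2 I. l2_norm (T x) \<le> C * l2_norm x) \<longleftrightarrow>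
        (\<exists>C\<ge>0. \<forall>x\<in>ell2 I. (l2_norm (T x))\<^sup>2 \<le> C * (l2_norm x)\<^sup>2)" (is "?L \<longleftrightarrow> ?R")
  proof
    assume ?L
    then obtain C where C: "\<forall>x\<in>ell2 I. l2_norm (T x) \<le> C * l2_norm x" by blast
    have "(l2_norm (T x))\<^sup>2 \<le> C\<^sup>2 * (l2_norm x)\<^sup>2" if "x \<in> ell2 I" for x
      using power_mono[of "l2_norm (T x)" "C * l2_norm x" 2] C that
      by (simp add: power_mult_distrib)
    then show ?R by (intro exI[of _ "C\<^sup>2"]) auto
  next
    assume ?R
    then obtain C where C: "C \<ge> 0" "\<forall>x\<in>ell2 I. (l2_norm (T x))\<^sup>2 \<le> C * (l2_norm x)\<^sup>2" by blast
    have "l2_norm (T x) \<le> sqrt C * l2_norm x" if "x \<in> ell2 I" for x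
      using C that real_sqrt_le_mono[of "(l2_norm (T x))\<^sup>2" "C * (l2_norm x)\<^sup>2"]
      by (simp add: real_sqrt_mult)
    then show ?L by blast
  qed
  then show ?thesis
    by (simp add: bounded_operators_def)
qed

lemma bounded_operatorsE:
  assumes "T \<in> bounded_operators I"
  obtains C where "C \<ge> 0" "\<And>x. x \<in> ell2 I \<Longrightarrow> (l2_norm (T x))\<^sup>2 \<le> C * (l2_norm x)\<^sup>2"
  using assms unfolding bounded_operators_iff_sq by blast

lemma bounded_operator_in_ell2:
  "T \<in> bounded_operators I \<Longrightarrow> T x \<in> ell2 I"
  by (cases "x \<in> ell2 I") (auto simp: bounded_operators_def)

lemma bounded_operator_outside:
  "T \<in> bounded_operators I \<Longrightarrow> x \<notin> ell2 I \<Longrightarrow> T x = (\<lambda>_. 0)"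
  by (simp add: bounded_operators_def)

lemma bounded_operator_linear:
  "T \<in> bounded_operators I \<Longrightarrow> x \<in> ell2 I \<Longrightarrow> y \<in> ell2 I \<Longrightarrow>
    T (\<lambda>i. c * x i + y i) = (\<lambda>i. c * T x i + T y i)"
  by (simp add: bounded_operators_def)

lemma bounded_operator_zero:
  assumes "T \<in> bounded_operators I"
  shows "T (\<lambda>_. 0) = (\<lambda>_. 0)"
  using bounded_operator_linear[OF assms, of "\<lambda>_. 0" "\<lambda>_. 0" 1] by (simp add: fun_eq_iff)

lemma bounded_operator_scale:
  assumes "T \<in> bounded_operators I" "x \<in> ell2 I"
  shows "T (\<lambda>i. c * x i) = (\<lambda>i. c * T x i)"
  using bounded_operator_linear[OF assms, of "\<lambda>_. 0" c] bounded_operator_zero[OF assms(1)] by simp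

lemma bounded_operator_add:
  assumes "T \<in> bounded_operators I" "x \<in> ell2 I" "y \<in> ell2 I"
  shows "T (\<lambda>i. x i + y i) = (\<lambda>i. T x i + T y i)"
  using bounded_operator_linear[OF assms, of 1] by simp

lemma bounded_operator_sum:
  assumes "T \<in> bounded_operators I" "\<And>k. k \<in> K \<Longrightarrow> x k \<in> ell2 I"
  shows "T (\<lambda>i. \<Sum>k\<in>K. x k i) = (\<lambda>i. \<Sum>k\<in>K. T (x k) i)"
  using assms(2)
proof (induction K rule: infinite_finite_induct)
  case (insert k K)
  then show ?case
    using bounded_operator_add[OF assms(1), of "x k" "\<lambda>i. \<Sum>k\<in>K. x k i"] ell2_sum[of K x I]
    by simp
qed (auto simp: bounded_operator_zero[OF assms(1)])

lemma bounded_operators_compose: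
  assumes S: "S \<in> bounded_operators I" and T: "T \<in> bounded_operators I"
  shows "S \<circ> T \<in> bounded_operators I"
proof -
  obtain C where C: "C \<ge> 0" "\<And>x. x \<in> ell2 I \<Longrightarrow> (l2_norm (S x))\<^sup>2 \<le> C * (l2_norm x)\<^sup>2"
    by (rule bounded_operatorsE[OF S]) blast
  obtain D where D: "D \<ge> 0" "\<And>x. x \<in> ell2 I \<Longrightarrow> (l2_norm (T x))\<^sup>2 \<le> D * (l2_norm x)\<^sup>2"
    by (rule bounded_operatorsE[OF T]) blast
  have "(l2_norm (S (T x)))\<^sup>2 \<le> C * D * (l2_norm x)\<^sup>2" if "x \<in> ell2 I" for x
    using order_trans[OF C(2)[OF bounded_operator_in_ell2[OF T]] mult_left_mono[OF D(2)[OF that] C(1)]]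
    by (simp add: mult_ac)
  then show ?thesis
    unfolding bounded_operators_iff_sq
    using S T C(1) D(1)
    by (auto simp: bounded_operator_in_ell2 bounded_operator_linear bounded_operator_outside
        bounded_operator_zero intro!: exI[of _ "C * D"])
qed

lemma bounded_operators_add:
  assumes S: "S \<in> bounded_operators I" and T: "T \<in> bounded_operators I"
  shows "add_operator S T \<in> bounded_operators I"
proof -
  obtain C where C: "C \<ge> 0" "\<And>x. x \<in> ell2 I \<Longrightarrow> (l2_norm (S x))\<^sup>2 \<le> C * (l2_norm x)\<^sup>2"
    by (rule bounded_operatorsE[OF S]) blast
  obtain D where D: "D \<ge> 0" "\<And>x. x \<in> ell2 I \<Longrightarrow> (l2_norm (T x))\<^sup>2 \<le> D * (l2_norm x)\<^sup>2"
    by (rule bounded_operatorsE[OF T]) blast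
  have "(l2_norm (\<lambda>i. S x i + T x i))\<^sup>2 \<le> (2 * C + 2 * D) * (l2_norm x)\<^sup>2" if "x \<in> ell2 I" for x
    using l2_norm_sq_add_le[OF bounded_operator_in_ell2[OF S] bounded_operator_in_ell2[OF T], of x x]
      C(2)[OF that] D(2)[OF that]
    by (simp add: algebra_simps)
  then show ?thesis
    unfolding bounded_operators_iff_sq add_operator_def
    using S T C(1) D(1)
    by (auto simp: bounded_operator_in_ell2 bounded_operator_linear bounded_operator_outside
        ell2_add distrib_left add.assoc add.left_commute intro!: exI[of _ "2 * C + 2 * D"])
qed

lemma bounded_operators_scale:
  assumes T: "T \<in> bounded_operators I"
  shows "scale_operator c T \<in> bounded_operators I"
proof -
  obtain D where D: "D \<ge> 0" "\<And>x. x \<in> ell2 I \<Longrightarrow> (l2_norm (T x))\<^sup>2 \<le> D * (l2_norm x)\<^sup>2"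
    by (rule bounded_operatorsE[OF T]) blast
  have "(l2_norm (\<lambda>i. c * T x i))\<^sup>2 \<le> ((cmod c)\<^sup>2 * D) * (l2_norm x)\<^sup>2" if "x \<in> ell2 I" for x
    using mult_left_mono[OF D(2)[OF that], of "(cmod c)\<^sup>2"]
    by (simp add: l2_norm_scale power_mult_distrib mult.assoc)
  then show ?thesis
    unfolding bounded_operators_iff_sq scale_operator_def
    using T D(1)
    by (auto simp: bounded_operator_in_ell2 bounded_operator_linear bounded_operator_outside
        ell2_scale distrib_left mult.left_commute intro!: exI[of _ "(cmod c)\<^sup>2 * D"])
qed

lemma zero_operator_bounded: "zero_operator \<in> bounded_operators I"
  unfolding bounded_operators_iff_sq zero_operator_def
  by (auto simp: l2_norm_def intro!: exI[of _ 0])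

text \<open>A coordinate of \<open>E x\<close> serves as the functional, which is bounded because
  coordinates are bounded by the norm. With \<open>E\<close> an atom and \<open>\<xi>\<close> in its
  range these operators commute with all atoms and serve as test operators for the double
  commutant.\<close>

definition rank_one :: "'i operator \<Rightarrow> 'i \<Rightarrow> ('i \<Rightarrow> complex) \<Rightarrow> 'i operator" where
  "rank_one E j \<xi> = (\<lambda>x i. E x j * \<xi> i)"

lemma rank_one_bounded:
  assumes E: "E \<in> bounded_operators I" and "\<xi> \<in> ell2 I"
  shows "rank_one E j \<xi> \<in> bounded_operators I"
proof -
  obtain D where D: "D \<ge> 0" "\<And>x. x \<in> ell2 I \<Longrightarrow> (l2_norm (E x))\<^sup>2 \<le> D * (l2_norm x)\<^sup>2"
    by (rule bounded_operatorsE[OF E]) blast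
  have "(l2_norm (\<lambda>i. E x j * \<xi> i))\<^sup>2 \<le> (D * (l2_norm \<xi>)\<^sup>2) * (l2_norm x)\<^sup>2" if "x \<in> ell2 I" for x
  proof -
    have "(cmod (E x j))\<^sup>2 \<le> D * (l2_norm x)\<^sup>2"
      by (rule order_trans[OF power_mono D(2)[OF that]])
        (simp_all add: cmod_le_l2_norm[OF bounded_operator_in_ell2[OF E]])
    from mult_right_mono[OF this, of "(l2_norm \<xi>)\<^sup>2"] show ?thesis
      unfolding l2_norm_scale power_mult_distrib by (simp add: mult_ac)
  qed
  then show ?thesis
    unfolding bounded_operators_iff_sq rank_one_def
    using E D(1) assms(2)
    by (auto simp: bounded_operator_linear bounded_operator_outside
        ell2_scale distrib_right mult.assoc intro!: exI[of _ "D * (l2_norm \<xi>)\<^sup>2"])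
qed


section \<open>Slices of vectors on a product, and amplifications of operators\<close>

lemma cmod_sq_summable_Sigma:
  fixes x :: "'i \<times> 'j \<Rightarrow> complex"
  shows "(\<lambda>ij. (cmod (x ij))\<^sup>2) summable_on UNIV \<longleftrightarrow>
    (\<forall>i. (\<lambda>j. (cmod (x (i, j)))\<^sup>2) summable_on UNIV) \<and>
    (\<lambda>i. (l2_norm (\<lambda>j. x (i, j)))\<^sup>2) summable_on UNIV"
  using Infinite_Sum.abs_summable_on_Sigma_iff[of "\<lambda>ij. (cmod (x ij))\<^sup>2" UNIV "\<lambda>_. UNIV"]
  by (simp add: l2_norm_sq infsum_nonneg)

lemma l2_norm_sq_Sigma:
  fixes x :: "'i \<times> 'j \<Rightarrow> complex"
  assumes "x \<in> ell2 K"
  shows "(l2_norm x)\<^sup>2 = (\<Sum>\<^sub>\<infinity>i. (l2_norm (\<lambda>j. x (i, j)))\<^sup>2)"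
  using infsum_Sigma_banach[of "\<lambda>ij. (cmod (x ij))\<^sup>2" UNIV "\<lambda>_. UNIV"] assms
  by (simp add: l2_norm_sq ell2_iff)

lemma ell2_slice_right:
  assumes "x \<in> ell2 (I \<times> J)"
  shows "(\<lambda>j. x (i, j)) \<in> ell2 J"
  using assms cmod_sq_summable_Sigma[of x] by (auto simp: ell2_iff)

lemma ell2_swap:
  "x \<in> ell2 (I \<times> J) \<longleftrightarrow> x \<circ> prod.swap \<in> ell2 (J \<times> I)"
proof -
  have "(\<lambda>ij. (cmod (x (prod.swap ij)))\<^sup>2) summable_on UNIV \<longleftrightarrow> (\<lambda>ij. (cmod (x ij))\<^sup>2) summable_on UNIV"
    by (rule summable_on_reindex_bij_betw) (rule bij_swap)
  then show ?thesis
    by (auto simp: ell2_iff)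
qed

lemma l2_norm_swap: "l2_norm (x \<circ> prod.swap) = l2_norm x"
proof -
  have "(\<Sum>\<^sub>\<infinity>ij. (cmod (x (prod.swap ij)))\<^sup>2) = (\<Sum>\<^sub>\<infinity>ij. (cmod (x ij))\<^sup>2)"
    by (rule infsum_reindex_bij_betw) (rule bij_swap)
  then show ?thesis
    by (simp add: l2_norm_def)
qed

lemma l2_inner_swap: "l2_inner (x \<circ> prod.swap) (y \<circ> prod.swap) = l2_inner x y"
  unfolding l2_inner_def comp_def
  by (rule infsum_reindex_bij_betw[of prod.swap UNIV UNIV "\<lambda>i. cnj (x i) * y i"]) (rule bij_swap)

lemma ell2_slice_left:
  assumes "x \<in> ell2 (I \<times> J)"
  shows "(\<lambda>i. x (i, j)) \<in> ell2 I"
  using ell2_slice_right[OF ell2_swap[THEN iffD1, OF assms], of j] by simp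

lemma l2_inner_Sigma:
  fixes x y :: "'i \<times> 'j \<Rightarrow> complex"
  assumes "x \<in> ell2 K" "y \<in> ell2 K"
  shows "l2_inner x y = (\<Sum>\<^sub>\<infinity>i. l2_inner (\<lambda>j. x (i, j)) (\<lambda>j. y (i, j)))"
  using infsum_Sigma_banach[of "\<lambda>ij. cnj (x ij) * y ij" UNIV "\<lambda>_. UNIV"] inner_summable[OF assms]
  by (simp add: l2_inner_def)

text \<open>The amplifications \<open>1 \<otimes> T\<close> and \<open>S \<otimes> 1\<close>.\<close>

definition amp_right :: "'j operator \<Rightarrow> ('i \<times> 'j) operator" where
  "amp_right T = (\<lambda>x (i, j). T (\<lambda>j'. x (i, j')) j)"

definition amp_left :: "'i operator \<Rightarrow> ('i \<times> 'j) operator" where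
  "amp_left S = (\<lambda>x (i, j). S (\<lambda>i'. x (i', j)) i)"

text \<open>Exchanging the two variables lets the norm bound and the adjoint of
  \<open>amp_left\<close> follow from those of \<open>amp_right\<close>.\<close>

lemma amp_left_eq: "amp_left S x = amp_right S (x \<circ> prod.swap) \<circ> prod.swap"
  by (auto simp: amp_left_def amp_right_def)

lemma tensor_operator_eq:
  "x \<in> ell2 (I \<times> J) \<Longrightarrow> tensor_operator I J S T x = amp_left S (amp_right T x)"
  by (simp add: tensor_operator_def amp_left_def amp_right_def)

text \<open>The bound for \<open>T\<close> holds in each row, and by \<open>l2_norm_sq_Sigma\<close>
  the squared norm is the sum over the rows.\<close>

lemma amp_right_ell2:
  fixes x :: "'i \<times> 'j \<Rightarrow> complex"
  assumes T: "T \<in> bounded_operators J" and x: "x \<in> ell2 (I \<times> J)"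
    and C: "C \<ge> 0" "\<And>x. x \<in> ell2 J \<Longrightarrow> (l2_norm (T x))\<^sup>2 \<le> C * (l2_norm x)\<^sup>2"
  shows "amp_right T x \<in> ell2 (I \<times> J)"
    and "(l2_norm (amp_right T x))\<^sup>2 \<le> C * (l2_norm x)\<^sup>2"
proof -
  let ?y = "amp_right T x"
  have s: "(\<lambda>i. (l2_norm (\<lambda>j. x (i, j)))\<^sup>2) summable_on UNIV"
    using x cmod_sq_summable_Sigma[of x] by (simp add: ell2_iff)
  have y: "(\<lambda>j. ?y (i, j)) = T (\<lambda>j. x (i, j))" for i
    by (simp add: amp_right_def)
  have sl: "(\<lambda>j. x (i, j)) \<in> ell2 J" for i
    using ell2_slice_right[OF x] .
  have le: "(l2_norm (\<lambda>j. ?y (i, j)))\<^sup>2 \<le> C * (l2_norm (\<lambda>j. x (i, j)))\<^sup>2" for i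
    unfolding y by (rule C(2)[OF sl])
  have s': "(\<lambda>i. (l2_norm (\<lambda>j. ?y (i, j)))\<^sup>2) summable_on UNIV"
    by (rule summable_on_comparison_test[OF summable_on_cmult_right[OF s, of C]])
      (use le in auto)
  have yJ: "(\<lambda>j. ?y (i, j)) \<in> ell2 J" for i
    unfolding y using bounded_operator_in_ell2[OF T] .
  have "?y (i, j) = 0" if "(i, j) \<notin> I \<times> J" for i j
  proof (cases "j \<in> J")
    case True
    then have "(\<lambda>j. x (i, j)) = (\<lambda>_. 0)"
      using that x by (auto simp: ell2_iff)
    then show ?thesis
      by (simp add: amp_right_def bounded_operator_zero[OF T])
  next
    case False
    then show ?thesis
      using yJ[of i] by (simp add: ell2_iff)
  qed
  moreover have "(\<lambda>ij. (cmod (?y ij))\<^sup>2) summable_on UNIV"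
    unfolding cmod_sq_summable_Sigma[of ?y] using s' yJ by (simp add: ell2_iff)
  ultimately show y2: "?y \<in> ell2 (I \<times> J)"
    by (auto simp: ell2_iff)
  show "(l2_norm ?y)\<^sup>2 \<le> C * (l2_norm x)\<^sup>2"
    unfolding l2_norm_sq_Sigma[OF y2] l2_norm_sq_Sigma[OF x] infsum_cmult_right'[symmetric]
    by (intro infsum_mono s' summable_on_cmult_right s le)
qed

lemma amp_right_in_ell2:
  assumes "T \<in> bounded_operators J" "x \<in> ell2 (I \<times> J)"
  shows "amp_right T x \<in> ell2 (I \<times> J)"
  by (rule bounded_operatorsE[OF assms(1)]) (blast intro: amp_right_ell2(1)[OF assms])

lemma amp_left_ell2:
  assumes "S \<in> bounded_operators I" "x \<in> ell2 (I \<times> J)"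
    and "C \<ge> 0" "\<And>x. x \<in> ell2 I \<Longrightarrow> (l2_norm (S x))\<^sup>2 \<le> C * (l2_norm x)\<^sup>2"
  shows "amp_left S x \<in> ell2 (I \<times> J)"
    and "(l2_norm (amp_left S x))\<^sup>2 \<le> C * (l2_norm x)\<^sup>2"
  using amp_right_ell2[OF assms(1) ell2_swap[THEN iffD1, OF assms(2)] assms(3,4)]
  unfolding amp_left_eq l2_norm_swap by (simp_all only: ell2_swap[symmetric] l2_norm_swap)

lemma amp_left_in_ell2:
  assumes "S \<in> bounded_operators I" "x \<in> ell2 (I \<times> J)"
  shows "amp_left S x \<in> ell2 (I \<times> J)"
  by (rule bounded_operatorsE[OF assms(1)]) (blast intro: amp_left_ell2(1)[OF assms])

lemma amp_right_linear:
  assumes "T \<in> bounded_operators J" "x \<in> ell2 (I \<times> J)" "y \<in> ell2 (I \<times> J)"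
  shows "amp_right T (\<lambda>i. c * x i + y i) = (\<lambda>i. c * amp_right T x i + amp_right T y i)"
  using bounded_operator_linear[OF assms(1) ell2_slice_right[OF assms(2)] ell2_slice_right[OF assms(3)]]
  by (auto simp: amp_right_def)

lemma amp_left_linear:
  assumes "S \<in> bounded_operators I" "x \<in> ell2 (I \<times> J)" "y \<in> ell2 (I \<times> J)"
  shows "amp_left S (\<lambda>i. c * x i + y i) = (\<lambda>i. c * amp_left S x i + amp_left S y i)"
  using bounded_operator_linear[OF assms(1) ell2_slice_left[OF assms(2)] ell2_slice_left[OF assms(3)]]
  by (auto simp: amp_left_def)

lemma tensor_operator_bounded:
  assumes S: "S \<in> bounded_operators I" and T: "T \<in> bounded_operators J"
  shows "tensor_operator I J S T \<in> bounded_operators (I \<times> J)"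
proof -
  obtain C where C: "C \<ge> 0" "\<And>x. x \<in> ell2 I \<Longrightarrow> (l2_norm (S x))\<^sup>2 \<le> C * (l2_norm x)\<^sup>2"
    by (rule bounded_operatorsE[OF S]) blast
  obtain D where D: "D \<ge> 0" "\<And>x. x \<in> ell2 J \<Longrightarrow> (l2_norm (T x))\<^sup>2 \<le> D * (l2_norm x)\<^sup>2"
    by (rule bounded_operatorsE[OF T]) blast
  have "(l2_norm (amp_left S (amp_right T x)))\<^sup>2 \<le> C * D * (l2_norm x)\<^sup>2" if "x \<in> ell2 (I \<times> J)" for x
    using amp_left_ell2(2)[OF S amp_right_in_ell2[OF T that] C]
      mult_left_mono[OF amp_right_ell2(2)[OF T that D] C(1)]
    by (simp add: mult.assoc)
  moreover have "tensor_operator I J S T (\<lambda>i. c * x i + y i) =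
      (\<lambda>i. c * tensor_operator I J S T x i + tensor_operator I J S T y i)"
    if "x \<in> ell2 (I \<times> J)" "y \<in> ell2 (I \<times> J)" for x y c
    using that
    by (simp add: tensor_operator_eq ell2_add ell2_scale amp_right_linear[OF T] amp_left_linear[OF S, where J = J]
        amp_right_in_ell2[OF T])
  ultimately show ?thesis
    unfolding bounded_operators_iff_sq using C(1) D(1)
    by (auto simp: tensor_operator_eq amp_right_in_ell2[OF T] amp_left_in_ell2[OF S] 
        intro!: exI[of _ "C * D"]) (simp add: tensor_operator_def)
qed

section \<open>Self-adjoint operators and their tensor products\<close>

definition self_adjoint :: "'i set \<Rightarrow> 'i operator \<Rightarrow> bool" where
  "self_adjoint I T \<longleftrightarrow> T \<in> bounded_operators I \<and> is_adjoint I T T"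

lemma self_adjoint_bounded: "self_adjoint I T \<Longrightarrow> T \<in> bounded_operators I"
  by (simp add: self_adjoint_def)

lemma l2_inner_delta: "l2_inner (delta_vec i) x = x i"
proof -
  have "(\<Sum>\<^sub>\<infinity>j. cnj (delta_vec i j) * x j) = (\<Sum>\<^sub>\<infinity>j\<in>{i}. x j)"
    by (rule infsum_cong_neutral) (auto simp: delta_vec_def)
  then show ?thesis
    by (simp add: l2_inner_def)
qed

text \<open>Row \<open>i\<close> of the matrix of \<open>S\<close> is the conjugate of the vector
  \<open>S (delta_vec i)\<close>, which is square summable. This turns amplifications into
  absolutely convergent double series.\<close>

lemma self_adjoint_entry:
  assumes "self_adjoint I S" "i \<in> I" "x \<in> ell2 I"
  shows "S x i = l2_inner (S (delta_vec i)) x"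
  using assms l2_inner_delta[of i "S x"] delta_vec_in_ell2[of i I]
  by (auto simp: self_adjoint_def is_adjoint_def)

lemma elementary_ell2:
  assumes "x \<in> ell2 I" "y \<in> ell2 J"
  shows "(\<lambda>(i, j). x i * y j) \<in> ell2 (I \<times> J)"
proof -
  have "(\<lambda>j. (cmod (x i * y j))\<^sup>2) summable_on UNIV" for i
    using summable_on_cmod_sq_scale[of y UNIV "x i"] assms by (simp add: ell2_iff)
  moreover have "(\<lambda>i. (l2_norm (\<lambda>j. x i * y j))\<^sup>2) summable_on UNIV"
    using assms by (simp add: l2_norm_scale power_mult_distrib summable_on_cmult_left ell2_iff)
  ultimately have "(\<lambda>ij. (cmod (case ij of (i, j) \<Rightarrow> x i * y j))\<^sup>2) summable_on UNIV"
    by (subst cmod_sq_summable_Sigma) simp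
  then show ?thesis
    using assms by (auto simp: ell2_iff)
qed

text \<open>Both sides are the same double series, which converges absolutely.\<close>

lemma amp_commute:
  fixes S :: "'i operator" and T :: "'j operator"
  assumes S: "self_adjoint I S" and T: "self_adjoint J T" and x: "x \<in> ell2 (I \<times> J)"
  shows "amp_left S (amp_right T x) = amp_right T (amp_left S x)"
proof (rule ext, clarify)
  fix i j
  note Sb = self_adjoint_bounded[OF S] and Tb = self_adjoint_bounded[OF T]
  show "amp_left S (amp_right T x) (i, j) = amp_right T (amp_left S x) (i, j)"
  proof (cases "i \<in> I \<and> j \<in> J")
    case True
    define s where "s = S (delta_vec i)"
    define t where "t = T (delta_vec j)"
    have s: "s \<in> ell2 I" and t: "t \<in> ell2 J"
      by (simp_all add: s_def t_def bounded_operator_in_ell2[OF Sb] bounded_operator_in_ell2[OF Tb])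
    have "amp_left S (amp_right T x) (i, j) = l2_inner s (\<lambda>i'. amp_right T x (i', j))"
      unfolding s_def using True
      by (simp add: amp_left_def self_adjoint_entry[OF S]
          ell2_slice_left[OF amp_right_in_ell2[OF Tb x]])
    also have "\<dots> = l2_inner s (\<lambda>i'. l2_inner t (\<lambda>j'. x (i', j')))"
      unfolding t_def using True
      by (simp add: amp_right_def self_adjoint_entry[OF T] ell2_slice_right[OF x])
    also have "\<dots> = (\<Sum>\<^sub>\<infinity>i'. \<Sum>\<^sub>\<infinity>j'. cnj (s i') * (cnj (t j') * x (i', j')))"
      by (simp add: l2_inner_def infsum_cmult_right')
    also have "\<dots> = (\<Sum>\<^sub>\<infinity>j'. \<Sum>\<^sub>\<infinity>i'. cnj (s i') * (cnj (t j') * x (i', j')))"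
      by (rule infsum_swap_banach)
        (use inner_summable[OF elementary_ell2[OF s t] x] in \<open>simp add: case_prod_unfold mult.assoc\<close>)
    also have "\<dots> = (\<Sum>\<^sub>\<infinity>j'. \<Sum>\<^sub>\<infinity>i'. cnj (t j') * (cnj (s i') * x (i', j')))"
      by (simp add: mult.left_commute)
    also have "\<dots> = l2_inner t (\<lambda>j'. l2_inner s (\<lambda>i'. x (i', j')))"
      by (simp add: l2_inner_def infsum_cmult_right')
    also have "\<dots> = l2_inner t (\<lambda>j'. amp_left S x (i, j'))"
      unfolding s_def using True
      by (simp add: amp_left_def self_adjoint_entry[OF S] ell2_slice_left[OF x])
    also have "\<dots> = amp_right T (amp_left S x) (i, j)"
      unfolding t_def using True
      by (simp add: amp_right_def self_adjoint_entry[OF T]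
          ell2_slice_right[OF amp_left_in_ell2[OF Sb x]])
    finally show ?thesis .
  next
    case False
    then show ?thesis
      using amp_left_in_ell2[OF Sb amp_right_in_ell2[OF Tb x]]
        amp_right_in_ell2[OF Tb amp_left_in_ell2[OF Sb x]]
      by (auto simp: ell2_iff)
  qed
qed

lemma amp_right_adjoint:
  assumes T: "self_adjoint J T" and x: "x \<in> ell2 (I \<times> J)" and y: "y \<in> ell2 (I \<times> J)"
  shows "l2_inner (amp_right T x) y = l2_inner x (amp_right T y)"
  unfolding l2_inner_Sigma[OF amp_right_in_ell2[OF self_adjoint_bounded[OF T] x] y]
    l2_inner_Sigma[OF x amp_right_in_ell2[OF self_adjoint_bounded[OF T] y]]
  using T by (simp add: amp_right_def self_adjoint_def is_adjoint_def
      ell2_slice_right[OF x] ell2_slice_right[OF y])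

lemma amp_left_adjoint:
  assumes S: "self_adjoint I S" and x: "x \<in> ell2 (I \<times> J)" and y: "y \<in> ell2 (I \<times> J)"
  shows "l2_inner (amp_left S x) y = l2_inner x (amp_left S y)"
proof -
  have x': "x \<circ> prod.swap \<in> ell2 (J \<times> I)" and y': "y \<circ> prod.swap \<in> ell2 (J \<times> I)"
    using x y by (auto intro: ell2_swap[THEN iffD1])
  have "l2_inner (amp_left S x) y = l2_inner (amp_left S x \<circ> prod.swap) (y \<circ> prod.swap)"
    by (simp only: l2_inner_swap)
  also have "\<dots> = l2_inner (x \<circ> prod.swap) (amp_left S y \<circ> prod.swap)"
    using amp_right_adjoint[OF S x' y'] by (simp add: amp_left_eq comp_assoc)
  finally show ?thesis
    by (simp only: l2_inner_swap)
qed

lemma tensor_operator_self_adjoint: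
  assumes S: "self_adjoint I S" and T: "self_adjoint J T"
  shows "self_adjoint (I \<times> J) (tensor_operator I J S T)"
proof -
  note Sb = self_adjoint_bounded[OF S] and Tb = self_adjoint_bounded[OF T]
  have "l2_inner (tensor_operator I J S T x) y = l2_inner x (tensor_operator I J S T y)"
    if x: "x \<in> ell2 (I \<times> J)" and y: "y \<in> ell2 (I \<times> J)" for x y
    using x y amp_left_adjoint[OF S amp_right_in_ell2[OF Tb x] y]
      amp_right_adjoint[OF T x amp_left_in_ell2[OF Sb y]] amp_commute[OF S T y]
    by (simp add: tensor_operator_eq)
  then show ?thesis
    by (simp add: self_adjoint_def tensor_operator_bounded Sb Tb is_adjoint_def)
qed

text \<open>\<open>amp_commute\<close> exchanges the two middle factors \<open>T\<close> and
  \<open>S'\<close>; self-adjointness is what it asks of them.\<close>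

lemma tensor_operator_compose:
  assumes S: "S \<in> bounded_operators I" and T: "self_adjoint J T"
    and S': "self_adjoint I S'" and T': "T' \<in> bounded_operators J"
  shows "tensor_operator I J S T \<circ> tensor_operator I J S' T' = tensor_operator I J (S \<circ> S') (T \<circ> T')"
proof
  fix x
  note Tb = self_adjoint_bounded[OF T] and S'b = self_adjoint_bounded[OF S']
  show "(tensor_operator I J S T \<circ> tensor_operator I J S' T') x =
      tensor_operator I J (S \<circ> S') (T \<circ> T') x"
  proof (cases "x \<in> ell2 (I \<times> J)")
    case True
    have "amp_left S (amp_right T (amp_left S' (amp_right T' x))) =
        amp_left S (amp_left S' (amp_right T (amp_right T' x)))"
      by (simp add: amp_commute[OF S' T amp_right_in_ell2[OF T' True]])
    also have "\<dots> = amp_left (S \<circ> S') (amp_right (T \<circ> T') x)"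
      by (auto simp: amp_left_def amp_right_def)
    finally show ?thesis
      using True by (simp add: tensor_operator_eq amp_left_in_ell2[OF S'b] amp_right_in_ell2[OF T'])
  next
    case False
    then show ?thesis
      using bounded_operator_zero[OF tensor_operator_bounded[OF S Tb]] by (simp add: tensor_operator_def)
  qed
qed

lemma tensor_operator_id:
  "tensor_operator I J (id_operator I) (id_operator J) = id_operator (I \<times> J)"
  by (auto simp: fun_eq_iff tensor_operator_def id_operator_def ell2_slice_right ell2_slice_left)

lemma tensor_operator_nonzero:
  assumes S: "S \<in> bounded_operators I" and T: "T \<in> bounded_operators J"
    and "S \<noteq> zero_operator" "T \<noteq> zero_operator"
  shows "tensor_operator I J S T \<noteq> zero_operator"
proof -
  obtain x i where x: "S x i \<noteq> 0"
    using assms(3) by (auto simp: zero_operator_def fun_eq_iff)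
  obtain y j where y: "T y j \<noteq> 0"
    using assms(4) by (auto simp: zero_operator_def fun_eq_iff)
  have "x \<in> ell2 I" "y \<in> ell2 J"
    using x y bounded_operator_outside[OF S, of x] bounded_operator_outside[OF T, of y] by force+
  then have "tensor_operator I J S T (\<lambda>(i, j). x i * y j) (i, j) = S x i * T y j"
    using tensor_operator_elementary[OF S T _ _ elementary_ell2] by simp
  then show ?thesis
    using x y by (auto simp: zero_operator_def)
qed


section \<open>Finite-dimensional abelian von Neumann algebras\<close>

definition comb :: "('k \<Rightarrow> 'i operator) \<Rightarrow> 'k set \<Rightarrow> ('k \<Rightarrow> complex) \<Rightarrow> 'i operator" where
  "comb P K c = (\<lambda>x i. \<Sum>k\<in>K. c k * P k x i)"

lemma comb_cong: "(\<And>k. k \<in> K \<Longrightarrow> c k = d k) \<Longrightarrow> comb P K c = comb P K d"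
  by (simp add: comb_def)

lemma comb_cong_ops: "(\<And>k. k \<in> K \<Longrightarrow> P k = Q k) \<Longrightarrow> comb P K c = comb Q K c"
  by (simp add: comb_def)

lemma comb_add: "add_operator (comb P K c) (comb P K d) = comb P K (\<lambda>k. c k + d k)"
  by (simp add: comb_def add_operator_def distrib_right sum.distrib)

lemma comb_scale: "scale_operator a (comb P K c) = comb P K (\<lambda>k. a * c k)"
  by (simp add: comb_def scale_operator_def sum_distrib_left mult.assoc)

lemma comb_empty [simp]: "comb P {} c = zero_operator"
  by (simp add: comb_def zero_operator_def)

lemma comb_insert:
  "finite K \<Longrightarrow> k \<notin> K \<Longrightarrow>
    comb P (insert k K) c = add_operator (scale_operator (c k) (P k)) (comb P K c)"
  by (simp add: comb_def add_operator_def scale_operator_def)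

lemma comb_comb:
  "comb (\<lambda>k. comb Q L (d k)) K c = comb Q L (\<lambda>l. \<Sum>k\<in>K. c k * d k l)"
  unfolding comb_def by (rule ext)+ (simp add: sum_distrib_left sum_distrib_right mult.assoc sum.swap[of _ L])

lemma comb_bounded:
  assumes "finite K" "\<And>k. k \<in> K \<Longrightarrow> P k \<in> bounded_operators I"
  shows "comb P K c \<in> bounded_operators I"
  using assms
  by (induction K rule: finite_induct)
    (auto simp: comb_insert zero_operator_bounded bounded_operators_add bounded_operators_scale)

lemma comb_reindex:
  assumes "bij_betw f L K"
  shows "comb P K c = comb (P \<circ> f) L (c \<circ> f)"
  unfolding comb_def using sum.reindex_bij_betw[OF assms, symmetric] by fastforce

lemma comb_subset:
  assumes "finite K" "F \<subseteq> K"
  shows "comb P F c = comb P K (\<lambda>k. if k \<in> F then c k else 0)"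
  unfolding comb_def using assms
  by (intro ext sum.mono_neutral_cong_left) auto

text \<open>The coordinate at \<open>k\<close> is read off from the action on the range of
  \<open>P k\<close>, so that no index set has to be mentioned.\<close>

definition coef :: "('k \<Rightarrow> 'i operator) \<Rightarrow> 'i operator \<Rightarrow> 'k \<Rightarrow> complex" where
  "coef P T k = (SOME z. T \<circ> P k = scale_operator z (P k))"

text \<open>The span of such a family is a copy of the functions on \<open>K\<close> with pointwise
  operations; the \<open>P k\<close> are the indicator functions of the points.\<close>

locale resolution =
  fixes I :: "'i set" and K :: "'k set" and P :: "'k \<Rightarrow> 'i operator"
  assumes fin: "finite K"
    and self_adj: "\<And>k. k \<in> K \<Longrightarrow> self_adjoint I (P k)"
    and nonzero: "\<And>k. k \<in> K \<Longrightarrow> P k \<noteq> zero_operator"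
    and orth: "\<And>k l. k \<in> K \<Longrightarrow> l \<in> K \<Longrightarrow> P k \<circ> P l = (if k = l then P k else zero_operator)"
    and complete: "comb P K (\<lambda>_. 1) = id_operator I"
begin

lemma atom_bounded: "k \<in> K \<Longrightarrow> P k \<in> bounded_operators I"
  using self_adj self_adjoint_bounded by blast

lemma atom_ell2: "k \<in> K \<Longrightarrow> P k x \<in> ell2 I"
  using atom_bounded bounded_operator_in_ell2 by blast

lemma comb_in_bounded: "comb P K c \<in> bounded_operators I"
  using fin atom_bounded by (intro comb_bounded)

lemma atom_atom: "k \<in> K \<Longrightarrow> l \<in> K \<Longrightarrow> P k (P l x) = (if k = l then P k x else (\<lambda>_. 0))"
  using fun_cong[OF orth[of k l], of x] by (auto simp: zero_operator_def)

lemma comb_atom_right: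
  assumes "k \<in> K"
  shows "comb P K c \<circ> P k = scale_operator (c k) (P k)"
proof (intro ext)
  fix x i
  have "(\<Sum>l\<in>K. c l * P l (P k x) i) = (\<Sum>l\<in>K. if l = k then c k * P k x i else 0)"
    using assms by (intro sum.cong) (auto simp: atom_atom)
  then show "(comb P K c \<circ> P k) x i = scale_operator (c k) (P k) x i"
    using assms fin by (simp add: comb_def scale_operator_def)
qed

lemma atom_sum:
  assumes k: "k \<in> K"
  shows "P k (\<lambda>i. \<Sum>l\<in>K. c l * P l x i) = (\<lambda>i. c k * P k x i)"
proof -
  have "P k (\<lambda>i. \<Sum>l\<in>K. c l * P l x i) = (\<lambda>i. \<Sum>l\<in>K. P k (\<lambda>i. c l * P l x i) i)"
    using k by (intro bounded_operator_sum[OF atom_bounded]) (auto intro: ell2_scale atom_ell2)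
  also have "\<dots> = (\<lambda>i. \<Sum>l\<in>K. if l = k then c k * P k x i else 0)"
  proof (intro ext sum.cong refl)
    fix i l assume l: "l \<in> K"
    show "P k (\<lambda>i. c l * P l x i) i = (if l = k then c k * P k x i else 0)"
      using fun_cong[OF bounded_operator_scale[OF atom_bounded[OF k] atom_ell2[OF l]]] k l
      by (simp add: atom_atom)
  qed
  also have "\<dots> = (\<lambda>i. c k * P k x i)"
    using k fin by simp
  finally show ?thesis .
qed

lemma atom_comb_left: "k \<in> K \<Longrightarrow> P k \<circ> comb P K c = scale_operator (c k) (P k)"
  by (rule ext) (simp add: comb_def scale_operator_def atom_sum)

lemma comb_compose: "comb P K c \<circ> comb P K d = comb P K (\<lambda>k. c k * d k)"
proof (intro ext)
  fix x i
  have "(comb P K c \<circ> comb P K d) x i = (\<Sum>k\<in>K. c k * (P k \<circ> comb P K d) x i)"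
    by (simp add: comb_def)
  also have "\<dots> = comb P K (\<lambda>k. c k * d k) x i"
    by (simp add: atom_comb_left) (simp add: comb_def scale_operator_def mult.assoc)
  finally show "(comb P K c \<circ> comb P K d) x i = comb P K (\<lambda>k. c k * d k) x i" .
qed

lemma atom_eq_comb: "k \<in> K \<Longrightarrow> P k = comb P K (\<lambda>l. if l = k then 1 else 0)"
proof (intro ext)
  fix x i assume k: "k \<in> K"
  have "(\<Sum>l\<in>K. (if l = k then 1 else 0) * P l x i) = (\<Sum>l\<in>K. if l = k then P l x i else 0)"
    by (intro sum.cong) auto
  then show "P k x i = comb P K (\<lambda>l. if l = k then 1 else 0) x i"
    using k fin by (simp add: comb_def)
qed

lemma scale_atom_inj:
  assumes "k \<in> K" "scale_operator a (P k) = scale_operator b (P k)"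
  shows "a = b"
proof -
  obtain x i where "P k x i \<noteq> 0"
    using nonzero[OF assms(1)] by (auto simp: zero_operator_def fun_eq_iff)
  then show ?thesis
    using fun_cong[OF fun_cong[OF assms(2)], of x i] by (simp add: scale_operator_def)
qed

lemma coef_comb:
  assumes "k \<in> K"
  shows "coef P (comb P K c) k = c k"
  unfolding coef_def
proof (rule some_equality)
  show "comb P K c \<circ> P k = scale_operator (c k) (P k)"
    by (rule comb_atom_right[OF assms])
  show "z = c k" if "comb P K c \<circ> P k = scale_operator z (P k)" for z
    using that scale_atom_inj[OF assms] comb_atom_right[OF assms] by metis
qed

lemma comb_eq_iff: "comb P K c = comb P K d \<longleftrightarrow> (\<forall>k\<in>K. c k = d k)"
  by (metis coef_comb comb_cong)

text \<open>A vector in the range of \<open>P k\<close> turns every combination into its coordinate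
  at \<open>k\<close>. Such vectors detect adjoints and supply normal functionals.\<close>

lemma unit_vector_in_atom:
  assumes k: "k \<in> K"
  obtains v where "v \<in> ell2 I" "l2_inner v v = 1" "\<And>c. comb P K c v = (\<lambda>i. c k * v i)"
proof -
  obtain x i where x: "P k x i \<noteq> 0"
    using nonzero[OF k] by (auto simp: zero_operator_def fun_eq_iff)
  define u where "u = P k x"
  have u: "u \<in> ell2 I"
    unfolding u_def by (rule atom_ell2[OF k])
  have n: "l2_norm u \<noteq> 0"
    using l2_norm_eq_0_iff[OF u] x by (auto simp: u_def)
  define v where "v = (\<lambda>i. complex_of_real (1 / l2_norm u) * u i)"
  have cu: "comb P K c u = (\<lambda>i. c k * u i)" for c
    using fun_cong[OF comb_atom_right[OF k, of c], of x] by (simp add: u_def scale_operator_def)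
  have "l2_inner v v = 1"
    unfolding v_def l2_inner_scale_right l2_inner_scale_left l2_inner_self[OF u]
    using n by (simp add: power2_eq_square)
  moreover have "comb P K c v = (\<lambda>i. c k * v i)" for c
    unfolding v_def bounded_operator_scale[OF comb_in_bounded u] cu by (simp add: mult_ac)
  moreover have "v \<in> ell2 I"
    unfolding v_def by (rule ell2_scale[OF u])
  ultimately show ?thesis
    using that[of v] by blast
qed

lemma is_adjoint_comb_iff:
  "is_adjoint I (comb P K c) (comb P K d) \<longleftrightarrow> (\<forall>k\<in>K. d k = cnj (c k))"
proof
  assume adj: "is_adjoint I (comb P K c) (comb P K d)"
  show "\<forall>k\<in>K. d k = cnj (c k)"
  proof
    fix k assume "k \<in> K"
    then obtain v where v: "v \<in> ell2 I" "l2_inner v v = 1" "\<And>c. comb P K c v = (\<lambda>i. c k * v i)"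
      by (rule unit_vector_in_atom) blast
    have "l2_inner (comb P K c v) v = l2_inner v (comb P K d v)"
      using adj v(1) by (simp add: is_adjoint_def)
    then show "d k = cnj (c k)"
      by (simp add: v(2,3) l2_inner_scale_right l2_inner_scale_left)
  qed
next
  assume d: "\<forall>k\<in>K. d k = cnj (c k)"
  show "is_adjoint I (comb P K c) (comb P K d)"
    unfolding is_adjoint_def
  proof (intro ballI)
    fix x y assume x: "x \<in> ell2 I" and y: "y \<in> ell2 I"
    have "l2_inner (comb P K c x) y = (\<Sum>k\<in>K. cnj (c k) * l2_inner (P k x) y)"
      unfolding comb_def
      by (subst l2_inner_sum_left[OF y]) (auto intro: ell2_scale atom_ell2 simp: l2_inner_scale_left)
    also have "\<dots> = (\<Sum>k\<in>K. d k * l2_inner x (P k y))"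
      using d self_adj x y by (intro sum.cong) (auto simp: self_adjoint_def is_adjoint_def)
    also have "\<dots> = l2_inner x (comb P K d y)"
      unfolding comb_def
      by (subst l2_inner_sum_right[OF x]) (auto intro: ell2_scale atom_ell2 simp: l2_inner_scale_right)
    finally show "l2_inner (comb P K c x) y = l2_inner x (comb P K d y)" .
  qed
qed

text \<open>An operator in the double commutant commutes with the operators of rank one on the range of
  each atom, hence is scalar on that range.\<close>

lemma double_commutant:
  assumes X: "X \<subseteq> range (comb P K)" and PX: "\<And>k. k \<in> K \<Longrightarrow> P k \<in> X"
  shows "commutant I (commutant I X) = range (comb P K)"
proof
  have comm: "S \<circ> comb P K c = comb P K c \<circ> S"
    if S: "S \<in> bounded_operators I" and "\<And>k. k \<in> K \<Longrightarrow> S \<circ> P k = P k \<circ> S" for S c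
  proof
    fix x
    have "S (comb P K c x) = (\<lambda>i. \<Sum>k\<in>K. S (\<lambda>i. c k * P k x i) i)"
      unfolding comb_def by (intro bounded_operator_sum[OF S]) (auto intro: ell2_scale atom_ell2)
    also have "\<dots> = (\<lambda>i. \<Sum>k\<in>K. c k * P k (S x) i)"
      using that(2) by (intro ext sum.cong refl)
        (simp add: bounded_operator_scale[OF S atom_ell2] fun_eq_iff)
    finally show "(S \<circ> comb P K c) x = (comb P K c \<circ> S) x"
      by (simp add: comb_def)
  qed
  show "range (comb P K) \<subseteq> commutant I (commutant I X)"
  proof
    fix T assume "T \<in> range (comb P K)"
    then obtain c where T: "T = comb P K c" by blast
    then show "T \<in> commutant I (commutant I X)"
      using comb_in_bounded comm PX by (auto simp: commutant_def)
  qed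
  show "commutant I (commutant I X) \<subseteq> range (comb P K)"
  proof
    fix T assume T: "T \<in> commutant I (commutant I X)"
    then have Tb: "T \<in> bounded_operators I"
      by (simp add: commutant_def)
    have "\<exists>z. \<forall>x. T (P k x) = (\<lambda>i. z * P k x i)" if k: "k \<in> K" for k
    proof -
      obtain y j where y: "P k y j \<noteq> 0"
        using nonzero[OF k] by (auto simp: zero_operator_def fun_eq_iff)
      have yI: "y \<in> ell2 I"
        by (rule ccontr) (use y bounded_operator_outside[OF atom_bounded[OF k], of y] in simp)
      \<comment> \<open>\<open>T\<close> commutes with every \<open>?R\<close>; applying both
        products to \<open>y\<close> gives the scalar, which does not depend on
        \<open>x\<close>.\<close>
      have "T (P k x) = (\<lambda>i. (P k (T y) j / P k y j) * P k x i)" for x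
      proof -
        let ?R = "rank_one (P k) j (P k x)"
        have Rb: "?R \<in> bounded_operators I"
          by (rule rank_one_bounded[OF atom_bounded[OF k] atom_ell2[OF k]])
        have "?R \<circ> P l = P l \<circ> ?R" if l: "l \<in> K" for l
        proof
          fix z
          have "P l (\<lambda>i. P k z j * P k x i) = (\<lambda>i. P k z j * P l (P k x) i)"
            by (rule bounded_operator_scale[OF atom_bounded[OF l] atom_ell2[OF k]])
          then show "(?R \<circ> P l) z = (P l \<circ> ?R) z"
            using k l by (auto simp: rank_one_def atom_atom)
        qed
        then have "?R \<circ> comb P K c = comb P K c \<circ> ?R" for c
          by (rule comm[OF Rb])
        then have "?R \<in> commutant I X"
          using Rb X by (auto simp: commutant_def)
        then have "T \<circ> ?R = ?R \<circ> T"
          using T by (simp add: commutant_def)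
        then have "T (\<lambda>i. P k y j * P k x i) = (\<lambda>i. P k (T y) j * P k x i)"
          by (simp add: fun_eq_iff rank_one_def)
        then have "P k y j * T (P k x) i = P k (T y) j * P k x i" for i
          by (simp add: bounded_operator_scale[OF Tb atom_ell2[OF k]] fun_eq_iff)
        then show ?thesis
          using y by (auto simp: field_simps)
      qed
      then show ?thesis by blast
    qed
    then obtain z where z: "T (P k x) = (\<lambda>i. z k * P k x i)" if "k \<in> K" for k x
      by metis
    have "T x = comb P K z x" for x
    proof (cases "x \<in> ell2 I")
      case True
      have "x = (\<lambda>i. \<Sum>k\<in>K. P k x i)"
        using fun_cong[OF complete, of x] True by (simp add: comb_def id_operator_def)
      then have "T x = T (\<lambda>i. \<Sum>k\<in>K. P k x i)" by simp
      also have "\<dots> = (\<lambda>i. \<Sum>k\<in>K. T (P k x) i)"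
        by (intro bounded_operator_sum[OF Tb] atom_ell2)
      finally show ?thesis
        by (simp add: comb_def z)
    next
      case False
      then show ?thesis
        by (simp add: bounded_operator_outside[OF Tb] bounded_operator_outside[OF comb_in_bounded])
    qed
    then show "T \<in> range (comb P K)" by blast
  qed
qed

end

locale atomic = resolution "index M" K P
  for M :: "('i, 'x) vn_scheme" and K :: "'k set" and P :: "'k \<Rightarrow> 'i operator" +
  assumes elems_eq: "elems M = range (comb P K)"
begin

lemma comb_in_elems [simp]: "comb P K c \<in> elems M"
  by (simp add: elems_eq)

lemma atom_in_elems: "k \<in> K \<Longrightarrow> P k \<in> elems M"
  by (subst atom_eq_comb) auto

lemma elemsE:
  assumes "T \<in> elems M"
  obtains c where "T = comb P K c"
  using assms by (auto simp: elems_eq)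

lemma von_neumann: "von_neumann_algebra M"
proof -
  have "\<exists>S\<in>elems M. is_adjoint (index M) T S" if T_in: "T \<in> elems M" for T
  proof -
    obtain c where "T = comb P K c" by (rule elemsE[OF T_in]) blast
    then show ?thesis
      using is_adjoint_comb_iff[of c "\<lambda>k. cnj (c k)"] by auto
  qed
  then show ?thesis
    unfolding von_neumann_algebra_def
    using double_commutant[of "elems M"] comb_in_bounded atom_in_elems by (auto simp: elems_eq)
qed

lemma vn_linear_comb:
  assumes "vn_linear M N \<theta>"
  shows "\<theta> (comb P K c) = comb (\<lambda>k. \<theta> (P k)) K c"
proof -
  have add: "\<theta> (add_operator S T) = add_operator (\<theta> S) (\<theta> T)" if "S \<in> elems M" "T \<in> elems M" for S T
    using assms that by (simp add: vn_linear_def)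
  have scale: "\<theta> (scale_operator a T) = scale_operator a (\<theta> T)" if "T \<in> elems M" for a T
    using assms that by (simp add: vn_linear_def)
  have "\<theta> (comb P F c) = comb (\<lambda>k. \<theta> (P k)) F c" if "F \<subseteq> K" for F
    using finite_subset[OF that fin] that
  proof (induction F rule: finite_induct)
    case empty
    have "zero_operator \<in> elems M"
      using comb_in_elems[of "\<lambda>_. 0"] by (simp add: comb_def zero_operator_def)
    from scale[OF this, of 0] show ?case
      by (simp add: scale_operator_def zero_operator_def)
  next
    case (insert k F)
    then have k: "k \<in> K" and F: "F \<subseteq> K" by auto
    have "scale_operator (c k) (P k) \<in> elems M"
      by (subst atom_eq_comb[OF k]) (simp add: comb_scale)
    moreover have "comb P F c \<in> elems M"
      by (simp add: comb_subset[OF fin F])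
    ultimately show ?case
      using insert F by (simp add: comb_insert add scale atom_in_elems k)
  qed
  then show ?thesis by blast
qed

text \<open>Linearity is not part of \<open>normal_functional\<close>; it is obtained termwise from
  the representing series.\<close>

lemma normal_functional_comb:
  assumes "normal_functional M \<omega>"
  shows "\<omega> (comb P K c) = (\<Sum>k\<in>K. c k * \<omega> (P k))"
proof -
  obtain \<xi> \<eta> :: "nat \<Rightarrow> 'i \<Rightarrow> complex" where
    e: "\<And>n. \<xi> n \<in> ell2 (index M)" "\<And>n. \<eta> n \<in> ell2 (index M)" and
    s: "\<And>T. T \<in> elems M \<Longrightarrow> (\<lambda>n. l2_inner (\<xi> n) (T (\<eta> n))) sums \<omega> T"
    using assms unfolding normal_functional_def by blast
  have "(\<lambda>n. \<Sum>k\<in>K. c k * l2_inner (\<xi> n) (P k (\<eta> n))) sums (\<Sum>k\<in>K. c k * \<omega> (P k))"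
    by (intro sums_sum sums_mult s atom_in_elems)
  moreover have "l2_inner (\<xi> n) (comb P K c (\<eta> n)) = (\<Sum>k\<in>K. c k * l2_inner (\<xi> n) (P k (\<eta> n)))" for n
    unfolding comb_def
    by (subst l2_inner_sum_right[OF e(1)]) (auto intro: ell2_scale atom_ell2 simp: l2_inner_scale_right)
  ultimately show ?thesis
    using s[OF comb_in_elems, of c] sums_unique2 by force
qed

text \<open>Coordinates are vector functionals at the unit vectors of the atoms, so a combination of
  them is a finite sum of the required kind, padded with zero vectors.\<close>

lemma normal_functionalI:
  assumes w: "\<And>c. \<omega> (comb P K c) = (\<Sum>k\<in>K. c k * w k)"
  shows "normal_functional M \<omega>"
proof -
  have "\<exists>v. v \<in> ell2 (index M) \<and> l2_inner v v = 1 \<and> (\<forall>c. comb P K c v = (\<lambda>i. c k * v i))"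
    if "k \<in> K" for k
    by (rule unit_vector_in_atom[OF that]) blast
  then obtain v where v: "v k \<in> ell2 (index M)" "l2_inner (v k) (v k) = 1"
      "comb P K c (v k) = (\<lambda>i. c k * v k i)" if "k \<in> K" for k c
    by metis
  obtain h where h: "bij_betw h {..<card K} K"
    using ex_bij_betw_nat_finite[OF fin] by (auto simp: lessThan_atLeast0)
  then have hK: "n < card K \<Longrightarrow> h n \<in> K" for n
    by (auto simp: bij_betw_def)
  \<comment> \<open>The first argument of the inner product is conjugate linear, hence the
    conjugated weight.\<close>
  define \<xi> where "\<xi> n = (if n < card K then (\<lambda>i. cnj (w (h n)) * v (h n) i) else (\<lambda>_. 0))" for n
  define \<eta> where "\<eta> n = (if n < card K then v (h n) else (\<lambda>_. 0))" for n
  have "(\<lambda>n. l2_inner (\<xi> n) (T (\<eta> n))) sums \<omega> T" if T_in: "T \<in> elems M" for T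
  proof -
    obtain c where T: "T = comb P K c" by (rule elemsE[OF T_in]) blast
    have "(\<lambda>n. l2_inner (\<xi> n) (T (\<eta> n))) sums (\<Sum>n<card K. l2_inner (\<xi> n) (T (\<eta> n)))"
      by (rule sums_finite) (auto simp: \<xi>_def)
    also have "(\<Sum>n<card K. l2_inner (\<xi> n) (T (\<eta> n))) = (\<Sum>n<card K. c (h n) * w (h n))"
      by (intro sum.cong refl)
        (auto simp: T \<xi>_def \<eta>_def v hK l2_inner_scale_left l2_inner_scale_right)
    also have "\<dots> = (\<Sum>k\<in>K. c k * w k)"
      by (rule sum.reindex_bij_betw[OF h])
    finally show ?thesis
      by (simp add: T w)
  qed
  moreover have "summable (\<lambda>n. (l2_norm (\<xi> n))\<^sup>2)" "summable (\<lambda>n. (l2_norm (\<eta> n))\<^sup>2)"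
    by (rule summable_finite[of "{..<card K}"]; simp add: \<xi>_def \<eta>_def l2_norm_def)+
  moreover have "\<xi> n \<in> ell2 (index M)" "\<eta> n \<in> ell2 (index M)" for n
    by (auto simp: \<xi>_def \<eta>_def v hK intro: ell2_scale)
  ultimately show ?thesis
    unfolding normal_functional_def by blast
qed

end


text \<open>Finite dimension makes normality automatic: \<open>\<omega> \<circ> \<theta>\<close> is
  a linear combination of coordinates, and \<open>normal_functionalI\<close> covers all of
  these.\<close>

lemma vn_linear_normal:
  assumes "atomic M K P" "atomic N L Q" and lin: "vn_linear M N \<theta>"
  shows "vn_normal M N \<theta>"
  unfolding vn_normal_def
proof (intro allI impI)
  interpret M: atomic M K P by fact
  interpret N: atomic N L Q by fact
  fix \<omega> assume \<omega>: "normal_functional N \<omega>"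
  have "\<exists>d. \<theta> (P k) = comb Q L d" if "k \<in> K" for k
    using lin M.atom_in_elems[OF that] by (auto simp: vn_linear_def N.elems_eq)
  then obtain d where d: "\<theta> (P k) = comb Q L (d k)" if "k \<in> K" for k
    by metis
  have "\<theta> (comb P K c) = comb Q L (\<lambda>l. \<Sum>k\<in>K. c k * d k l)" for c
    unfolding M.vn_linear_comb[OF lin] comb_comb[symmetric] by (rule comb_cong_ops) (rule d)
  then have "\<omega> (\<theta> (comb P K c)) = (\<Sum>k\<in>K. c k * (\<Sum>l\<in>L. d k l * \<omega> (Q l)))" for c
    by (simp add: N.normal_functional_comb[OF \<omega>] sum_distrib_left sum_distrib_right mult.assoc
        sum.swap[of _ L])
  then show "normal_functional M (\<omega> \<circ> \<theta>)"
    by (intro M.normal_functionalI) (simp add: comp_def)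
qed

text \<open>A map \<open>\<tau>\<close> between the index sets of the atoms induces a homomorphism in the other direction,
  and every homomorphism arises in this way.\<close>

definition pullback ::
    "('k \<Rightarrow> 'i operator) \<Rightarrow> ('l \<Rightarrow> 'j operator) \<Rightarrow> 'l set \<Rightarrow> ('l \<Rightarrow> 'k) \<Rightarrow> 'i operator \<Rightarrow> 'j operator" where
  "pullback P Q L \<tau> T = comb Q L (coef P T \<circ> \<tau>)"

lemma pullback_comb:
  assumes "resolution I K P" "\<And>l. l \<in> L \<Longrightarrow> \<tau> l \<in> K"
  shows "pullback P Q L \<tau> (comb P K c) = comb Q L (c \<circ> \<tau>)"
  unfolding pullback_def using assms(2)
  by (intro comb_cong) (simp add: resolution.coef_comb[OF assms(1)])

lemma star_hom_of_index_map:
  assumes "atomic M K P" "atomic N L Q"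
    and \<theta>: "\<And>c. \<theta> (comb P K c) = comb Q L (c \<circ> \<tau>)" and \<tau>: "\<And>l. l \<in> L \<Longrightarrow> \<tau> l \<in> K"
  shows "unital_star_hom M N \<theta>"
proof -
  interpret M: atomic M K P by fact
  interpret N: atomic N L Q by fact
  have "vn_linear M N \<theta>"
    unfolding vn_linear_def M.elems_eq
    by (auto simp: \<theta> comb_add comb_scale comp_def N.elems_eq)
  moreover have "\<forall>S\<in>elems M. \<forall>T\<in>elems M. \<theta> (S \<circ> T) = \<theta> S \<circ> \<theta> T"
    unfolding M.elems_eq by (clarsimp simp: \<theta> M.comb_compose N.comb_compose) (simp add: comp_def)
  moreover have "\<forall>S\<in>elems M. \<forall>T\<in>elems M. is_adjoint (index M) S T \<longrightarrow> is_adjoint (index N) (\<theta> S) (\<theta> T)"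
    unfolding M.elems_eq using \<tau> by (auto simp: \<theta> M.is_adjoint_comb_iff N.is_adjoint_comb_iff)
  moreover have "\<theta> (id_operator (index M)) = id_operator (index N)"
    by (simp add: \<theta> comp_def N.complete flip: M.complete)
  ultimately show ?thesis
    by (simp add: unital_star_hom_def)
qed

text \<open>At a fixed \<open>l\<close> the coordinates of the \<open>\<theta> (P k)\<close> are
  idempotent, mutually orthogonal and sum to one, so exactly one of them is 1. Its index is
  \<open>\<tau> l\<close>: characters of a finite function algebra are evaluations.\<close>

lemma star_hom_index_map:
  assumes "atomic M K P" "atomic N L Q" and hom: "unital_star_hom M N \<theta>"
  obtains \<tau> where "\<And>l. l \<in> L \<Longrightarrow> \<tau> l \<in> K" "\<And>c. \<theta> (comb P K c) = comb Q L (c \<circ> \<tau>)"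
proof -
  interpret M: atomic M K P by fact
  interpret N: atomic N L Q by fact
  have lin: "vn_linear M N \<theta>" and
    mult: "\<And>S T. S \<in> elems M \<Longrightarrow> T \<in> elems M \<Longrightarrow> \<theta> (S \<circ> T) = \<theta> S \<circ> \<theta> T" and
    one: "\<theta> (id_operator (index M)) = id_operator (index N)"
    using hom by (auto simp: unital_star_hom_def)
  have "\<exists>d. \<theta> (P k) = comb Q L d" if "k \<in> K" for k
    using lin M.atom_in_elems[OF that] by (auto simp: vn_linear_def N.elems_eq)
  then obtain d where d: "\<theta> (P k) = comb Q L (d k)" if "k \<in> K" for k
    by metis
  have \<theta>: "\<theta> (comb P K c) = comb Q L (\<lambda>l. \<Sum>k\<in>K. c k * d k l)" for c
    unfolding M.vn_linear_comb[OF lin] comb_comb[symmetric] by (rule comb_cong_ops) (rule d)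
  have sum1: "(\<Sum>k\<in>K. d k l) = 1" if "l \<in> L" for l
    using one that unfolding M.complete[symmetric] N.complete[symmetric] \<theta> N.comb_eq_iff by simp
  have zero: "\<theta> zero_operator = comb Q L (\<lambda>_. 0)"
    using \<theta>[of "\<lambda>_. 0"] by (simp add: comb_def zero_operator_def)
  have prod: "d k l * d k' l = (if k = k' then d k l else 0)" if "k \<in> K" "k' \<in> K" "l \<in> L" for k k' l
  proof -
    have "comb Q L (\<lambda>l. d k l * d k' l) = \<theta> (P k \<circ> P k')"
      using that by (simp add: mult M.atom_in_elems d N.comb_compose)
    also have "\<dots> = comb Q L (\<lambda>l. if k = k' then d k l else 0)"
      using that by (simp add: M.orth d zero)
    finally show ?thesis
      using that by (simp add: N.comb_eq_iff)
  qed
  have "\<exists>k\<in>K. \<forall>k'\<in>K. d k' l = (if k' = k then 1 else 0)" if l: "l \<in> L" for l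
  proof -
    obtain k where k: "k \<in> K" "d k l \<noteq> 0"
      using sum1[OF l] by (metis sum.neutral zero_neq_one)
    have d1: "d k l = 1"
      using prod[OF k(1) k(1) l] k(2) by simp
    have "d k' l = 0" if "k' \<in> K" "k' \<noteq> k" for k'
      using prod[OF that(1) k(1) l] that d1 by simp
    then show ?thesis
      using d1 k(1) by (intro bexI[of _ k]) auto
  qed
  then have "\<forall>l\<in>L. \<exists>k. k \<in> K \<and> (\<forall>k'\<in>K. d k' l = (if k' = k then 1 else 0))"
    by blast
  from bchoice[OF this] obtain \<tau> where
    "\<forall>l\<in>L. \<tau> l \<in> K \<and> (\<forall>k'\<in>K. d k' l = (if k' = \<tau> l then 1 else 0))"
    by blast
  then have \<tau>: "\<And>l. l \<in> L \<Longrightarrow> \<tau> l \<in> K"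
    "\<And>l k'. l \<in> L \<Longrightarrow> k' \<in> K \<Longrightarrow> d k' l = (if k' = \<tau> l then 1 else 0)"
    by auto
  have "\<theta> (comb P K c) = comb Q L (c \<circ> \<tau>)" for c
    unfolding \<theta>
  proof (rule comb_cong)
    fix l assume l: "l \<in> L"
    have "(\<Sum>k\<in>K. c k * d k l) = (\<Sum>k\<in>K. if k = \<tau> l then c k else 0)"
      using \<tau>(2)[OF l] by (intro sum.cong) auto
    then show "(\<Sum>k\<in>K. c k * d k l) = (c \<circ> \<tau>) l"
      using \<tau>(1)[OF l] M.fin by simp
  qed
  with \<tau>(1) show ?thesis
    by (rule that)
qed

text \<open>Take for \<open>c\<close> the indicator function of \<open>\<tau> l\<close>.\<close>

lemma index_map_unique:
  assumes "resolution J L Q" "\<And>c. comb Q L (c \<circ> \<tau>) = comb Q L (c \<circ> \<tau>')" "l \<in> L"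
  shows "\<tau> l = \<tau>' l"
  using assms(2)[of "\<lambda>k. if k = \<tau> l then 1 else 0"] assms(3)
  by (auto simp: resolution.comb_eq_iff[OF assms(1)] split: if_splits)

lemma star_iso_of_index_map:
  assumes "atomic M K P" "atomic N L Q"
    and \<theta>: "\<And>c. \<theta> (comb P K c) = comb Q L (c \<circ> \<tau>)" and \<tau>: "bij_betw \<tau> L K"
  shows "star_iso M N \<theta>"
proof -
  interpret M: atomic M K P by fact
  interpret N: atomic N L Q by fact
  have \<tau>K: "\<tau> l \<in> K" if "l \<in> L" for l
    using \<tau> that by (auto simp: bij_betw_def)
  have "inj_on \<theta> (elems M)"
    unfolding M.elems_eq inj_on_def
    using \<tau> by (auto simp: \<theta> N.comb_eq_iff M.comb_eq_iff bij_betw_def)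
  moreover have "comb Q L d \<in> \<theta> ` range (comb P K)" for d
  proof -
    have "comb Q L d = \<theta> (comb P K (d \<circ> inv_into L \<tau>))"
      unfolding \<theta> using \<tau> by (intro comb_cong) (auto simp: bij_betw_def)
    then show ?thesis by blast
  qed
  ultimately have "bij_betw \<theta> (elems M) (elems N)"
    by (auto simp: bij_betw_def M.elems_eq N.elems_eq \<theta>)
  then show ?thesis
    using star_hom_of_index_map[OF assms(1,2) \<theta> \<tau>K] by (simp add: star_iso_def)
qed

section \<open>Tensor products\<close>

abbreviation tensor_atom ::
    "'i set \<Rightarrow> 'j set \<Rightarrow> ('k \<Rightarrow> 'i operator) \<Rightarrow> ('l \<Rightarrow> 'j operator) \<Rightarrow> 'k \<times> 'l \<Rightarrow> ('i \<times> 'j) operator" where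
  "tensor_atom I J P Q \<equiv> \<lambda>(k, l). tensor_operator I J (P k) (Q l)"

lemma tensor_comb:
  assumes "resolution I K P" "resolution J L Q"
  shows "tensor_operator I J (comb P K c) (comb Q L d) =
    comb (tensor_atom I J P Q) (K \<times> L) (\<lambda>(k, l). c k * d l)"
proof (intro ext)
  interpret M: resolution I K P by fact
  interpret N: resolution J L Q by fact
  fix x and ij :: "'a \<times> 'c"
  obtain i j where ij: "ij = (i, j)" by fastforce
  show "tensor_operator I J (comb P K c) (comb Q L d) x ij =
      comb (tensor_atom I J P Q) (K \<times> L) (\<lambda>(k, l). c k * d l) x ij"
  proof (cases "x \<in> ell2 (I \<times> J)")
    case x: True
    \<comment> \<open>The slice at \<open>j\<close> after \<open>Q l\<close> has acted on the second
      variable; \<open>j\<close> stays fixed while the operators \<open>P k\<close> act on the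
      first.\<close>
    define y where "y l = (\<lambda>i. amp_right (Q l) x (i, j))" for l
    have y: "y l \<in> ell2 I" if "l \<in> L" for l
      unfolding y_def by (rule ell2_slice_left[OF amp_right_in_ell2[OF N.atom_bounded[OF that] x]])
    have "tensor_operator I J (comb P K c) (comb Q L d) x ij =
        (\<Sum>k\<in>K. c k * P k (\<lambda>i. \<Sum>l\<in>L. d l * y l i) i)"
      using x by (simp add: tensor_operator_def ij comb_def y_def amp_right_def)
    also have "\<dots> = (\<Sum>k\<in>K. c k * (\<Sum>l\<in>L. d l * P k (y l) i))"
    proof (intro sum.cong refl)
      fix k assume k: "k \<in> K"
      have "P k (\<lambda>i. \<Sum>l\<in>L. d l * y l i) = (\<lambda>i. \<Sum>l\<in>L. P k (\<lambda>i. d l * y l i) i)"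
        by (intro bounded_operator_sum[OF M.atom_bounded[OF k]] ell2_scale y)
      also have "\<dots> = (\<lambda>i. \<Sum>l\<in>L. d l * P k (y l) i)"
        by (intro ext sum.cong refl) (simp add: bounded_operator_scale[OF M.atom_bounded[OF k] y])
      finally show "c k * P k (\<lambda>i. \<Sum>l\<in>L. d l * y l i) i = c k * (\<Sum>l\<in>L. d l * P k (y l) i)"
        by simp
    qed
    also have "\<dots> = (\<Sum>(k, l)\<in>K \<times> L. c k * d l * P k (y l) i)"
      by (simp add: sum_distrib_left mult.assoc sum.cartesian_product)
    also have "\<dots> = comb (tensor_atom I J P Q) (K \<times> L) (\<lambda>(k, l). c k * d l) x ij"
      unfolding comb_def using x
      by (intro sum.cong refl) (auto simp: tensor_operator_def ij y_def amp_right_def)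
    finally show ?thesis .
  qed (simp add: tensor_operator_def comb_def case_prod_unfold)
qed

lemma tensor_resolution:
  assumes "resolution I K P" "resolution J L Q"
  shows "resolution (I \<times> J) (K \<times> L) (tensor_atom I J P Q)"
proof -
  interpret M: resolution I K P by fact
  interpret N: resolution J L Q by fact
  have zero: "tensor_operator I J S T = zero_operator"
    if "S = zero_operator \<or> T = zero_operator" "S \<in> bounded_operators I" "T \<in> bounded_operators J" for S T
  proof (intro ext)
    fix x ij
    show "tensor_operator I J S T x ij = zero_operator x ij"
      using that(1) bounded_operator_zero[OF that(2)]
      by (auto simp: tensor_operator_def zero_operator_def split: prod.splits)
  qed
  show ?thesis
  proof
    show "finite (K \<times> L)"
      by (simp add: M.fin N.fin)
    show "self_adjoint (I \<times> J) (tensor_atom I J P Q kl)" if "kl \<in> K \<times> L" for kl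
      using that by (auto intro: tensor_operator_self_adjoint M.self_adj N.self_adj)
    show "tensor_atom I J P Q kl \<noteq> zero_operator" if "kl \<in> K \<times> L" for kl
      using that tensor_operator_nonzero[OF M.atom_bounded N.atom_bounded M.nonzero N.nonzero]
      by (cases kl) auto
    show "tensor_atom I J P Q kl \<circ> tensor_atom I J P Q kl' =
        (if kl = kl' then tensor_atom I J P Q kl else zero_operator)"
      if kl: "kl \<in> K \<times> L" "kl' \<in> K \<times> L" for kl kl'
    proof -
      obtain k l k' l' where [simp]: "kl = (k, l)" "kl' = (k', l')" by fastforce
      have "tensor_operator I J (P k) (Q l) \<circ> tensor_operator I J (P k') (Q l') =
          tensor_operator I J (P k \<circ> P k') (Q l \<circ> Q l')"
        using kl by (intro tensor_operator_compose M.atom_bounded N.self_adj M.self_adj N.atom_bounded) auto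
      moreover have "tensor_operator I J (P k \<circ> P k') (Q l \<circ> Q l') = zero_operator" if "kl \<noteq> kl'"
        using kl that by (intro zero bounded_operators_compose M.atom_bounded N.atom_bounded)
          (auto simp: M.orth N.orth)
      ultimately show ?thesis
        using kl by (auto simp: M.orth N.orth)
    qed
    show "comb (tensor_atom I J P Q) (K \<times> L) (\<lambda>_. 1) = id_operator (I \<times> J)"
      using tensor_comb[OF assms, of "\<lambda>_. 1" "\<lambda>_. 1"] 
      by (simp add: M.complete N.complete tensor_operator_id case_prod_unfold)
  qed
qed

lemma index_vn_tensor [simp]: "index (vn_tensor M N) = index M \<times> index N"
  by (simp add: vn_tensor_def Let_def)

text \<open>The elementary tensors lie in the span of the product atoms and include these atoms, so
  \<open>double_commutant\<close> computes the tensor product algebra.\<close>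

lemma tensor_atomic:
  assumes "atomic M K P" "atomic N L Q"
  shows "atomic (vn_tensor M N) (K \<times> L) (tensor_atom (index M) (index N) P Q)"
proof -
  interpret M: atomic M K P by fact
  interpret N: atomic N L Q by fact
  let ?T = "tensor_atom (index M) (index N) P Q"
  interpret T: resolution "index M \<times> index N" "K \<times> L" ?T
    by (rule tensor_resolution) unfold_locales
  have "elems (vn_tensor M N) = range (comb ?T (K \<times> L))"
    unfolding vn_tensor_def Let_def vn.select_convs
  proof (rule T.double_commutant)
    show "{tensor_operator (index M) (index N) S T |S T. S \<in> elems M \<and> T \<in> elems N}
        \<subseteq> range (comb ?T (K \<times> L))"
      by (auto simp: M.elems_eq N.elems_eq tensor_comb[OF M.resolution_axioms N.resolution_axioms])
    show "?T kl \<in> {tensor_operator (index M) (index N) S T |S T. S \<in> elems M \<and> T \<in> elems N}"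
      if "kl \<in> K \<times> L" for kl
      using that M.atom_in_elems N.atom_in_elems by auto
  qed
  then show ?thesis
    using T.resolution_axioms by (simp add: atomic_def atomic_axioms_def)
qed


text \<open>\<open>tensor_hom\<close> is a choice, so two things are needed: pulling back along
  \<open>map_prod \<tau> \<sigma>\<close> satisfies the specification, and the specification
  determines the values on the product atoms, which are elementary tensors.\<close>

lemma tensor_hom_comb:
  assumes "atomic M K P" "atomic N L Q" "atomic M' K' P'" "atomic N' L' Q'"
    and f: "\<And>c. f (comb P K c) = comb P' K' (c \<circ> \<tau>)" and \<tau>: "\<And>k. k \<in> K' \<Longrightarrow> \<tau> k \<in> K"
    and g: "\<And>c. g (comb Q L c) = comb Q' L' (c \<circ> \<sigma>)" and \<sigma>: "\<And>l. l \<in> L' \<Longrightarrow> \<sigma> l \<in> L"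
  shows "tensor_hom M N M' N' f g (comb (tensor_atom (index M) (index N) P Q) (K \<times> L) c) =
    comb (tensor_atom (index M') (index N') P' Q') (K' \<times> L') (c \<circ> map_prod \<tau> \<sigma>)"
proof -
  interpret M: atomic M K P by fact
  interpret N: atomic N L Q by fact
  interpret M': atomic M' K' P' by fact
  interpret N': atomic N' L' Q' by fact
  let ?P = "tensor_atom (index M) (index N) P Q"
  let ?Q = "tensor_atom (index M') (index N') P' Q'"
  have at: "atomic (vn_tensor M N) (K \<times> L) ?P" and at': "atomic (vn_tensor M' N') (K' \<times> L') ?Q"
    by (intro tensor_atomic assms)+
  interpret T: atomic "vn_tensor M N" "K \<times> L" ?P by fact
  define \<theta>\<^sub>0 where "\<theta>\<^sub>0 = pullback ?P ?Q (K' \<times> L') (map_prod \<tau> \<sigma>)"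
  have mp: "map_prod \<tau> \<sigma> kl \<in> K \<times> L" if "kl \<in> K' \<times> L'" for kl
    using that \<tau> \<sigma> by auto
  have \<theta>\<^sub>0: "\<theta>\<^sub>0 (comb ?P (K \<times> L) c) = comb ?Q (K' \<times> L') (c \<circ> map_prod \<tau> \<sigma>)" for c
    unfolding \<theta>\<^sub>0_def by (rule pullback_comb[OF T.resolution_axioms mp])
  have hom: "unital_star_hom (vn_tensor M N) (vn_tensor M' N') \<theta>\<^sub>0"
    by (rule star_hom_of_index_map[OF at at' \<theta>\<^sub>0 mp])
  define \<Phi> where "\<Phi> \<theta> \<longleftrightarrow> unital_star_hom (vn_tensor M N) (vn_tensor M' N') \<theta> \<and>
     vn_normal (vn_tensor M N) (vn_tensor M' N') \<theta> \<and>
     (\<forall>S\<in>elems M. \<forall>T\<in>elems N.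
        \<theta> (tensor_operator (index M) (index N) S T) =
        tensor_operator (index M') (index N') (f S) (g T))" for \<theta>
  have "\<Phi> \<theta>\<^sub>0"
    unfolding \<Phi>_def
  proof (intro conjI ballI hom)
    show "vn_normal (vn_tensor M N) (vn_tensor M' N') \<theta>\<^sub>0"
      using hom by (intro vn_linear_normal[OF at at']) (simp add: unital_star_hom_def)
    show "\<theta>\<^sub>0 (tensor_operator (index M) (index N) S T) =
        tensor_operator (index M') (index N') (f S) (g T)" if "S \<in> elems M" "T \<in> elems N" for S T
      using that unfolding M.elems_eq N.elems_eq
      by (clarsimp simp: f g \<theta>\<^sub>0 tensor_comb[OF M.resolution_axioms N.resolution_axioms]
          tensor_comb[OF M'.resolution_axioms N'.resolution_axioms])
        (auto intro: comb_cong)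
  qed
  moreover have "tensor_hom M N M' N' f g = (SOME \<theta>. \<Phi> \<theta>)"
    by (simp add: tensor_hom_def \<Phi>_def)
  ultimately have "\<Phi> (tensor_hom M N M' N' f g)"
    by (metis someI)
  then have lin: "vn_linear (vn_tensor M N) (vn_tensor M' N') (tensor_hom M N M' N' f g)"
    and on_atoms: "\<And>k l. k \<in> K \<Longrightarrow> l \<in> L \<Longrightarrow> tensor_hom M N M' N' f g (?P (k, l)) = \<theta>\<^sub>0 (?P (k, l))"
    using \<open>\<Phi> \<theta>\<^sub>0\<close> M.atom_in_elems N.atom_in_elems by (auto simp: \<Phi>_def unital_star_hom_def)
  have lin0: "vn_linear (vn_tensor M N) (vn_tensor M' N') \<theta>\<^sub>0"
    using hom by (simp add: unital_star_hom_def)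
  have "tensor_hom M N M' N' f g (comb ?P (K \<times> L) c) = \<theta>\<^sub>0 (comb ?P (K \<times> L) c)"
    unfolding T.vn_linear_comb[OF lin] T.vn_linear_comb[OF lin0]
    by (rule comb_cong_ops) (use on_atoms in auto)
  then show ?thesis
    by (simp add: \<theta>\<^sub>0)
qed

text \<open>Same pattern as for \<open>tensor_hom\<close>: \<open>E\<^sub>0\<close> shows that the
  specification can be met, and linearity together with the values on elementary tensors shows that
  it has one solution on the algebra.\<close>

lemma slice_snd_comb:
  assumes "atomic M K P" "atomic N L Q" and \<phi>: "normal_functional N \<phi>"
  shows "slice_snd M N \<phi> (comb (tensor_atom (index M) (index N) P Q) (K \<times> L) c) =
    comb P K (\<lambda>k. \<Sum>l\<in>L. c (k, l) * \<phi> (Q l))"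
proof -
  interpret M: atomic M K P by fact
  interpret N: atomic N L Q by fact
  let ?P = "tensor_atom (index M) (index N) P Q"
  have at: "atomic (vn_tensor M N) (K \<times> L) ?P"
    by (intro tensor_atomic assms)
  interpret T: atomic "vn_tensor M N" "K \<times> L" ?P by fact
  define E\<^sub>0 where "E\<^sub>0 T = comb P K (\<lambda>k. \<Sum>l\<in>L. coef ?P T (k, l) * \<phi> (Q l))" for T
  have E\<^sub>0: "E\<^sub>0 (comb ?P (K \<times> L) c) = comb P K (\<lambda>k. \<Sum>l\<in>L. c (k, l) * \<phi> (Q l))" for c
    unfolding E\<^sub>0_def by (intro comb_cong sum.cong) (auto simp: T.coef_comb)
  have lin0: "vn_linear (vn_tensor M N) M E\<^sub>0"
    unfolding vn_linear_def T.elems_eq M.elems_eq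
    by (auto simp: E\<^sub>0 comb_add comb_scale distrib_right sum.distrib sum_distrib_left mult.assoc)
  define \<Phi> where "\<Phi> E \<longleftrightarrow> vn_linear (vn_tensor M N) M E \<and> vn_normal (vn_tensor M N) M E \<and>
     (\<forall>S\<in>elems M. \<forall>T\<in>elems N.
        E (tensor_operator (index M) (index N) S T) = scale_operator (\<phi> T) S)" for E
  have "\<Phi> E\<^sub>0"
    unfolding \<Phi>_def
  proof (intro conjI ballI lin0)
    show "vn_normal (vn_tensor M N) M E\<^sub>0"
      by (rule vn_linear_normal[OF at assms(1) lin0])
    show "E\<^sub>0 (tensor_operator (index M) (index N) S T) = scale_operator (\<phi> T) S"
      if "S \<in> elems M" "T \<in> elems N" for S T
      using that unfolding M.elems_eq N.elems_eq
      by (clarsimp simp: E\<^sub>0 tensor_comb[OF M.resolution_axioms N.resolution_axioms] comb_scale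
          N.normal_functional_comb[OF \<phi>] sum_distrib_left sum_distrib_right mult_ac)
  qed
  moreover have "slice_snd M N \<phi> = (SOME E. \<Phi> E)"
    by (simp add: slice_snd_def \<Phi>_def)
  ultimately have "\<Phi> (slice_snd M N \<phi>)"
    by (metis someI)
  then have lin: "vn_linear (vn_tensor M N) M (slice_snd M N \<phi>)"
    and on_atoms: "\<And>k l. k \<in> K \<Longrightarrow> l \<in> L \<Longrightarrow> slice_snd M N \<phi> (?P (k, l)) = E\<^sub>0 (?P (k, l))"
    using \<open>\<Phi> E\<^sub>0\<close> M.atom_in_elems N.atom_in_elems by (auto simp: \<Phi>_def)
  have "slice_snd M N \<phi> (comb ?P (K \<times> L) c) = E\<^sub>0 (comb ?P (K \<times> L) c)"
    unfolding T.vn_linear_comb[OF lin] T.vn_linear_comb[OF lin0]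
    by (rule comb_cong_ops) (use on_atoms in auto)
  then show ?thesis
    by (simp add: E\<^sub>0)
qed

lemma slice_fst_comb:
  assumes "atomic M K P" "atomic N L Q" and \<phi>: "normal_functional M \<phi>"
  shows "slice_fst M N \<phi> (comb (tensor_atom (index M) (index N) P Q) (K \<times> L) c) =
    comb Q L (\<lambda>l. \<Sum>k\<in>K. c (k, l) * \<phi> (P k))"
proof -
  interpret M: atomic M K P by fact
  interpret N: atomic N L Q by fact
  let ?P = "tensor_atom (index M) (index N) P Q"
  have at: "atomic (vn_tensor M N) (K \<times> L) ?P"
    by (intro tensor_atomic assms)
  interpret T: atomic "vn_tensor M N" "K \<times> L" ?P by fact
  define E\<^sub>0 where "E\<^sub>0 T = comb Q L (\<lambda>l. \<Sum>k\<in>K. coef ?P T (k, l) * \<phi> (P k))" for T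
  have E\<^sub>0: "E\<^sub>0 (comb ?P (K \<times> L) c) = comb Q L (\<lambda>l. \<Sum>k\<in>K. c (k, l) * \<phi> (P k))" for c
    unfolding E\<^sub>0_def by (intro comb_cong sum.cong) (auto simp: T.coef_comb)
  have lin0: "vn_linear (vn_tensor M N) N E\<^sub>0"
    unfolding vn_linear_def T.elems_eq N.elems_eq
    by (auto simp: E\<^sub>0 comb_add comb_scale distrib_right sum.distrib sum_distrib_left mult.assoc)
  define \<Phi> where "\<Phi> E \<longleftrightarrow> vn_linear (vn_tensor M N) N E \<and> vn_normal (vn_tensor M N) N E \<and>
     (\<forall>S\<in>elems M. \<forall>T\<in>elems N.
        E (tensor_operator (index M) (index N) S T) = scale_operator (\<phi> S) T)" for E
  have "\<Phi> E\<^sub>0"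
    unfolding \<Phi>_def
  proof (intro conjI ballI lin0)
    show "vn_normal (vn_tensor M N) N E\<^sub>0"
      by (rule vn_linear_normal[OF at assms(2) lin0])
    show "E\<^sub>0 (tensor_operator (index M) (index N) S T) = scale_operator (\<phi> S) T"
      if "S \<in> elems M" "T \<in> elems N" for S T
      using that unfolding M.elems_eq N.elems_eq
      by (clarsimp simp: E\<^sub>0 tensor_comb[OF M.resolution_axioms N.resolution_axioms] comb_scale
          M.normal_functional_comb[OF \<phi>] sum_distrib_left sum_distrib_right mult_ac)
  qed
  moreover have "slice_fst M N \<phi> = (SOME E. \<Phi> E)"
    by (simp add: slice_fst_def \<Phi>_def)
  ultimately have "\<Phi> (slice_fst M N \<phi>)"
    by (metis someI)
  then have lin: "vn_linear (vn_tensor M N) N (slice_fst M N \<phi>)"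
    and on_atoms: "\<And>k l. k \<in> K \<Longrightarrow> l \<in> L \<Longrightarrow> slice_fst M N \<phi> (?P (k, l)) = E\<^sub>0 (?P (k, l))"
    using \<open>\<Phi> E\<^sub>0\<close> M.atom_in_elems N.atom_in_elems by (auto simp: \<Phi>_def)
  have "slice_fst M N \<phi> (comb ?P (K \<times> L) c) = E\<^sub>0 (comb ?P (K \<times> L) c)"
    unfolding T.vn_linear_comb[OF lin] T.vn_linear_comb[OF lin0]
    by (rule comb_cong_ops) (use on_atoms in auto)
  then show ?thesis
    by (simp add: E\<^sub>0)
qed

lemma bij_assoc: "bij_betw (\<lambda>((i, j), k). (i, j, k)) ((A \<times> B) \<times> C) (A \<times> B \<times> C)"
  by (rule bij_betwI[of _ _ _ "\<lambda>(i, j, k). ((i, j), k)"]) auto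

lemma ell2_assoc:
  "(\<lambda>(i, j, k). x ((i, j), k)) \<in> ell2 (I \<times> J \<times> L) \<longleftrightarrow> x \<in> ell2 ((I \<times> J) \<times> L)"
proof -
  define f where "f = (\<lambda>(i, j, k). (cmod (x ((i, j), k)))\<^sup>2)"
  have "(\<lambda>v. f ((\<lambda>((i, j), k). (i, j, k)) v)) summable_on (UNIV \<times> UNIV) \<times> UNIV \<longleftrightarrow>
      f summable_on UNIV \<times> UNIV \<times> UNIV"
    by (rule summable_on_reindex_bij_betw[OF bij_assoc])
  moreover have "(\<lambda>v. f ((\<lambda>((i, j), k). (i, j, k)) v)) = (\<lambda>v. (cmod (x v))\<^sup>2)"
    by (auto simp: fun_eq_iff f_def)
  moreover have "(\<lambda>v. (cmod (case v of (i, j, k) \<Rightarrow> x ((i, j), k)))\<^sup>2) = f"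
    by (auto simp: fun_eq_iff f_def)
  ultimately show ?thesis
    by (auto simp: ell2_iff)
qed

lemma assoc_tensor_operator:
  fixes A :: "'i operator" and B :: "'j operator" and C :: "'l operator"
  assumes A: "A \<in> bounded_operators I" and B: "B \<in> bounded_operators J" and C: "C \<in> bounded_operators L"
  shows "assoc_operator (tensor_operator I (J \<times> L) A (tensor_operator J L B C)) =
    tensor_operator (I \<times> J) L (tensor_operator I J A B) C"
proof (intro ext, clarify)
  fix x :: "('i \<times> 'j) \<times> 'l \<Rightarrow> complex" and i j k
  let ?x = "\<lambda>(i, j, k). x ((i, j), k)"
  show "assoc_operator (tensor_operator I (J \<times> L) A (tensor_operator J L B C)) x ((i, j), k) =
    tensor_operator (I \<times> J) L (tensor_operator I J A B) C x ((i, j), k)"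
  proof (cases "x \<in> ell2 ((I \<times> J) \<times> L)")
    case True
    then have x': "?x \<in> ell2 (I \<times> J \<times> L)"
      by (simp only: ell2_assoc)
    have sl: "(\<lambda>(j, k). x ((i, j), k)) \<in> ell2 (J \<times> L)" for i
      using ell2_slice_right[OF x', of i] by (simp add: case_prod_unfold)
    have sr: "(\<lambda>ij. C (\<lambda>k. x (ij, k)) k) \<in> ell2 (I \<times> J)"
      using ell2_slice_left[OF amp_right_in_ell2[OF C True], of k] by (simp add: amp_right_def)
    show ?thesis
      using True x' sl sr by (simp add: assoc_operator_def tensor_operator_def case_prod_unfold)
  next
    case False
    then have "?x \<notin> ell2 (I \<times> J \<times> L)"
      by (simp only: ell2_assoc) simp
    then show ?thesis
      using False by (simp add: assoc_operator_def tensor_operator_def)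
  qed
qed

lemma assoc_comb:
  assumes "resolution I K P" "resolution J L Q" "resolution H N R"
  shows "assoc_operator (comb (tensor_atom I (J \<times> H) P (tensor_atom J H Q R)) (K \<times> L \<times> N) c) =
    comb (tensor_atom (I \<times> J) H (tensor_atom I J P Q) R) ((K \<times> L) \<times> N)
      (c \<circ> (\<lambda>((i, j), k). (i, j, k)))"
proof -
  let ?T = "tensor_atom I (J \<times> H) P (tensor_atom J H Q R)"
  have "assoc_operator (comb ?T (K \<times> L \<times> N) c) =
      comb (\<lambda>r. assoc_operator (?T r)) (K \<times> L \<times> N) c"
    by (simp add: assoc_operator_def comb_def fun_eq_iff)
  also have "\<dots> = comb ((\<lambda>r. assoc_operator (?T r)) \<circ> (\<lambda>((i, j), k). (i, j, k))) ((K \<times> L) \<times> N)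
      (c \<circ> (\<lambda>((i, j), k). (i, j, k)))"
    by (rule comb_reindex[OF bij_assoc])
  also have "\<dots> = comb (tensor_atom (I \<times> J) H (tensor_atom I J P Q) R) ((K \<times> L) \<times> N)
      (c \<circ> (\<lambda>((i, j), k). (i, j, k)))"
    by (rule comb_cong_ops)
      (auto intro!: assoc_tensor_operator simp: resolution.atom_bounded[OF assms(1)]
        resolution.atom_bounded[OF assms(2)] resolution.atom_bounded[OF assms(3)])
  finally show ?thesis .
qed


section \<open>Quantum groups on finite-dimensional abelian algebras\<close>

text \<open>\<open>comult_from A K P m\<close> says that the comultiplication of \<open>A\<close> is dual to the operation \<open>m\<close> on
  the index set \<open>K\<close> of the atoms.\<close>

definition comult_from ::
    "('i, 'x) qgroup_scheme \<Rightarrow> 'k set \<Rightarrow> ('k \<Rightarrow> 'i operator) \<Rightarrow> ('k \<Rightarrow> 'k \<Rightarrow> 'k) \<Rightarrow> bool" where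
  "comult_from A K P m \<longleftrightarrow>
     (\<forall>k\<in>K. \<forall>l\<in>K. m k l \<in> K) \<and>
     (\<forall>c. comult A (comb P K c) =
       comb (tensor_atom (index A) (index A) P P) (K \<times> K) (c \<circ> (\<lambda>(k, l). m k l)))"

text \<open>Either side is the pullback along one of the two bracketings of a triple product in
  \<open>K\<close>, and equal pullbacks come from equal maps.\<close>

lemma coassociative_iff:
  assumes at: "atomic A K P" and m: "comult_from A K P m"
  shows "(\<forall>T\<in>elems A.
        tensor_hom A A (vn_tensor A A) A (comult A) id (comult A T) =
        assoc_operator (tensor_hom A A A (vn_tensor A A) id (comult A) (comult A T))) \<longleftrightarrow>
    (\<forall>i\<in>K. \<forall>j\<in>K. \<forall>k\<in>K. m (m i j) k = m i (m j k))" (is "?L \<longleftrightarrow> ?R")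
proof -
  interpret A: atomic A K P by fact
  let ?I = "index A"
  have at2: "atomic (vn_tensor A A) (K \<times> K) (tensor_atom ?I ?I P P)"
    by (rule tensor_atomic[OF at at])
  have cm: "comult A (comb P K c) = comb (tensor_atom ?I ?I P P) (K \<times> K) (c \<circ> (\<lambda>(k, l). m k l))" for c
    using m by (simp add: comult_from_def)
  have mK: "(\<lambda>(k, l). m k l) kl \<in> K" if "kl \<in> K \<times> K" for kl
    using m that by (auto simp: comult_from_def)
  let ?T = "tensor_atom (?I \<times> ?I) ?I (tensor_atom ?I ?I P P) P"
  have res3: "resolution ((?I \<times> ?I) \<times> ?I) ((K \<times> K) \<times> K) ?T"
    using tensor_atomic[OF at2 at] by (simp add: atomic_def)
  define l where "l = (\<lambda>((i, j), k). m (m i j) k)"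
  define r where "r = (\<lambda>((i, j), k). m i (m j k))"
  have L: "tensor_hom A A (vn_tensor A A) A (comult A) id (comult A (comb P K c)) =
      comb ?T ((K \<times> K) \<times> K) (c \<circ> l)" for c
  proof -
    have "tensor_hom A A (vn_tensor A A) A (comult A) id (comult A (comb P K c)) =
        comb ?T ((K \<times> K) \<times> K) ((c \<circ> (\<lambda>(k, l). m k l)) \<circ> map_prod (\<lambda>(k, l). m k l) id)"
      unfolding cm
      by (rule tensor_hom_comb[OF at at at2 at, where g = id and \<sigma> = id, unfolded index_vn_tensor])
        (use cm mK in auto)
    also have "(c \<circ> (\<lambda>(k, l). m k l)) \<circ> map_prod (\<lambda>(k, l). m k l) id = c \<circ> l"
      by (auto simp: l_def fun_eq_iff)
    finally show ?thesis .
  qed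
  have R: "assoc_operator (tensor_hom A A A (vn_tensor A A) id (comult A) (comult A (comb P K c))) =
      comb ?T ((K \<times> K) \<times> K) (c \<circ> r)" for c
  proof -
    have "tensor_hom A A A (vn_tensor A A) id (comult A) (comult A (comb P K c)) =
        comb (tensor_atom ?I (?I \<times> ?I) P (tensor_atom ?I ?I P P)) (K \<times> K \<times> K)
          ((c \<circ> (\<lambda>(k, l). m k l)) \<circ> map_prod id (\<lambda>(k, l). m k l))"
      unfolding cm
      by (rule tensor_hom_comb[OF at at at at2, where f = id and \<tau> = id, unfolded index_vn_tensor])
        (use cm mK in auto)
    then have "assoc_operator (tensor_hom A A A (vn_tensor A A) id (comult A) (comult A (comb P K c))) =
        comb ?T ((K \<times> K) \<times> K)
          ((c \<circ> (\<lambda>(k, l). m k l)) \<circ> map_prod id (\<lambda>(k, l). m k l) \<circ> (\<lambda>((i, j), k). (i, j, k)))"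
      by (simp only: assoc_comb[OF A.resolution_axioms A.resolution_axioms A.resolution_axioms])
    also have "(c \<circ> (\<lambda>(k, l). m k l)) \<circ> map_prod id (\<lambda>(k, l). m k l) \<circ> (\<lambda>((i, j), k). (i, j, k)) = c \<circ> r"
      by (auto simp: r_def fun_eq_iff)
    finally show ?thesis .
  qed
  have "?L \<longleftrightarrow> (\<forall>c. comb ?T ((K \<times> K) \<times> K) (c \<circ> l) = comb ?T ((K \<times> K) \<times> K) (c \<circ> r))"
    by (auto simp: A.elems_eq L R)
  also have "\<dots> \<longleftrightarrow> (\<forall>v\<in>(K \<times> K) \<times> K. l v = r v)"
    using index_map_unique[OF res3, of l r] by (auto intro: comb_cong)
  also have "\<dots> \<longleftrightarrow> ?R"
    by (auto simp: l_def r_def)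
  finally show ?thesis .
qed

text \<open>Coassociativity gives a semigroup on \<open>K\<close>. The Haar state supplies the
  divisions: it is invariant and charges every point, so no point can be missed by a
  translation.\<close>

lemma compact_quantum_group_imp_group:
  fixes K :: "'k set"
  assumes cqg: "compact_quantum_group B" and at: "atomic B K P"
  obtains G :: "'k monoid" where "group G" "carrier G = K" "comult_from B K P (mult G)"
proof -
  interpret B: atomic B K P by fact
  let ?I = "index B"
  have at2: "atomic (vn_tensor B B) (K \<times> K) (tensor_atom ?I ?I P P)"
    by (rule tensor_atomic[OF at at])
  interpret B2: atomic "vn_tensor B B" "K \<times> K" "tensor_atom ?I ?I P P" by fact
  have hom: "unital_star_hom B (vn_tensor B B) (comult B)"
    using cqg by (simp add: compact_quantum_group_def)
  obtain \<tau> where \<tau>: "\<And>kl. kl \<in> K \<times> K \<Longrightarrow> \<tau> kl \<in> K"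
    "\<And>c. comult B (comb P K c) = comb (tensor_atom ?I ?I P P) (K \<times> K) (c \<circ> \<tau>)"
    by (rule star_hom_index_map[OF at at2 hom]) blast
  define m where "m k l = \<tau> (k, l)" for k l
  have \<tau>_eq: "\<tau> = (\<lambda>(k, l). m k l)"
    by (auto simp: m_def)
  have m: "comult_from B K P m"
    using \<tau> by (auto simp: comult_from_def \<tau>_eq)
  have mK: "m k l \<in> K" if "k \<in> K" "l \<in> K" for k l
    using \<tau>(1) that by (simp add: m_def)
  have assoc: "m (m i j) k = m i (m j k)" if "i \<in> K" "j \<in> K" "k \<in> K" for i j k
    using coassociative_iff[OF at m] cqg that by (simp add: compact_quantum_group_def)
  obtain \<phi> where "is_haar_state B \<phi>"
    using cqg by (auto simp: compact_quantum_group_def)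
  then have \<phi>: "normal_functional B \<phi>" "\<phi> (id_operator ?I) = 1"
    "\<And>T S. T \<in> elems B \<Longrightarrow> S \<in> elems B \<Longrightarrow> is_adjoint ?I T S \<Longrightarrow> \<phi> (S \<circ> T) = 0 \<Longrightarrow> T = zero_operator"
    "\<And>T. T \<in> elems B \<Longrightarrow> slice_snd B B \<phi> (comult B T) = scale_operator (\<phi> T) (id_operator ?I)"
    "\<And>T. T \<in> elems B \<Longrightarrow> slice_fst B B \<phi> (comult B T) = scale_operator (\<phi> T) (id_operator ?I)"
    by (auto simp: is_haar_state_def faithful_normal_state_def)
  have pos: "\<phi> (P k) \<noteq> 0" if "k \<in> K" for k
    using \<phi>(3)[OF B.atom_in_elems[OF that] B.atom_in_elems[OF that]] B.self_adj[OF that]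
      B.nonzero[OF that] by (auto simp: self_adjoint_def B.orth[OF that that])
  have snd: "(\<Sum>l\<in>K. c (m k l) * \<phi> (P l)) = \<phi> (comb P K c)" if "k \<in> K" for k c
    using \<phi>(4)[of "comb P K c"] that
    by (simp add: \<tau>(2) \<tau>_eq slice_snd_comb[OF at at \<phi>(1)] comb_scale B.comb_eq_iff
        flip: B.complete)
  have fst: "(\<Sum>k\<in>K. c (m k l) * \<phi> (P k)) = \<phi> (comb P K c)" if "l \<in> K" for l c
    using \<phi>(5)[of "comb P K c"] that
    by (simp add: \<tau>(2) \<tau>_eq slice_fst_comb[OF at at \<phi>(1)] comb_scale B.comb_eq_iff
        flip: B.complete)
  \<comment> \<open>If \<open>m k l\<close> were never \<open>j\<close>, invariance for the
    indicator function of \<open>j\<close> would give \<open>\<phi> (P j) = 0\<close>.\<close>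
  have right_div: "\<exists>l\<in>K. m k l = j" if "k \<in> K" "j \<in> K" for k j
  proof (rule ccontr)
    assume "\<not> ?thesis"
    then have "(\<Sum>l\<in>K. (if m k l = j then 1 else 0) * \<phi> (P l)) = 0"
      by (intro sum.neutral) auto
    then show False
      using snd[OF that(1), of "\<lambda>i. if i = j then 1 else 0"] pos[OF that(2)]
      by (simp add: B.atom_eq_comb[OF that(2), symmetric])
  qed
  have left_div: "\<exists>k\<in>K. m k l = j" if "l \<in> K" "j \<in> K" for l j
  proof (rule ccontr)
    assume "\<not> ?thesis"
    then have "(\<Sum>k\<in>K. (if m k l = j then 1 else 0) * \<phi> (P k)) = 0"
      by (intro sum.neutral) auto
    then show False
      using fst[OF that(1), of "\<lambda>i. if i = j then 1 else 0"] pos[OF that(2)]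
      by (simp add: B.atom_eq_comb[OF that(2), symmetric])
  qed
  have "K \<noteq> {}"
  proof
    assume "K = {}"
    then show False
      using \<phi>(2) B.normal_functional_comb[OF \<phi>(1), of "\<lambda>_. 1"] B.complete by simp
  qed
  then obtain a where a: "a \<in> K" by blast
  \<comment> \<open>Neutrality from the left at one point \<open>a\<close> spreads to every
    \<open>b\<close>, since \<open>b\<close> is of the form \<open>m a x\<close>.\<close>
  obtain e where e: "e \<in> K" "m e a = a"
    using left_div[OF a a] by blast
  have one: "m e b = b" if b: "b \<in> K" for b
  proof -
    obtain x where "x \<in> K" "m a x = b" using right_div[OF a b] by blast
    then show ?thesis using assoc[OF e(1) a, of x] e(2) by simp
  qed
  define G where "G = \<lparr>carrier = K, mult = m, one = e\<rparr>"
  have "group G"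
    by (rule groupI) (auto simp: G_def mK e(1) assoc one left_div)
  then show ?thesis
    using that[of G] m by (simp add: G_def)
qed

text \<open>The Haar state is the uniform one, invariant because translations are bijective; it is a
  trace because the algebra is commutative. The neutral element makes the comultiplication
  injective.\<close>

lemma group_imp_kac_type:
  assumes at: "atomic A K P" and "group G" "carrier G = K" and m: "comult_from A K P (mult G)"
  shows "kac_type A"
proof -
  interpret A: atomic A K P by fact
  interpret G: group G by fact
  let ?I = "index A" and ?m = "\<lambda>(k, l). k \<otimes>\<^bsub>G\<^esub> l"
  have K: "K = carrier G" using assms by simp
  have at2: "atomic (vn_tensor A A) (K \<times> K) (tensor_atom ?I ?I P P)"
    by (rule tensor_atomic[OF at at])
  interpret A2: atomic "vn_tensor A A" "K \<times> K" "tensor_atom ?I ?I P P" by fact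
  have cm: "comult A (comb P K c) = comb (tensor_atom ?I ?I P P) (K \<times> K) (c \<circ> ?m)" for c
    using m by (simp add: comult_from_def)
  have mK: "?m kl \<in> K" if "kl \<in> K \<times> K" for kl
    using that by (auto simp: K)
  have hom: "unital_star_hom A (vn_tensor A A) (comult A)"
    by (rule star_hom_of_index_map[OF at at2 cm mK])
  have "inj_on (comult A) (elems A)"
    unfolding A.elems_eq inj_on_def
  proof (clarsimp simp: cm A2.comb_eq_iff A.comb_eq_iff)
    fix c d k assume "\<forall>x\<in>K. \<forall>y\<in>K. c (x \<otimes>\<^bsub>G\<^esub> y) = d (x \<otimes>\<^bsub>G\<^esub> y)" "k \<in> K"
    then show "c k = d k"
      using G.r_one[of k] G.one_closed unfolding K by metis
  qed
  moreover have "\<exists>\<phi>. is_haar_state A \<phi>"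
  proof
    define n where "n = complex_of_real (real (card K))"
    define \<phi> where "\<phi> T = (\<Sum>k\<in>K. coef P T k * (1 / n))" for T
    have n: "n \<noteq> 0"
      using A.fin G.one_closed by (auto simp: n_def K)
    have \<phi>: "\<phi> (comb P K c) = (\<Sum>k\<in>K. c k * (1 / n))" for c
      by (simp add: \<phi>_def A.coef_comb)
    have nf: "normal_functional A \<phi>"
      by (rule A.normal_functionalI) (rule \<phi>)
    have \<phi>P: "\<phi> (P k) = 1 / n" if "k \<in> K" for k
      using A.fin that by (subst A.atom_eq_comb[OF that]) (simp add: \<phi> if_distrib[of "\<lambda>x. x / n"] cong: if_cong)
    have "faithful_normal_state A \<phi>"
      unfolding faithful_normal_state_def A.elems_eq
    proof (intro conjI nf ballI impI)
      show "\<phi> (id_operator ?I) = 1"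
        unfolding A.complete[symmetric] \<phi> using n by (simp add: n_def)
      fix T S assume "T \<in> range (comb P K)" "S \<in> range (comb P K)" and adj: "is_adjoint ?I T S"
      then obtain c d where T: "T = comb P K c" and S: "S = comb P K d" by blast
      have d: "d k = cnj (c k)" if "k \<in> K" for k
        using adj that by (simp add: T S A.is_adjoint_comb_iff)
      have eq: "\<phi> (S \<circ> T) = complex_of_real ((\<Sum>k\<in>K. (cmod (c k))\<^sup>2) / real (card K))"
      proof -
        have "\<phi> (S \<circ> T) = (\<Sum>k\<in>K. d k * c k * (1 / n))"
          by (simp add: S T A.comb_compose \<phi>)
        also have "\<dots> = (\<Sum>k\<in>K. complex_of_real ((cmod (c k))\<^sup>2 / real (card K)))"
          by (intro sum.cong refl)
            (simp only: d of_real_divide complex_norm_square, simp add: n_def mult.commute)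
        finally show ?thesis
          by (simp only: of_real_sum[symmetric] sum_divide_distrib)
      qed
      show "\<phi> (S \<circ> T) \<in> \<real>\<^sub>\<ge>\<^sub>0"
        unfolding eq by (simp only: nonneg_Reals_of_real_iff) (simp add: sum_nonneg)
      assume "\<phi> (S \<circ> T) = 0"
      then have "(\<Sum>k\<in>K. (cmod (c k))\<^sup>2) = 0"
        using n unfolding eq of_real_eq_0_iff by (simp add: n_def)
      then have "c k = 0" if "k \<in> K" for k
        using that A.fin by (simp add: sum_nonneg_eq_0_iff)
      then show "T = zero_operator"
        by (simp add: T comb_def zero_operator_def)
    qed
    moreover have "slice_snd A A \<phi> (comult A T) = scale_operator (\<phi> T) (id_operator ?I) \<and>
        slice_fst A A \<phi> (comult A T) = scale_operator (\<phi> T) (id_operator ?I)" if T_in: "T \<in> elems A" for T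
    proof -
      obtain c where T: "T = comb P K c" by (rule A.elemsE[OF T_in]) blast
      have "(\<Sum>l\<in>K. c (k \<otimes>\<^bsub>G\<^esub> l) * \<phi> (P l)) = \<phi> T" if "k \<in> K" for k
      proof -
        have "bij_betw (\<lambda>l. k \<otimes>\<^bsub>G\<^esub> l) K K"
          unfolding K by (rule bij_betwI[of _ _ _ "\<lambda>l. inv\<^bsub>G\<^esub> k \<otimes>\<^bsub>G\<^esub> l"])
            (use that in \<open>auto simp: K G.m_assoc[symmetric]\<close>)
        from sum.reindex_bij_betw[OF this, of "\<lambda>l. c l * (1 / n)"] show ?thesis
          by (simp add: T \<phi> \<phi>P)
      qed
      moreover have "(\<Sum>k\<in>K. c (k \<otimes>\<^bsub>G\<^esub> l) * \<phi> (P k)) = \<phi> T" if "l \<in> K" for l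
      proof -
        have "bij_betw (\<lambda>k. k \<otimes>\<^bsub>G\<^esub> l) K K"
          unfolding K by (rule bij_betwI[of _ _ _ "\<lambda>k. k \<otimes>\<^bsub>G\<^esub> inv\<^bsub>G\<^esub> l"])
            (use that in \<open>auto simp: K G.m_assoc\<close>)
        from sum.reindex_bij_betw[OF this, of "\<lambda>l. c l * (1 / n)"] show ?thesis
          by (simp add: T \<phi> \<phi>P)
      qed
      ultimately show ?thesis
        by (simp add: T cm slice_snd_comb[OF at at nf] slice_fst_comb[OF at at nf]
            comb_scale A.comb_eq_iff flip: A.complete)
    qed
    ultimately show "is_haar_state A \<phi>"
      by (simp add: is_haar_state_def)
  qed
  moreover have "vn_normal A (vn_tensor A A) (comult A)"
    using hom by (intro vn_linear_normal[OF at at2]) (simp add: unital_star_hom_def)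
  ultimately have "compact_quantum_group A"
    unfolding compact_quantum_group_def coassociative_iff[OF at m]
    using A.von_neumann hom by (auto simp: K G.m_assoc)
  moreover have "S \<circ> T = T \<circ> S" if "S \<in> elems A" "T \<in> elems A" for S T
    using that by (auto simp: A.elems_eq A.comb_compose mult.commute)
  ultimately show ?thesis
    by (simp add: kac_type_def)
qed

text \<open>Index maps run against homomorphisms: \<open>\<theta>\<close> from \<open>A\<close> to
  \<open>B\<close> is dual to \<open>\<tau>\<close> from \<open>L\<close> to \<open>K\<close>, so
  multiplicativity is asked of \<open>\<tau>\<close>.\<close>

lemma qgroup_iso_comb_iff:
  assumes at: "atomic A K P" and at': "atomic B L Q"
    and m: "comult_from A K P m" and n: "comult_from B L Q n"
    and \<theta>: "\<And>c. \<theta> (comb P K c) = comb Q L (c \<circ> \<tau>)" and \<tau>: "bij_betw \<tau> L K"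
  shows "qgroup_iso A B \<theta> \<longleftrightarrow> (\<forall>k\<in>L. \<forall>l\<in>L. \<tau> (n k l) = m (\<tau> k) (\<tau> l))"
proof -
  interpret A: atomic A K P by fact
  interpret B: atomic B L Q by fact
  let ?Q = "tensor_atom (index B) (index B) Q Q"
  have res2: "resolution (index B \<times> index B) (L \<times> L) ?Q"
    by (intro tensor_resolution B.resolution_axioms)
  have \<tau>K: "\<tau> l \<in> K" if "l \<in> L" for l
    using \<tau> that by (auto simp: bij_betw_def)
  define l where "l = (\<lambda>(k, l). \<tau> (n k l))"
  define r where "r = (\<lambda>(k, l). m (\<tau> k) (\<tau> l))"
  have L: "comult B (\<theta> (comb P K c)) = comb ?Q (L \<times> L) (c \<circ> l)" for c
  proof -
    have "comult B (\<theta> (comb P K c)) = comb ?Q (L \<times> L) (c \<circ> \<tau> \<circ> (\<lambda>(k, l). n k l))"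
      using n by (simp add: \<theta> comult_from_def)
    also have "c \<circ> \<tau> \<circ> (\<lambda>(k, l). n k l) = c \<circ> l"
      by (auto simp: l_def fun_eq_iff)
    finally show ?thesis .
  qed
  have R: "tensor_hom A A B B \<theta> \<theta> (comult A (comb P K c)) = comb ?Q (L \<times> L) (c \<circ> r)" for c
  proof -
    have "tensor_hom A A B B \<theta> \<theta> (comult A (comb P K c)) =
        comb ?Q (L \<times> L) ((c \<circ> (\<lambda>(k, l). m k l)) \<circ> map_prod \<tau> \<tau>)"
      using m tensor_hom_comb[OF at at at' at' \<theta> \<tau>K \<theta> \<tau>K] by (simp add: comult_from_def)
    also have "(c \<circ> (\<lambda>(k, l). m k l)) \<circ> map_prod \<tau> \<tau> = c \<circ> r"
      by (auto simp: r_def fun_eq_iff)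
    finally show ?thesis .
  qed
  have "qgroup_iso A B \<theta> \<longleftrightarrow> (\<forall>c. comb ?Q (L \<times> L) (c \<circ> l) = comb ?Q (L \<times> L) (c \<circ> r))"
    using star_iso_of_index_map[OF at at' \<theta> \<tau>] by (auto simp: qgroup_iso_def A.elems_eq L R)
  also have "\<dots> \<longleftrightarrow> (\<forall>v\<in>L \<times> L. l v = r v)"
    using index_map_unique[OF res2, of l r] by (auto intro: comb_cong)
  finally show ?thesis
    by (auto simp: l_def r_def)
qed


section \<open>Rigidity of finite groups\<close>

lemma comb_mult_operator:
  assumes "finite S"
  shows "comb (\<lambda>k. mult_operator S (delta_vec k)) S c = mult_operator S c"
proof (intro ext)
  fix x i
  show "comb (\<lambda>k. mult_operator S (delta_vec k)) S c x i = mult_operator S c x i"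
  proof (cases "x \<in> ell2 S \<and> i \<in> S")
    case True
    have "(\<Sum>k\<in>S. c k * (delta_vec k i * x i)) = (\<Sum>k\<in>S. if k = i then c i * x i else 0)"
      by (intro sum.cong) (auto simp: delta_vec_def)
    then show ?thesis
      using True assms by (simp add: comb_def mult_operator_def)
  next
    case False
    then have "x \<in> ell2 S \<Longrightarrow> x i = 0"
      by (auto simp: ell2_iff)
    then show ?thesis
      by (cases "x \<in> ell2 S") (simp_all add: comb_def mult_operator_def)
  qed
qed

lemma mult_operator_cong:
  assumes "\<And>i. i \<in> S \<Longrightarrow> F i = G i"
  shows "mult_operator S F = mult_operator S G"
proof (intro ext)
  fix x i
  show "mult_operator S F x i = mult_operator S G x i"
    using assms by (cases "i \<in> S") (auto simp: mult_operator_def ell2_def)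
qed

lemma symbol_mult_operator: "i \<in> S \<Longrightarrow> symbol (mult_operator S F) i = F i"
  by (simp add: symbol_def mult_operator_def delta_vec_in_ell2) (simp add: delta_vec_def)

lemma mult_operator_bounded:
  assumes "\<And>i. cmod (F i) \<le> 1"
  shows "mult_operator S F \<in> bounded_operators S"
proof -
  have le: "(cmod (F i * x i))\<^sup>2 \<le> (cmod (x i))\<^sup>2" for x i
    using assms[of i] by (simp add: norm_mult power_mult_distrib mult_left_le_one_le power_le_one)
  have sm: "(\<lambda>i. (cmod (F i * x i))\<^sup>2) summable_on UNIV" if "x \<in> ell2 S" for x
    by (rule summable_on_comparison_test[of "\<lambda>i. (cmod (x i))\<^sup>2"]) (use that le in \<open>auto simp: ell2_iff\<close>)
  have "(l2_norm (\<lambda>i. F i * x i))\<^sup>2 \<le> 1 * (l2_norm x)\<^sup>2" if "x \<in> ell2 S" for x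
    unfolding l2_norm_sq mult_1
    using that by (intro infsum_mono le sm) (auto simp: ell2_iff)
  then show ?thesis
    unfolding bounded_operators_iff_sq using sm
    by (auto simp: mult_operator_def ell2_add ell2_scale distrib_left mult.left_commute
        intro!: exI[of _ 1]) (auto simp: ell2_iff)
qed

context
  fixes K :: "('k, 'm) monoid_scheme"
  assumes K: "group K" and finK: "finite (carrier K)"
begin

interpretation K: group K by (rule K)

abbreviation (input) "atoms \<equiv> \<lambda>k. mult_operator (carrier K) (delta_vec k)"

lemma finite_qgroup_atomic: "atomic (finite_qgroup K) (carrier K) atoms"
proof -
  let ?S = "carrier K"
  have b: "mult_operator ?S (delta_vec k) \<in> bounded_operators ?S" for k
    by (rule mult_operator_bounded) (simp add: delta_vec_def)
  have "l2_inner (mult_operator ?S (delta_vec k) x) y = l2_inner x (mult_operator ?S (delta_vec k) y)"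
    if "x \<in> ell2 ?S" "y \<in> ell2 ?S" for k x y
    using that by (auto simp: mult_operator_def l2_inner_def delta_vec_def intro!: infsum_cong)
  then have sa: "self_adjoint ?S (mult_operator ?S (delta_vec k))" for k
    using b by (simp add: self_adjoint_def is_adjoint_def)
  have nz: "mult_operator ?S (delta_vec k) \<noteq> zero_operator" if "k \<in> ?S" for k
    using symbol_mult_operator[OF that, of "delta_vec k"]
    by (auto simp: symbol_def zero_operator_def delta_vec_def)
  have "mult_operator ?S (delta_vec k) \<circ> mult_operator ?S (delta_vec l) =
      (if k = l then mult_operator ?S (delta_vec k) else zero_operator)" for k l
  proof
    fix x
    have "mult_operator ?S (delta_vec l) x \<in> ell2 ?S"
      by (rule bounded_operator_in_ell2[OF b])
    then show "(mult_operator ?S (delta_vec k) \<circ> mult_operator ?S (delta_vec l)) x =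
      (if k = l then mult_operator ?S (delta_vec k) else zero_operator) x"
      by (auto simp: mult_operator_def delta_vec_def zero_operator_def fun_eq_iff)
  qed
  moreover have "comb atoms ?S (\<lambda>_. 1) = id_operator ?S"
    unfolding comb_mult_operator[OF finK] by (auto simp: mult_operator_def id_operator_def)
  ultimately show ?thesis
    by unfold_locales
      (auto simp: finite_qgroup_def finK sa nz comb_mult_operator[OF finK, abs_def])
qed

lemma finite_qgroup_comult: "comult_from (finite_qgroup K) (carrier K) atoms (mult K)"
  unfolding comult_from_def
proof (intro conjI ballI allI)
  let ?S = "carrier K"
  fix c
  have fin2: "finite (?S \<times> ?S)" using finK by simp
  have "tensor_operator ?S ?S (mult_operator ?S (delta_vec k)) (mult_operator ?S (delta_vec l)) =
      mult_operator (?S \<times> ?S) (delta_vec (k, l))" for k l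
    by (auto simp: fun_eq_iff tensor_operator_def mult_operator_def ell2_slice_right delta_vec_def
        ell2_slice_left ell2_scale)
  then have "comb (tensor_atom ?S ?S atoms atoms) (?S \<times> ?S) d = mult_operator (?S \<times> ?S) d" for d
    by (subst comb_mult_operator[OF fin2, symmetric]) (simp add: comb_def case_prod_unfold)
  moreover have "mult_operator (?S \<times> ?S) (\<lambda>(k1, k2). symbol (mult_operator ?S c) (k1 \<otimes>\<^bsub>K\<^esub> k2)) =
      mult_operator (?S \<times> ?S) (c \<circ> (\<lambda>(k, l). k \<otimes>\<^bsub>K\<^esub> l))"
    by (rule mult_operator_cong) (auto simp: symbol_mult_operator)
  ultimately show "comult (finite_qgroup K) (comb atoms ?S c) =
      comb (tensor_atom (index (finite_qgroup K)) (index (finite_qgroup K)) atoms atoms) (?S \<times> ?S)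
        (c \<circ> (\<lambda>(k, l). k \<otimes>\<^bsub>K\<^esub> l))"
    by (simp add: finite_qgroup_def comb_mult_operator[OF finK])
qed simp_all

lemma aut_action_comb:
  assumes "g \<in> auto K"
  shows "aut_action K g (comb atoms (carrier K) c) =
    comb atoms (carrier K) (c \<circ> inv_into (carrier K) g)"
proof -
  have "inv_into (carrier K) g k \<in> carrier K" if "k \<in> carrier K" for k
    using assms that by (auto simp: auto_def Bij_def bij_betw_def inv_into_into)
  then have "comb atoms (carrier K) (symbol (mult_operator (carrier K) c) \<circ> inv_into (carrier K) g) =
      comb atoms (carrier K) (c \<circ> inv_into (carrier K) g)"
    by (intro comb_cong) (simp add: symbol_mult_operator)
  then show ?thesis
    by (simp add: aut_action_def comb_mult_operator[OF finK])
qed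

end

section \<open>Reduction to group laws on the set K\<close>

lemma star_iso_atomic:
  assumes "atomic A K P" and iso: "star_iso A B \<pi>" and vn: "von_neumann_algebra B"
  shows "atomic B K (\<pi> \<circ> P)" and "\<pi> (comb P K c) = comb (\<pi> \<circ> P) K c"
proof -
  interpret A: atomic A K P by fact
  have lin: "vn_linear A B \<pi>" and hom: "unital_star_hom A B \<pi>" and bij: "bij_betw \<pi> (elems A) (elems B)"
    using iso by (auto simp: star_iso_def unital_star_hom_def)
  show comb: "\<pi> (comb P K c) = comb (\<pi> \<circ> P) K c" for c
    using A.vn_linear_comb[OF lin, of c] by (simp add: comp_def)
  have zero: "\<pi> zero_operator = zero_operator"
    using comb[of "\<lambda>_. 0"] by (simp add: comb_def zero_operator_def)
  have z: "zero_operator \<in> elems A"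
    using A.comb_in_elems[of "\<lambda>_. 0"] by (simp add: comb_def zero_operator_def)
  show "atomic B K (\<pi> \<circ> P)"
  proof
    show "finite K" by (rule A.fin)
    fix k assume k: "k \<in> K"
    have Pk: "P k \<in> elems A" by (rule A.atom_in_elems[OF k])
    then have "\<pi> (P k) \<in> elems B"
      using bij by (auto simp: bij_betw_def)
    then show "self_adjoint (index B) ((\<pi> \<circ> P) k)"
      using hom vn A.self_adj[OF k] Pk
      by (auto simp: self_adjoint_def unital_star_hom_def von_neumann_algebra_def)
    show "(\<pi> \<circ> P) k \<noteq> zero_operator"
      using A.nonzero[OF k] zero Pk z bij by (auto simp: bij_betw_def inj_on_def)
    fix l assume l: "l \<in> K"
    have "\<pi> (P k) \<circ> \<pi> (P l) = \<pi> (P k \<circ> P l)"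
      using hom Pk A.atom_in_elems[OF l] by (simp add: unital_star_hom_def)
    then show "(\<pi> \<circ> P) k \<circ> (\<pi> \<circ> P) l = (if k = l then (\<pi> \<circ> P) k else zero_operator)"
      using A.orth[OF k l] zero by auto
  next
    show "comb (\<pi> \<circ> P) K (\<lambda>_. 1) = id_operator (index B)"
      using hom by (simp add: A.complete unital_star_hom_def flip: comb)
    show "elems B = range (comb (\<pi> \<circ> P) K)"
    proof -
      have "elems B = range (\<lambda>c. \<pi> (comb P K c))"
        using bij by (auto simp: bij_betw_def A.elems_eq)
      then show ?thesis by (simp add: comb)
    qed
  qed
qed

text \<open>The group-theoretic criterion with the bijection \<open>\<pi>\<close> replaced by the
  identity. The functions in \<open>auto\<close> are extensional on the carrier, so equal carriers
  make the inclusion \<open>auto K \<subseteq> auto \<Lambda>\<close> meaningful.\<close>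

definition group_rigid :: "('k, 'm) monoid_scheme \<Rightarrow> bool" where
  "group_rigid K \<longleftrightarrow> (\<forall>\<Lambda> :: 'k monoid.
     group \<Lambda> \<and> carrier \<Lambda> = carrier K \<and> auto K \<subseteq> auto \<Lambda> \<longrightarrow> K \<cong> \<Lambda>)"

lemma finite_auto: "finite (carrier K) \<Longrightarrow> finite (auto K)"
  by (rule finite_subset[of _ "carrier K \<rightarrow>\<^sub>E carrier K"])
    (auto simp: auto_def Bij_def bij_betw_def PiE_def intro: finite_PiE[unfolded PiE_def])

text \<open>Conjugation by \<open>\<psi>\<close>, restricted to \<open>S\<close> since
  \<open>auto\<close> demands extensional functions.\<close>

definition conj_auto :: "'k set \<Rightarrow> ('k \<Rightarrow> 'k) \<Rightarrow> ('k \<Rightarrow> 'k) \<Rightarrow> 'k \<Rightarrow> 'k" where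
  "conj_auto S \<psi> g = (\<lambda>k\<in>S. \<psi> (g (inv_into S \<psi> k)))"

lemma conj_auto_in_auto:
  assumes \<psi>: "\<psi> \<in> iso K L" and K: "carrier K = S" and L: "carrier L = S" and g: "g \<in> auto K"
    and "group K" "group L"
  shows "conj_auto S \<psi> g \<in> auto L"
proof -
  interpret K: group K by fact
  interpret L: group L by fact
  have bij: "bij_betw \<psi> S S" and hom: "\<psi> \<in> hom K L"
    using \<psi> by (auto simp: iso_def K L)
  have inv: "inv_into S \<psi> \<in> iso L K"
    using K.iso_set_sym[OF \<psi>] by (simp add: K)
  have "g \<in> iso K K"
    using g by (auto simp: auto_def iso_def Bij_def)
  then have "\<psi> \<circ> (g \<circ> inv_into S \<psi>) \<in> iso L L"
    by (rule iso_set_trans[OF iso_set_trans[OF inv] \<psi>])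
  then have *: "\<psi> \<circ> (g \<circ> inv_into S \<psi>) \<in> hom L L" "bij_betw (\<psi> \<circ> (g \<circ> inv_into S \<psi>)) S S"
    by (auto simp: iso_def L)
  have "bij_betw (conj_auto S \<psi> g) S S"
    using *(2) by (subst bij_betw_cong[where g = "\<psi> \<circ> (g \<circ> inv_into S \<psi>)"]) (auto simp: conj_auto_def)
  moreover have "conj_auto S \<psi> g \<in> hom L L"
  proof (rule homI)
    fix x y assume xy: "x \<in> carrier L" "y \<in> carrier L"
    have gx: "g (inv_into S \<psi> x) \<in> S" "g (inv_into S \<psi> y) \<in> S" 
      using xy bij g by (auto simp: L auto_def Bij_def bij_betw_def K inv_into_into)
    have xy': "x \<otimes>\<^bsub>L\<^esub> y \<in> S"
      using L.m_closed[OF xy] by (simp add: L)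
    show "conj_auto S \<psi> g x \<in> carrier L"
      using gx bij xy by (auto simp: conj_auto_def L bij_betw_def)
    show "conj_auto S \<psi> g (x \<otimes>\<^bsub>L\<^esub> y) = conj_auto S \<psi> g x \<otimes>\<^bsub>L\<^esub> conj_auto S \<psi> g y"
      using hom_mult[OF *(1) xy] xy xy' by (simp add: conj_auto_def L)
  qed
  ultimately show ?thesis
    by (auto simp: auto_def Bij_def L conj_auto_def)
qed

lemma conj_auto_inj:
  assumes \<psi>: "bij_betw \<psi> S S"
  shows "inj_on (conj_auto S \<psi>) (Bij S)"
proof
  fix g h assume g: "g \<in> Bij S" and h: "h \<in> Bij S" and eq: "conj_auto S \<psi> g = conj_auto S \<psi> h"
  show "g = h"
  proof (rule extensionalityI[of _ S])
    fix x assume x: "x \<in> S"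
    have "conj_auto S \<psi> g (\<psi> x) = conj_auto S \<psi> h (\<psi> x)" by (simp add: eq)
    then have "\<psi> (g x) = \<psi> (h x)"
      using x \<psi> bij_betwE[OF \<psi>] by (simp add: conj_auto_def bij_betw_inv_into_left[OF \<psi>])
    then show "g x = h x"
      using x g h inj_onD[OF bij_betw_imp_inj_on[OF \<psi>], of "g x" "h x"]
      by (auto simp: Bij_def dest: bij_betwE)
  qed (use g h in \<open>auto simp: Bij_def\<close>)
qed

text \<open>Isomorphic groups have equally many automorphisms, so the inclusion of finite sets is an
  equality. This is what lets conjugation with an isomorphism from \<open>K\<close> to
  \<open>\<Lambda>\<close> return to \<open>auto K\<close>.\<close>

lemma auto_eq_of_subset:
  assumes "K \<cong> L" "group K" "group L" "carrier K = carrier L" "finite (carrier K)" "auto K \<subseteq> auto L"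
  shows "auto K = auto L"
proof -
  let ?S = "carrier K"
  obtain \<psi> where \<psi>: "\<psi> \<in> iso L K"
    using assms(1,2) group.iso_sym by (metis (no_types) is_iso_def ex_in_conv)
  have "inj_on (conj_auto ?S \<psi>) (auto L)"
    by (rule inj_on_subset[OF conj_auto_inj]) (use \<psi> assms(4) in \<open>auto simp: iso_def auto_def\<close>)
  moreover have "conj_auto ?S \<psi> ` auto L \<subseteq> auto K"
    using conj_auto_in_auto[OF \<psi> _ _ _ assms(3,2)] assms(4) by auto
  ultimately have "card (auto L) \<le> card (auto K)"
    using finite_auto[OF assms(5)] by (metis card_inj_on_le)
  then show ?thesis
    using card_seteq[OF _ assms(6)] finite_auto[of L] assms(4,5) by metis
qed


lemma carrier_AutoGroup [simp]: "carrier (AutoGroup K) = auto K"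
  by (simp add: AutoGroup_def)

lemma mult_AutoGroup:
  "g \<in> auto K \<Longrightarrow> h \<in> auto K \<Longrightarrow> g \<otimes>\<^bsub>AutoGroup K\<^esub> h = compose (carrier K) g h"
  by (simp add: AutoGroup_def BijGroup_def auto_def)

lemma auto_bij: "g \<in> auto K \<Longrightarrow> bij_betw g (carrier K) (carrier K)"
  by (simp add: auto_def Bij_def)

lemma inv_into_auto_mult:
  assumes "group K" "g \<in> auto K" "x \<in> carrier K" "y \<in> carrier K"
  shows "inv_into (carrier K) g (x \<otimes>\<^bsub>K\<^esub> y) =
    inv_into (carrier K) g x \<otimes>\<^bsub>K\<^esub> inv_into (carrier K) g y"
proof -
  interpret group K by fact
  show ?thesis
    using assms(2-) by (intro Bij_inv_into_lemma) (auto simp: auto_def hom_def)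
qed

lemma inv_into_compose:
  assumes "bij_betw g S S" "bij_betw h S S" "k \<in> S"
  shows "inv_into S (compose S g h) k = inv_into S h (inv_into S g k)"
proof -
  let ?x = "inv_into S h (inv_into S g k)"
  have x: "?x \<in> S" "compose S g h ?x = k"
    using assms by (simp_all add: compose_def bij_betw_def inv_into_into f_inv_into_f)
  have "inj_on (compose S g h) S"
    using bij_betw_compose[OF assms(2,1)] by (simp add: bij_betw_def)
  from inv_into_f_f[OF this x(1)] show ?thesis
    by (simp add: x(2))
qed

lemma inv_into_conj_auto:
  assumes "bij_betw \<psi> S S" "bij_betw g S S" "k \<in> S"
  shows "inv_into S \<psi> (inv_into S (conj_auto S \<psi> g) k) = inv_into S g (inv_into S \<psi> k)"
proof -
  have "bij_betw (inv_into S \<psi>) S S"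
    by (rule bij_betw_inv_into[OF assms(1)])
  note bij_betwE[OF this] bij_betwE[OF assms(1)] bij_betwE[OF assms(2)]
    bij_betwE[OF bij_betw_inv_into[OF assms(2)]]
  note mem = this[rule_format]
  let ?x = "\<psi> (inv_into S g (inv_into S \<psi> k))"
  have "conj_auto S \<psi> g ?x = k"
    using assms mem by (simp add: conj_auto_def bij_betw_inv_into_left bij_betw_inv_into_right)
  moreover have "bij_betw (\<psi> \<circ> (g \<circ> inv_into S \<psi>)) S S"
    using assms by (intro bij_betw_trans[of _ S S]) (auto intro: bij_betw_inv_into)
  then have "bij_betw (conj_auto S \<psi> g) S S"
    by (subst bij_betw_cong[where g = "\<psi> \<circ> (g \<circ> inv_into S \<psi>)"]) (auto simp: conj_auto_def)
  ultimately have "inv_into S (conj_auto S \<psi> g) k = ?x"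
    using assms(3) mem by (metis bij_betw_inv_into_left)
  then show ?thesis
    using assms mem by (simp add: bij_betw_inv_into_left)
qed

lemma aut_action_qgroup_action:
  assumes K: "group K" and fin: "finite (carrier K)"
  shows "qgroup_action (AutoGroup K) (finite_qgroup K) (aut_action K)"
proof -
  interpret K: group K by fact
  let ?S = "carrier K"
  note at = finite_qgroup_atomic[OF K fin] and cm = finite_qgroup_comult[OF K fin]
    and act = aut_action_comb[OF K fin]
  interpret A: atomic "finite_qgroup K" ?S "\<lambda>k. mult_operator ?S (delta_vec k)" by (rule at)
  have "qgroup_iso (finite_qgroup K) (finite_qgroup K) (aut_action K g)" if g: "g \<in> auto K" for g
    using qgroup_iso_comb_iff[OF at at cm cm act[OF g] bij_betw_inv_into[OF auto_bij[OF g]]]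
      inv_into_auto_mult[OF K g] by simp
  moreover have "aut_action K (g \<otimes>\<^bsub>AutoGroup K\<^esub> h) T = aut_action K g (aut_action K h T)"
    if g: "g \<in> auto K" and h: "h \<in> auto K" and T_in: "T \<in> elems (finite_qgroup K)" for g h T
  proof -
    obtain c where T: "T = comb (\<lambda>k. mult_operator ?S (delta_vec k)) ?S c"
      by (rule A.elemsE[OF T_in]) blast
    have "g \<otimes>\<^bsub>AutoGroup K\<^esub> h \<in> auto K"
      using group.is_monoid[OF K.AutoGroup] monoid.m_closed[of "AutoGroup K" g h] g h by simp
    then show ?thesis
      unfolding T act[OF g] act[OF h]
      by (subst act) (auto intro!: comb_cong simp: mult_AutoGroup[OF g h] 
          inv_into_compose[OF auto_bij[OF g] auto_bij[OF h]])
  qed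
  ultimately show ?thesis
    by (simp add: qgroup_action_def)
qed

text \<open>With \<open>\<psi>\<close> an isomorphism from \<open>K\<close> to
  \<open>\<Lambda>\<close>, the quantum group isomorphism is dual to the inverse of
  \<open>\<psi>\<close>, and \<open>\<zeta>\<close> is conjugation by \<open>\<psi>\<close>, which
  maps the automorphism group to itself because \<open>auto K = auto \<Lambda>\<close>.\<close>

theorem group_rigid_imp_rigid:
  fixes K :: "('k, 'm) monoid_scheme"
  assumes K: "group K" and fin: "finite (carrier K)" and rigid: "group_rigid K"
  shows "rigid_relative_to_Aut TYPE('j) K"
  unfolding rigid_relative_to_Aut_def rigid_relative_to_def
proof (intro conjI allI impI)
  interpret K: group K by fact
  let ?S = "carrier K" and ?A = "finite_qgroup K"
  let ?P = "\<lambda>k. mult_operator ?S (delta_vec k)"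
  note at = finite_qgroup_atomic[OF K fin] and cm = finite_qgroup_comult[OF K fin]
    and act = aut_action_comb[OF K fin]
  interpret A: atomic ?A ?S ?P by (rule at)
  show "kac_type ?A"
    by (rule group_imp_kac_type[OF at K refl cm])
  show "qgroup_action (AutoGroup K) ?A (aut_action K)"
    by (rule aut_action_qgroup_action[OF K fin])
  fix B :: "'j qgroup" and \<beta> \<pi>
  assume asm: "kac_type B \<and> qgroup_action (AutoGroup K) B \<beta> \<and> star_iso ?A B \<pi> \<and>
    (\<forall>T\<in>elems ?A. haar_state B (\<pi> T) = haar_state ?A T) \<and>
    (\<forall>g\<in>carrier (AutoGroup K). \<forall>T\<in>elems ?A. \<beta> g (\<pi> T) = \<pi> (aut_action K g T))"
  then have cqg: "compact_quantum_group B" and actB: "qgroup_action (AutoGroup K) B \<beta>"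
    and iso: "star_iso ?A B \<pi>"
    and equiv: "\<And>g T. g \<in> auto K \<Longrightarrow> T \<in> elems ?A \<Longrightarrow> \<beta> g (\<pi> T) = \<pi> (aut_action K g T)"
    by (auto simp: kac_type_def)
  have vn: "von_neumann_algebra B"
    using cqg by (simp add: compact_quantum_group_def)
  let ?Q = "\<pi> \<circ> ?P"
  have atB: "atomic B ?S ?Q" and \<pi>: "\<And>c. \<pi> (comb ?P ?S c) = comb ?Q ?S c"
    using star_iso_atomic[OF at iso vn] by auto
  obtain \<Lambda> :: "'k monoid" where \<Lambda>: "group \<Lambda>" "carrier \<Lambda> = ?S" and cmB: "comult_from B ?S ?Q (mult \<Lambda>)"
    by (rule compact_quantum_group_imp_group[OF cqg atB]) blast
  interpret \<Lambda>: group \<Lambda> by fact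
  have \<beta>: "\<beta> g (comb ?Q ?S c) = comb ?Q ?S (c \<circ> inv_into ?S g)" if g: "g \<in> auto K" for g c
    using equiv[OF g A.comb_in_elems] unfolding act[OF g] \<pi> .
  \<comment> \<open>\<open>\<beta> g\<close> is dual to the inverse of \<open>g\<close>, so that
    inverse, and with it \<open>g\<close>, respects the product of \<open>\<Lambda>\<close>.\<close>
  have sub: "auto K \<subseteq> auto \<Lambda>"
  proof
    fix g assume g: "g \<in> auto K"
    have bij: "bij_betw g ?S ?S" by (rule auto_bij[OF g])
    have "qgroup_iso B B (\<beta> g)"
      using actB g by (simp add: qgroup_action_def)
    then have inv_hom: "inv_into ?S g (k \<otimes>\<^bsub>\<Lambda>\<^esub> l) = inv_into ?S g k \<otimes>\<^bsub>\<Lambda>\<^esub> inv_into ?S g l"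
      if "k \<in> ?S" "l \<in> ?S" for k l
      using that unfolding qgroup_iso_comb_iff[OF atB atB cmB cmB \<beta>[OF g] bij_betw_inv_into[OF bij]]
      by blast
    have "g (x \<otimes>\<^bsub>\<Lambda>\<^esub> y) = g x \<otimes>\<^bsub>\<Lambda>\<^esub> g y" if xy: "x \<in> ?S" "y \<in> ?S" for x y
    proof -
      have gxy: "g x \<in> ?S" "g y \<in> ?S"
        using xy bij by (auto dest: bij_betwE)
      then have "inv_into ?S g (g x \<otimes>\<^bsub>\<Lambda>\<^esub> g y) = x \<otimes>\<^bsub>\<Lambda>\<^esub> y"
        using inv_hom[OF gxy] xy by (simp add: bij_betw_inv_into_left[OF bij])
      moreover have "g x \<otimes>\<^bsub>\<Lambda>\<^esub> g y \<in> ?S"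
        using gxy \<Lambda>.m_closed[of "g x" "g y"] by (simp add: \<Lambda>(2))
      ultimately show ?thesis
        using bij_betw_inv_into_right[OF bij] by metis
    qed
    then have "g \<in> hom \<Lambda> \<Lambda>"
      using bij by (intro homI) (auto simp: \<Lambda>(2) dest: bij_betwE)
    then show "g \<in> auto \<Lambda>"
      using g by (simp add: auto_def \<Lambda>(2))
  qed
  then have "K \<cong> \<Lambda>"
    using rigid \<Lambda> by (simp add: group_rigid_def)
  then obtain \<psi> where \<psi>: "\<psi> \<in> iso K \<Lambda>"
    by (auto simp: is_iso_def)
  have auto_eq: "auto K = auto \<Lambda>"
    using auto_eq_of_subset[OF \<open>K \<cong> \<Lambda>\<close> K \<Lambda>(1) \<Lambda>(2)[symmetric] fin sub] .
  have bij\<psi>: "bij_betw \<psi> ?S ?S"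
    using \<psi> by (simp add: iso_def \<Lambda>(2))
  have inv\<psi>: "inv_into ?S \<psi> \<in> hom \<Lambda> K"
    using K.iso_set_sym[OF \<psi>] by (simp add: iso_def)
  define \<pi>\<^sub>0 where "\<pi>\<^sub>0 = pullback ?P ?Q ?S (inv_into ?S \<psi>)"
  have \<pi>\<^sub>0: "\<pi>\<^sub>0 (comb ?P ?S c) = comb ?Q ?S (c \<circ> inv_into ?S \<psi>)" for c
    unfolding \<pi>\<^sub>0_def by (rule pullback_comb[OF A.resolution_axioms])
      (use bij_betwE[OF bij_betw_inv_into[OF bij\<psi>]] in blast)
  define \<zeta> where "\<zeta> = (\<lambda>g\<in>auto K. conj_auto ?S \<psi> g)"
  have \<zeta>: "conj_auto ?S \<psi> g \<in> auto K" if "g \<in> auto K" for g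
    using conj_auto_in_auto[OF \<psi> refl \<Lambda>(2) that K \<Lambda>(1)] by (simp add: auto_eq)
  show "\<exists>\<pi>\<^sub>0 \<zeta>. qgroup_iso ?A B \<pi>\<^sub>0 \<and> \<zeta> \<in> auto (AutoGroup K) \<and>
      (\<forall>g\<in>carrier (AutoGroup K). \<forall>T\<in>elems ?A. \<beta> (\<zeta> g) (\<pi>\<^sub>0 T) = \<pi>\<^sub>0 (aut_action K g T))"
  proof (intro exI conjI ballI)
    show "qgroup_iso ?A B \<pi>\<^sub>0"
      using hom_mult[OF inv\<psi>]
      by (simp add: qgroup_iso_comb_iff[OF at atB cm cmB \<pi>\<^sub>0 bij_betw_inv_into[OF bij\<psi>]] \<Lambda>(2))
    show "\<zeta> \<in> auto (AutoGroup K)"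
    proof -
      have "inj_on (conj_auto ?S \<psi>) (auto K)"
        by (rule inj_on_subset[OF conj_auto_inj[OF bij\<psi>]]) (simp add: auto_def)
      then have "inj_on \<zeta> (auto K)"
        by (simp add: \<zeta>_def inj_on_def)
      moreover have "\<zeta> ` auto K \<subseteq> auto K"
        using \<zeta> by (auto simp: \<zeta>_def)
      ultimately have bij\<zeta>: "bij_betw \<zeta> (auto K) (auto K)"
        using finite_auto[OF fin] by (simp add: bij_betw_def endo_inj_surj)
      have "\<zeta> (g \<otimes>\<^bsub>AutoGroup K\<^esub> h) = \<zeta> g \<otimes>\<^bsub>AutoGroup K\<^esub> \<zeta> h"
        if g: "g \<in> auto K" and h: "h \<in> auto K" for g h
      proof -
        have gh: "compose ?S g h \<in> auto K"
          using group.is_monoid[OF K.AutoGroup] monoid.m_closed[of "AutoGroup K" g h] g h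
          by (simp add: mult_AutoGroup)
        have "conj_auto ?S \<psi> (compose ?S g h) = compose ?S (conj_auto ?S \<psi> g) (conj_auto ?S \<psi> h)"
        proof
          fix k
          show "conj_auto ?S \<psi> (compose ?S g h) k =
              compose ?S (conj_auto ?S \<psi> g) (conj_auto ?S \<psi> h) k"
          proof (cases "k \<in> ?S")
            case True
            have i: "inv_into ?S \<psi> k \<in> ?S"
              using True bij_betwE[OF bij_betw_inv_into[OF bij\<psi>]] by blast
            moreover have "h (inv_into ?S \<psi> k) \<in> ?S"
              using i bij_betwE[OF auto_bij[OF h]] by blast
            moreover from this have "\<psi> (h (inv_into ?S \<psi> k)) \<in> ?S"
              using bij_betwE[OF bij\<psi>] by blast
            ultimately show ?thesis
              using True by (simp add: conj_auto_def compose_def bij_betw_inv_into_left[OF bij\<psi>])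
          qed (simp add: conj_auto_def compose_def)
        qed
        then show ?thesis
          using g h gh \<zeta> by (simp add: \<zeta>_def mult_AutoGroup)
      qed
      then have "\<zeta> \<in> hom (AutoGroup K) (AutoGroup K)"
        using \<zeta> by (intro homI) (auto simp: \<zeta>_def)
      then show ?thesis
        using bij\<zeta> by (simp add: auto_def[of "AutoGroup K"] Bij_def) (simp add: \<zeta>_def)
    qed
    fix g T assume "g \<in> carrier (AutoGroup K)" and T_in: "T \<in> elems ?A"
    then have g: "g \<in> auto K" by simp
    obtain c where T: "T = comb ?P ?S c" by (rule A.elemsE[OF T_in]) blast
    have \<zeta>g: "\<zeta> g = conj_auto ?S \<psi> g"
      using g by (simp add: \<zeta>_def)
    show "\<beta> (\<zeta> g) (\<pi>\<^sub>0 T) = \<pi>\<^sub>0 (aut_action K g T)"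
      unfolding T act[OF g] \<pi>\<^sub>0 \<zeta>g \<beta>[OF \<zeta>[OF g]]
      by (rule comb_cong) (simp add: inv_into_conj_auto[OF bij\<psi> auto_bij[OF g]])
  qed
qed


section \<open>Two by two matrices and the projective line\<close>

definition mat2 :: "'a \<Rightarrow> 'a \<Rightarrow> 'a \<Rightarrow> 'a \<Rightarrow> 'a::zero ^ 2 ^ 2" where
  "mat2 a b c d = vector [vector [a, b], vector [c, d]]"

lemma mat2_nth [simp]:
  "mat2 a b c d $ 1 $ 1 = a" "mat2 a b c d $ 1 $ 2 = b"
  "mat2 a b c d $ 2 $ 1 = c" "mat2 a b c d $ 2 $ 2 = d"
  by (simp_all add: mat2_def)

lemma mat2_eq_iff [simp]:
  "mat2 a b c d = mat2 a' b' c' d' \<longleftrightarrow> a = a' \<and> b = b' \<and> c = c' \<and> d = d'"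
  by (metis mat2_nth)

lemma mat2_exhaust [cases type]:
  obtains a b c d where "A = mat2 a b c d"
  by (rule that[of "A $ 1 $ 1" "A $ 1 $ 2" "A $ 2 $ 1" "A $ 2 $ 2"])
    (simp add: vec_eq_iff forall_2)

lemma mat2_mult [simp]:
  fixes a :: "'a::semiring_1"
  shows "mat2 a b c d ** mat2 a' b' c' d' =
    mat2 (a * a' + b * c') (a * b' + b * d') (c * a' + d * c') (c * b' + d * d')"
  by (simp add: vec_eq_iff forall_2 matrix_matrix_mult_def sum_2)

lemma det_mat2 [simp]: "det (mat2 a b c d) = a * d - b * (c :: 'a::comm_ring_1)"
  by (simp add: det_2)

lemma mat_eq_mat2: "mat k = mat2 k 0 0 (k :: 'a::semiring_1)"
  by (simp add: vec_eq_iff forall_2 mat_def)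

abbreviation GL :: "('f::field ^ 2 ^ 2) set" where "GL \<equiv> {A. det A \<noteq> 0}"
abbreviation SL :: "('f::field ^ 2 ^ 2) set" where "SL \<equiv> {A. det A = 1}"

lemma invertible_iff_GL: "invertible A \<longleftrightarrow> (A :: 'f::field ^ 2 ^ 2) \<in> GL"
  by (simp add: invertible_det_nz)

lemma GL_mult: "A \<in> GL \<Longrightarrow> B \<in> GL \<Longrightarrow> A ** B \<in> GL"
  by (simp add: det_mul)

lemma SL_mult: "A \<in> SL \<Longrightarrow> B \<in> SL \<Longrightarrow> A ** B \<in> SL"
  by (simp add: det_mul)

lemma matrix_inv_GL:
  assumes "(A :: 'f::field ^ 2 ^ 2) \<in> GL"
  shows "A ** matrix_inv A = mat 1" "matrix_inv A ** A = mat 1" "matrix_inv A \<in> GL"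
    "det (matrix_inv A) = 1 / det A"
proof -
  have i: "invertible A" using assms by (simp only: invertible_iff_GL)
  show 1: "A ** matrix_inv A = mat 1" and "matrix_inv A ** A = mat 1"
    unfolding matrix_inv_def using someI_ex[OF i[unfolded invertible_def]] by simp_all
  have "det A * det (matrix_inv A) = 1"
    using arg_cong[OF 1, of det] by (simp add: det_mul mat_eq_mat2)
  then show "matrix_inv A \<in> GL" "det (matrix_inv A) = 1 / det A"
    using assms by (auto simp: field_simps)
qed

lemma matrix_inv_eqI:
  fixes A :: "'f::field ^ 2 ^ 2"
  assumes "A ** B = mat 1"
  shows "matrix_inv A = B"
proof -
  have "det A * det B = 1"
    using arg_cong[OF assms, of det] by (simp add: det_mul mat_eq_mat2)
  then have "A \<in> GL" by auto
  then have "matrix_inv A = matrix_inv A ** (A ** B)"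
    by (simp add: assms)
  also have "\<dots> = B"
    by (simp add: matrix_mul_assoc matrix_inv_GL(2)[OF \<open>A \<in> GL\<close>])
  finally show ?thesis .
qed

lemma matrix_inv_mult:
  fixes A B :: "'f::field ^ 2 ^ 2"
  assumes "A \<in> GL" "B \<in> GL"
  shows "matrix_inv (A ** B) = matrix_inv B ** matrix_inv A"
proof (rule matrix_inv_eqI)
  have "A ** B ** (matrix_inv B ** matrix_inv A) = A ** (B ** matrix_inv B) ** matrix_inv A"
    by (simp only: matrix_mul_assoc)
  then show "A ** B ** (matrix_inv B ** matrix_inv A) = mat 1"
    using assms by (simp add: matrix_inv_GL)
qed

text \<open>The point of the projective line with homogeneous coordinates \<open>x : y\<close>.\<close>

definition pt :: "'f::field \<Rightarrow> 'f \<Rightarrow> 'f option" where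
  "pt x y = (if y = 0 then None else Some (x / y))"

text \<open>The action by fractional linear maps, with \<open>None\<close> as the point at infinity
  \<open>1 : 0\<close>.\<close>

definition mob :: "'f::field ^ 2 ^ 2 \<Rightarrow> 'f option \<Rightarrow> 'f option" where
  "mob A z = (case z of None \<Rightarrow> pt (A $ 1 $ 1) (A $ 2 $ 1)
     | Some x \<Rightarrow> pt (A $ 1 $ 1 * x + A $ 1 $ 2) (A $ 2 $ 1 * x + A $ 2 $ 2))"

lemma mob_pt:
  assumes "x \<noteq> 0 \<or> y \<noteq> 0"
  shows "mob (mat2 a b c d) (pt x y) = pt (a * x + b * y) (c * x + d * y)"
proof (cases "y = 0")
  case True
  then show ?thesis using assms by (simp add: mob_def pt_def)
next
  case False
  have "c * (x / y) + d = (c * x + d * y) / y" "a * (x / y) + b = (a * x + b * y) / y"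
    using False by (simp_all add: field_simps)
  then show ?thesis
    using False by (simp add: mob_def pt_def)
qed

lemma pt_exhaust:
  obtains x y where "z = pt x y" "x \<noteq> 0 \<or> y \<noteq> 0"
proof (cases z)
  case None
  then show ?thesis using that[of 1 0] by (simp add: pt_def)
next
  case (Some x)
  then show ?thesis using that[of x 1] by (simp add: pt_def)
qed

lemma mob_mult:
  fixes A B :: "'f::field ^ 2 ^ 2"
  assumes "B \<in> GL"
  shows "mob (A ** B) = mob A \<circ> mob B"
proof
  fix z :: "'f option"
  obtain x y where z: "z = pt x y" "x \<noteq> 0 \<or> y \<noteq> 0" by (rule pt_exhaust)
  obtain a b c d where A: "A = mat2 a b c d" by (rule mat2_exhaust)
  obtain e f g h where B: "B = mat2 e f g h" by (rule mat2_exhaust)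
  \<comment> \<open>Cramer's rule: the adjugate recovers the determinant times the vector, so an
    invertible matrix cannot send a nonzero vector to zero.\<close>
  have "(e * h - f * g) * x = h * (e * x + f * y) - f * (g * x + h * y)"
    "(e * h - f * g) * y = e * (g * x + h * y) - g * (e * x + f * y)"
    by (simp_all add: algebra_simps)
  then have "e * x + f * y \<noteq> 0 \<or> g * x + h * y \<noteq> 0"
    using assms z(2) by (auto simp: B)
  then show "mob (A ** B) z = (mob A \<circ> mob B) z"
    by (simp add: A B z(1) mob_pt[OF z(2)] mob_pt algebra_simps)
qed

lemma mob_mat [simp]: "k \<noteq> 0 \<Longrightarrow> mob (mat k) = id"
  by (rule ext, rule_tac z = x in pt_exhaust) (simp add: mat_eq_mat2 mob_pt, simp add: pt_def)

lemma mob_inv: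
  assumes "A \<in> GL"
  shows "mob A \<circ> mob (matrix_inv A) = id" "mob (matrix_inv A) \<circ> mob A = id"
  using mob_mult[OF matrix_inv_GL(3)[OF assms], of A] mob_mult[OF assms, of "matrix_inv A"]
  by (simp_all add: matrix_inv_GL[OF assms])

lemma mob_bij: "A \<in> GL \<Longrightarrow> bij (mob A)"
  using mob_inv[of A] o_bij by blast

text \<open>The quotient of \<open>A\<close> by \<open>B\<close> fixes infinity, 0 and 1. The first
  two make it diagonal, the third scalar.\<close>

lemma mob_eq_iff:
  assumes A: "A \<in> GL" and B: "B \<in> GL"
  shows "mob A = mob B \<longleftrightarrow> (\<exists>k. k \<noteq> 0 \<and> A = mat k ** B)"
proof
  assume eq: "mob A = mob B"
  define D where "D = matrix_inv B ** A"
  obtain a b c d where D2: "D = mat2 a b c d" by (rule mat2_exhaust)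
  have "mob D = id"
    by (simp add: D_def mob_mult[OF A] eq mob_inv[OF B])
  then have "mob D None = None" "mob D (Some 0) = Some 0" "mob D (Some 1) = Some 1"
    by simp_all
  then have D: "D = mat a" "a \<noteq> 0"
    by (auto simp: D2 mob_def pt_def mat_eq_mat2 split: if_splits)
  have "A = B ** D"
    by (simp add: D_def matrix_mul_assoc matrix_inv_GL[OF B])
  also have "\<dots> = mat a ** B"
    by (cases B rule: mat2_exhaust) (simp add: D mat_eq_mat2)
  finally show "\<exists>k. k \<noteq> 0 \<and> A = mat k ** B"
    using D(2) by blast
next
  assume "\<exists>k. k \<noteq> 0 \<and> A = mat k ** B"
  then show "mob A = mob B"
    by (auto simp: mob_mult[OF B])
qed

abbreviation umat :: "'f::field \<Rightarrow> 'f ^ 2 ^ 2" where "umat t \<equiv> mat2 1 t 0 1"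
abbreviation lmat :: "'f::field \<Rightarrow> 'f ^ 2 ^ 2" where "lmat t \<equiv> mat2 1 0 t 1"

lemma mob_umat [simp]: "mob (umat t) None = None" "mob (umat t) (Some x) = Some (x + t)"
  by (simp_all add: mob_def pt_def)

lemma mob_transitive:
  obtains g where "g \<in> SL" "mob g None = z"
proof (cases z)
  case None
  then show ?thesis using that[of "mat 1"] by (simp add: mat_eq_mat2 mob_def pt_def)
next
  case (Some x)
  then show ?thesis using that[of "mat2 x (-1) 1 0"] by (simp add: mob_def pt_def)
qed

text \<open>The translations \<open>umat t\<close> fix infinity and move 0 to any finite point,
  which upgrades transitivity on points to pairs.\<close>

lemma mob_transitive2:
  assumes "z \<noteq> w"
  obtains g where "g \<in> SL" "mob g None = z" "mob g (Some 0) = w"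
proof -
  obtain h where h: "h \<in> SL" "mob h None = z" by (rule mob_transitive)
  then have hG: "h \<in> GL" by simp
  obtain y where y: "w = mob h y"
    using mob_bij[OF hG] by (metis bij_pointE)
  then obtain t where t: "y = Some t"
    using assms h by (cases y) auto
  show ?thesis
  proof (rule that[of "h ** umat t"])
    show "h ** umat t \<in> SL" using h(1) by (simp add: det_mul)
    have "umat t \<in> GL" by simp
    from mob_mult[OF this, of h] show "mob (h ** umat t) None = z" "mob (h ** umat t) (Some 0) = w"
      by (simp_all add: h y t)
  qed
qed

section \<open>Orders of the matrix groups and of their images\<close>

lemma card_fibres:
  assumes "finite S" "\<And>y. y \<in> f ` S \<Longrightarrow> card {x \<in> S. f x = y} = n"
  shows "card S = n * card (f ` S)"
proof -
  have "card S = (\<Sum>y\<in>f ` S. card {x \<in> S. f x = y})"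
    using sum.image_gen[OF assms(1), of "\<lambda>_. 1::nat" f] by simp
  then show ?thesis
    using assms(2) by simp
qed

context
  fixes TF :: "'f::{field,finite} itself"
begin

text \<open>A matrix with \<open>c \<noteq> 0\<close> is determined by \<open>c\<close>,
  \<open>a\<close> and \<open>d\<close>; one with \<open>c = 0\<close> by
  \<open>a \<noteq> 0\<close> and \<open>b\<close>.\<close>

lemma card_SL: "card (SL :: ('f ^ 2 ^ 2) set) = (CARD('f) - 1) * CARD('f) * (CARD('f) + 1)"
proof -
  let ?U = "UNIV :: 'f set" and ?V = "- {0} :: 'f set"
  define f where "f = (\<lambda>(c, a, d). mat2 a ((a * d - 1) / c) c d :: 'f ^ 2 ^ 2)"
  define g where "g = (\<lambda>(a, b). mat2 a b 0 (1 / a) :: 'f ^ 2 ^ 2)"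
  have "(SL :: ('f ^ 2 ^ 2) set) = f ` (?V \<times> ?U \<times> ?U) \<union> g ` (?V \<times> ?U)"
  proof
    show "SL \<subseteq> f ` (?V \<times> ?U \<times> ?U) \<union> g ` (?V \<times> ?U)"
    proof
      fix A :: "'f ^ 2 ^ 2" assume A: "A \<in> SL"
      obtain a b c d where A2: "A = mat2 a b c d" by (rule mat2_exhaust)
      show "A \<in> f ` (?V \<times> ?U \<times> ?U) \<union> g ` (?V \<times> ?U)"
      proof (cases "c = 0")
        case True
        then have ad: "a * d = 1"
          using A by (simp add: A2)
        then have "a \<noteq> 0" by auto
        moreover from this have "d = 1 / a"
          using nonzero_eq_divide_eq[of a d 1] ad by (simp add: mult.commute)
        ultimately have "a \<noteq> 0" "A = g (a, b)"
          by (simp_all add: A2 g_def True)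
        then show ?thesis by (intro UnI2 image_eqI[of _ _ "(a, b)"]) auto
      next
        case False
        have "b * c = a * d - 1"
          using A by (simp add: A2 algebra_simps)
        then have "b = (a * d - 1) / c"
          using nonzero_eq_divide_eq[OF False, of b] by simp
        then have "A = f (c, a, d)"
          by (simp add: A2 f_def)
        then show ?thesis using False by (intro UnI1 image_eqI[of _ _ "(c, a, d)"]) auto
      qed
    qed
    show "f ` (?V \<times> ?U \<times> ?U) \<union> g ` (?V \<times> ?U) \<subseteq> SL"
      by (auto simp: f_def g_def split: if_splits)
  qed
  moreover have "f ` (?V \<times> ?U \<times> ?U) \<inter> g ` (?V \<times> ?U) = {}"
    by (auto simp: f_def g_def)
  moreover have "inj_on f (?V \<times> ?U \<times> ?U)" "inj_on g (?V \<times> ?U)"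
    by (auto simp: f_def g_def inj_on_def)
  moreover have "card ?V = CARD('f) - 1"
    by (simp add: card_Diff_subset flip: Compl_eq_Diff_UNIV Diff_UNIV) (simp add: Compl_eq_Diff_UNIV card_Diff_singleton)
  ultimately have "card (SL :: ('f ^ 2 ^ 2) set) = (CARD('f) - 1) * (CARD('f) * CARD('f)) + (CARD('f) - 1) * CARD('f)"
    by (simp add: card_Un_disjoint card_image card_cartesian_product)
  then show ?thesis
    by (simp add: algebra_simps)
qed

lemma not_sq_dvd_card_SL:
  assumes p: "prime (CARD('f))"
  shows "\<not> (CARD('f))\<^sup>2 dvd card (SL :: ('f ^ 2 ^ 2) set)"
proof
  let ?p = "CARD('f)"
  have gt: "?p > 1" using p prime_gt_1_nat by blast
  assume "?p\<^sup>2 dvd card (SL :: ('f ^ 2 ^ 2) set)"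
  then have "?p * ?p dvd ?p * ((?p - 1) * (?p + 1))"
    by (simp add: card_SL power2_eq_square mult_ac)
  then have "?p dvd (?p - 1) * (?p + 1)"
    using gt by simp
  then have "?p dvd ?p - 1 \<or> ?p dvd ?p + 1"
    by (rule prime_dvd_multD[OF p])
  then show False
    using gt dvd_imp_le[of ?p "?p - 1"] dvd_add_right_iff[of ?p ?p 1] by auto
qed

lemma scalar_fibre:
  assumes B: "(B :: 'f ^ 2 ^ 2) \<in> S" and S: "S = GL \<or> S = SL"
  shows "card {A \<in> S. mob A = mob B} = card {k :: 'f. k \<noteq> 0 \<and> mat k \<in> S}"
proof -
  have BG: "B \<in> GL" using assms by auto
  have "{A \<in> S. mob A = mob B} = (\<lambda>k. mat k ** B) ` {k. k \<noteq> 0 \<and> mat k \<in> S}"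
  proof (intro equalityI subsetI)
    fix A assume A: "A \<in> {A \<in> S. mob A = mob B}"
    then have "A \<in> GL" using S by auto
    with A obtain k where k: "k \<noteq> 0" "A = mat k ** B"
      using mob_eq_iff[OF _ BG] by blast
    then have "mat k \<in> S"
      using A B S by (auto simp: det_mul mat_eq_mat2)
    then show "A \<in> (\<lambda>k. mat k ** B) ` {k. k \<noteq> 0 \<and> mat k \<in> S}"
      using k by blast
  next
    fix A assume "A \<in> (\<lambda>k. mat k ** B) ` {k. k \<noteq> 0 \<and> mat k \<in> S}"
    then show "A \<in> {A \<in> S. mob A = mob B}"
      using B S by (auto simp: mob_mult[OF BG] det_mul)
  qed
  moreover have "inj_on (\<lambda>k. mat k ** B) {k. k \<noteq> 0 \<and> mat k \<in> S}"
  proof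
    fix k k' assume "mat k ** B = mat k' ** B"
    then have "mat k ** (B ** matrix_inv B) = mat k' ** (B ** matrix_inv B)"
      by (simp only: matrix_mul_assoc)
    then show "k = k'"
      by (simp add: matrix_inv_GL[OF BG]) (simp add: mat_eq_mat2)
  qed
  ultimately show ?thesis
    by (simp add: card_image)
qed

lemma card_GL: "card (GL :: ('f ^ 2 ^ 2) set) = (CARD('f) - 1) * card (SL :: ('f ^ 2 ^ 2) set)"
proof -
  have "card {A \<in> GL. det A = k} = card (SL :: ('f ^ 2 ^ 2) set)" if "k \<noteq> 0" for k :: 'f
  proof (rule bij_betw_same_card[OF bij_betwI[of "\<lambda>A. mat2 (1 / k) 0 0 1 ** A" _ _ "\<lambda>A. mat2 k 0 0 1 ** A"]])
  qed (use that in \<open>auto simp: det_mul matrix_mul_assoc simp flip: mat_eq_mat2\<close>)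
  moreover have "det ` (GL :: ('f ^ 2 ^ 2) set) = - {0}"
  proof (intro equalityI subsetI)
    fix k :: 'f assume "k \<in> - {0}"
    then show "k \<in> det ` (GL :: ('f ^ 2 ^ 2) set)"
      by (intro image_eqI[of _ _ "mat2 k 0 0 1"]) auto
  qed auto
  ultimately have "card (GL :: ('f ^ 2 ^ 2) set) = card (SL :: ('f ^ 2 ^ 2) set) * card (- {0} :: 'f set)"
    using card_fibres[of "GL :: ('f ^ 2 ^ 2) set" det] by auto
  then show ?thesis
    by (simp add: Compl_eq_Diff_UNIV card_Diff_singleton)
qed

text \<open>The determinant and the scalar matrices both account for a factor
  \<open>CARD('f) - 1\<close>, so passing from \<open>GL\<close> to either \<open>SL\<close> or
  \<open>PGL2\<close> divides the order by the same number.\<close>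

lemma card_mob_GL: "card (mob ` (GL :: ('f ^ 2 ^ 2) set)) = card (SL :: ('f ^ 2 ^ 2) set)"
proof -
  have "{k :: 'f. k \<noteq> 0 \<and> mat k \<in> (GL :: ('f ^ 2 ^ 2) set)} = UNIV - {0}"
    by (auto simp: mat_eq_mat2)
  then have "card (GL :: ('f ^ 2 ^ 2) set) = (CARD('f) - 1) * card (mob ` (GL :: ('f ^ 2 ^ 2) set))"
    using card_fibres[of "GL :: ('f ^ 2 ^ 2) set" mob, OF _ ] scalar_fibre[of _ "GL :: ('f ^ 2 ^ 2) set"]
    by (auto simp: card_Diff_singleton)
  moreover have "CARD('f) > 1"
    using card_mono[of "UNIV :: 'f set" "{0, 1}"] by simp
  ultimately show ?thesis
    by (simp add: card_GL)
qed

text \<open>The scalars in \<open>SL\<close> are the square roots of 1. Leaving their number open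
  covers characteristic two as well.\<close>

lemma card_mob_SL:
  "card (SL :: ('f ^ 2 ^ 2) set) = card {k :: 'f. k\<^sup>2 = 1} * card (mob ` (SL :: ('f ^ 2 ^ 2) set))"
proof -
  have "{k :: 'f. k \<noteq> 0 \<and> mat k \<in> (SL :: ('f ^ 2 ^ 2) set)} = {k. k\<^sup>2 = 1}"
    by (auto simp: mat_eq_mat2 power2_eq_square)
  then show ?thesis
    using card_fibres[of "SL :: ('f ^ 2 ^ 2) set" mob] scalar_fibre[of _ "SL :: ('f ^ 2 ^ 2) set"]
    by auto
qed

lemma card_square_roots: "card {k :: 'f. k\<^sup>2 = 1} \<le> 2"
proof -
  have "{k :: 'f. k\<^sup>2 = 1} \<subseteq> {1, -1}"
    by (auto simp: power2_eq_1_iff)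
  then have "card {k :: 'f. k\<^sup>2 = 1} \<le> card {1, -1 :: 'f}"
    by (intro card_mono) auto
  also have "\<dots> \<le> 2"
    by (simp add: card_insert_if)
  finally show ?thesis .
qed

lemma not_sq_dvd_card_mob:
  assumes p: "prime (CARD('f))" and "S = GL \<or> S = SL"
  shows "\<not> (CARD('f))\<^sup>2 dvd card (mob ` (S :: ('f ^ 2 ^ 2) set))"
  using not_sq_dvd_card_SL[OF p] assms(2) card_mob_GL card_mob_SL by (metis dvd_mult)

end


section \<open>Actions of \<open>GL\<^sub>2\<close> on a finite group\<close>

text \<open>The multiples of 1 below \<open>CARD('f)\<close> are distinct, since Bezout would turn a
  smaller vanishing multiple into \<open>1 = 0\<close>; hence they fill the field.\<close>

lemma prime_field_of_nat:
  assumes p: "prime (CARD('f::{field,finite}))"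
  obtains n where "(t :: 'f) = of_nat n"
proof -
  let ?p = "CARD('f)"
  \<comment> \<open>Adding 1 permutes the field; comparing the two sums shows that
    \<open>CARD('f)\<close> times 1 vanishes.\<close>
  have "(\<Sum>x\<in>UNIV. x + 1 :: 'f) = (\<Sum>x\<in>UNIV. x)"
    by (rule sum.reindex_bij_witness[of _ "\<lambda>x. x - 1" "\<lambda>x. x + 1"]) auto
  then have p0: "of_nat ?p = (0 :: 'f)"
    by (simp add: sum.distrib)
  have nz: "of_nat k \<noteq> (0 :: 'f)" if k0: "0 < k" "k < ?p" for k
  proof
    assume k: "of_nat k = (0 :: 'f)"
    have "coprime k ?p"
      using p k0 by (metis coprime_commute dvd_imp_le not_le prime_imp_coprime)
    moreover obtain x y where "k * x = ?p * y + gcd k ?p"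
      using bezout_nat[of k ?p] k0(1) by auto
    ultimately have "k * x = ?p * y + 1"
      by simp
    from arg_cong[OF this, of "of_nat :: nat \<Rightarrow> 'f"] show False
      by (simp add: k p0)
  qed
  have "inj_on (of_nat :: nat \<Rightarrow> 'f) {..<?p}"
  proof (rule linorder_inj_onI)
    fix i j assume "i < j" "i \<in> {..<?p}" "j \<in> {..<?p}"
    then show "(of_nat i :: 'f) \<noteq> of_nat j"
      using nz[of "j - i"] less_imp_diff_less[of j ?p i] by (auto simp: of_nat_diff)
  qed auto
  then have "card ((of_nat :: nat \<Rightarrow> 'f) ` {..<?p}) = ?p"
    by (simp add: card_image)
  then have "(of_nat :: nat \<Rightarrow> 'f) ` {..<?p} = UNIV"
    by (intro card_subset_eq) auto
  then show ?thesis
    using that by blast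
qed

section \<open>Subgroups of prime order in a finite group\<close>

context group
begin

lemma subgroup_card_dvd:
  assumes "subgroup H G" "subgroup K G" "H \<subseteq> K"
  shows "card H dvd card K"
  using group.lagrange[OF subgroup_imp_group[OF assms(2)] subgroup_incl[OF assms]]
  by (simp add: order_def) (metis dvd_triv_right)

lemma prime_subgroups_eq:
  assumes "prime p" "subgroup H G" "subgroup K G" "card H = p" "card K = p"
    and y: "y \<in> H" "y \<in> K" "y \<noteq> \<one>"
  shows "H = K"
proof -
  have fin: "finite H" "finite K"
    using assms prime_gt_0_nat card_ge_0_finite by metis+
  have s: "subgroup (H \<inter> K) G"
    by (rule subgroups_Inter_pair[OF assms(2,3)])
  have "card (H \<inter> K) dvd p"
    using subgroup_card_dvd[OF s assms(2)] assms(4) by simp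
  moreover have "card {\<one>, y} \<le> card (H \<inter> K)"
    using y subgroup.one_closed[OF s] fin by (intro card_mono) auto
  ultimately have c: "card (H \<inter> K) = p"
    using \<open>prime p\<close> y(3) by (auto simp: prime_nat_iff)
  have "H \<inter> K = H" "H \<inter> K = K"
    by (rule card_subset_eq; use c assms(4,5) fin in simp)+
  then show ?thesis by blast
qed

text \<open>If they differed, they would meet trivially and their product would be a subgroup of
  order \<open>p\<^sup>2\<close>, contrary to Lagrange.\<close>

lemma normalizing_prime_subgroups_eq:
  assumes "prime p" and H: "subgroup H G" and K: "subgroup K G" and c: "card H = p" "card K = p"
    and fin: "finite (carrier G)" and not_sq: "\<not> p\<^sup>2 dvd order G"
    and norm: "\<And>h k. h \<in> H \<Longrightarrow> k \<in> K \<Longrightarrow> h \<otimes> k \<otimes> inv h \<in> K"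
  shows "H = K"
proof (rule ccontr)
  assume "H \<noteq> K"
  then have triv: "y = \<one>" if "y \<in> H" "y \<in> K" for y
    using prime_subgroups_eq[OF assms(1-5)] that by blast
  interpret H: subgroup H G by fact
  interpret K: subgroup K G by fact
  let ?f = "\<lambda>(h, k). h \<otimes> k"
  have "inj_on ?f (H \<times> K)"
  proof (clarsimp simp: inj_on_def)
    fix h k h' k' assume h: "h \<in> H" "h' \<in> H" and k: "k \<in> K" "k' \<in> K" and eq: "h \<otimes> k = h' \<otimes> k'"
    have "inv h' \<otimes> h = inv h' \<otimes> (h \<otimes> k) \<otimes> inv k"
      using h k by (simp add: m_assoc)
    also have "\<dots> = k' \<otimes> inv k"
      using h k by (simp add: eq m_assoc[symmetric])
    finally have e: "inv h' \<otimes> h = k' \<otimes> inv k" .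
    have "inv h' \<otimes> h = \<one>"
      by (rule triv) (use h k in \<open>simp, simp add: e\<close>)
    then have "h = h'"
      using h by (metis H.mem_carrier inv_closed inv_equality inv_inv)
    then show "h = h' \<and> k = k'"
      using eq h k by simp
  qed
  then have card: "card (?f ` (H \<times> K)) = p\<^sup>2"
    using c by (simp add: card_image card_cartesian_product power2_eq_square)
  have "subgroup (?f ` (H \<times> K)) G"
  proof (rule subgroupI)
    show "?f ` (H \<times> K) \<subseteq> carrier G" by auto
    show "?f ` (H \<times> K) \<noteq> {}" using H.one_closed K.one_closed by blast
    fix a assume "a \<in> ?f ` (H \<times> K)"
    then obtain h k where a: "h \<in> H" "k \<in> K" "a = h \<otimes> k" by auto
    have "inv a = inv h \<otimes> (h \<otimes> inv k \<otimes> inv h)"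
      using a by (simp add: inv_mult_group m_assoc[symmetric])
    then show "inv a \<in> ?f ` (H \<times> K)"
      using a norm[of h "inv k"] by (intro image_eqI[of _ _ "(inv h, h \<otimes> inv k \<otimes> inv h)"]) auto
    fix b assume "b \<in> ?f ` (H \<times> K)"
    then obtain h' k' where b: "h' \<in> H" "k' \<in> K" "b = h' \<otimes> k'" by auto
    have "inv h' \<otimes> k \<otimes> h' \<in> K"
      using norm[of "inv h'" k] a b by simp
    moreover have "a \<otimes> b = (h \<otimes> h') \<otimes> ((inv h' \<otimes> k \<otimes> h') \<otimes> k')"
    proof -
      define x where "x = inv h' \<otimes> k \<otimes> h'"
      have x: "x \<in> carrier G" "h' \<otimes> x = k \<otimes> h'"
        using a b by (simp_all add: x_def m_assoc[symmetric])
      have "(h \<otimes> h') \<otimes> (x \<otimes> k') = h \<otimes> (h' \<otimes> x) \<otimes> k'"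
        using a(1,2) b(1,2) x(1) by (simp add: m_assoc)
      also have "\<dots> = a \<otimes> b"
        unfolding x(2) a(3) b(3) using a(1,2) b(1,2) by (simp add: m_assoc)
      finally show ?thesis
        by (simp add: x_def)
    qed
    ultimately show "a \<otimes> b \<in> ?f ` (H \<times> K)"
      using a b by (intro image_eqI[of _ _ "(h \<otimes> h', (inv h' \<otimes> k \<otimes> h') \<otimes> k')"]) auto
  qed
  then have "p\<^sup>2 dvd order G"
    using lagrange[of "?f ` (H \<times> K)"] card by (metis dvd_triv_right)
  then show False using not_sq by simp
qed

lemma pow_card_subgroup:
  assumes "subgroup H G" "finite H" "x \<in> H"
  shows "x [^] card H = \<one>"
proof -
  interpret H: group "G\<lparr>carrier := H\<rparr>"
    by (rule subgroup_imp_group[OF assms(1)])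
  have "x [^]\<^bsub>G\<lparr>carrier := H\<rparr>\<^esub> order (G\<lparr>carrier := H\<rparr>) = \<one>\<^bsub>G\<lparr>carrier := H\<rparr>\<^esub>"
    using assms by (intro H.pow_order_eq_1) simp_all
  then show ?thesis
    by (simp add: order_def nat_pow_consistent[symmetric])
qed

lemma prime_dvd_card_subgroup:
  assumes "prime p" "subgroup H G" "finite H" "x \<in> H" "x \<noteq> \<one>" "x [^] p = \<one>"
  shows "p dvd card H"
proof -
  have x: "x \<in> carrier G" using assms subgroup.subset by blast
  have "ord x dvd p" using pow_eq_id[OF x] assms(6) by simp
  moreover have "ord x \<noteq> 1"
    using pow_eq_id[OF x, of 1] x assms(5) by simp
  ultimately have "ord x = p"
    using assms(1) unfolding prime_nat_iff by blast
  moreover have "ord x dvd card H"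
    using pow_card_subgroup[OF assms(2-4)] pow_eq_id[OF x] by simp
  ultimately show ?thesis by simp
qed

text \<open>For \<open>y\<close> outside \<open>P\<close>, the group \<open>H\<close> is the
  disjoint union of \<open>P\<close> and the coset of \<open>y\<close>; a square of \<open>y\<close>
  in that coset would put \<open>y\<close> into \<open>P\<close>.\<close>

lemma subgroup_of_index_two_square:
  assumes P: "subgroup P G" and H: "subgroup H G" "finite H" "P \<subseteq> H" "card H = 2 * card P" and y: "y \<in> H"
  shows "y \<otimes> y \<in> P"
proof (cases "y \<in> P")
  case True
  then show ?thesis using P by (simp add: subgroup.m_closed)
next
  case False
  interpret P: subgroup P G by fact
  interpret H: subgroup H G by fact
  have inj: "inj_on (\<lambda>x. x \<otimes> y) P"
    using y by (auto simp: inj_on_def)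
  have disj: "P \<inter> (\<lambda>x. x \<otimes> y) ` P = {}"
  proof safe
    fix x assume x: "x \<in> P" "x \<otimes> y \<in> P"
    then have "inv x \<otimes> (x \<otimes> y) \<in> P" by blast
    then show "x \<otimes> y \<in> {}" using x y False by (simp add: m_assoc[symmetric])
  qed
  have "finite P" using H finite_subset by blast
  then have "card (P \<union> (\<lambda>x. x \<otimes> y) ` P) = card H"
    using disj inj H(4) by (simp add: card_Un_disjoint card_image)
  moreover have "P \<union> (\<lambda>x. x \<otimes> y) ` P \<subseteq> H"
    using H(3) y by auto
  ultimately have "P \<union> (\<lambda>x. x \<otimes> y) ` P = H"
    using H(2) by (intro card_subset_eq)
  then have "y \<otimes> y \<in> P \<union> (\<lambda>x. x \<otimes> y) ` P"
    using H.m_closed[OF y y] by simp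
  moreover have "y \<otimes> y \<notin> (\<lambda>x. x \<otimes> y) ` P"
    using False y by auto
  ultimately show ?thesis by blast
qed

end

section \<open>Actions by automorphisms and the fixed points of unipotent matrices\<close>

definition fixed :: "'k set \<Rightarrow> ('k \<Rightarrow> 'k) \<Rightarrow> 'k set" where
  "fixed S f = {x \<in> S. f x = x}"

text \<open>\<open>G\<close> will be the competitor \<open>\<Lambda>\<close> and \<open>act\<close>
  conjugation in \<open>K\<close>. The numerical assumptions can be checked in \<open>K\<close>, as
  fixed sets do not involve the product. The fixed set of \<open>umat 1\<close> is the centralizer
  of a unipotent matrix: \<open>p\<close> elements in the quotients by scalars, \<open>2 * p\<close>
  in \<open>SL2\<close> for odd \<open>p\<close> because of the sign. The last assumption separates
  the \<open>x\<close> that cannot have order \<open>p\<close> from those conjugate into this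
  set.\<close>

locale GL2_action = group G for G :: "'k monoid" (structure) +
  fixes act :: "'f::{field,finite} ^ 2 ^ 2 \<Rightarrow> 'k \<Rightarrow> 'k" and p :: nat
  assumes card_field: "CARD('f) = p" and prime_card: "prime p"
    and fin: "finite (carrier G)"
    and act_closed: "A \<in> GL \<Longrightarrow> x \<in> carrier G \<Longrightarrow> act A x \<in> carrier G"
    and act_hom: "A \<in> GL \<Longrightarrow> x \<in> carrier G \<Longrightarrow> y \<in> carrier G \<Longrightarrow> act A (x \<otimes> y) = act A x \<otimes> act A y"
    and act_one: "x \<in> carrier G \<Longrightarrow> act (mat 1) x = x"
    and act_mult: "A \<in> GL \<Longrightarrow> B \<in> GL \<Longrightarrow> x \<in> carrier G \<Longrightarrow> act (A ** B) x = act A (act B x)"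
    and not_sq: "\<not> p\<^sup>2 dvd order G"
    and card_fixed: "card (fixed (carrier G) (act (umat 1))) = p \<or>
      card (fixed (carrier G) (act (umat 1))) = 2 * p \<and> odd p"
    and card_fixed2:
      "card (fixed (carrier G) (act (umat 1)) \<inter> fixed (carrier G) (act (lmat 1))) < p"
    and conjugate: "x \<in> carrier G \<Longrightarrow>
      (\<exists>A\<in>GL. act A x = x \<and> \<not> p dvd card (fixed (carrier G) (act A))) \<or>
      (\<exists>A\<in>GL. \<exists>y\<in>fixed (carrier G) (act (umat 1)). x = act A y)"
begin

abbreviation "Fix A \<equiv> fixed (carrier G) (act A)"
abbreviation "C \<equiv> Fix (umat 1)"

lemma act_group_hom: "A \<in> GL \<Longrightarrow> group_hom G G (act A)"
  by unfold_locales (auto simp: hom_def act_closed act_hom)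

lemma fixed_subgroup:
  assumes "A \<in> GL"
  shows "subgroup (Fix A) G"
proof -
  interpret h: group_hom G G "act A" by (rule act_group_hom[OF assms])
  show ?thesis
    by (rule subgroupI) (auto simp: fixed_def intro: exI[of _ \<one>])
qed

lemma finite_fixed: "finite (Fix A)"
  using fin by (simp add: fixed_def)

lemma act_inverse:
  assumes "A \<in> GL" "x \<in> carrier G"
  shows "act (matrix_inv A) (act A x) = x" "act A (act (matrix_inv A) x) = x"
  using act_mult[OF matrix_inv_GL(3)[OF assms(1)] assms] act_mult[OF assms(1) matrix_inv_GL(3)[OF assms(1)] assms(2)]
    matrix_inv_GL[OF assms(1)] act_one[OF assms(2)] by simp_all

lemma act_inj: "A \<in> GL \<Longrightarrow> inj_on (act A) (carrier G)"
  by (rule inj_on_inverseI[of _ "act (matrix_inv A)"]) (simp add: act_inverse)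

text \<open>The field is prime, so \<open>umat s\<close> is a power of
  \<open>umat t\<close>.\<close>

lemma act_umat_fixed:
  assumes "t \<noteq> 0" and x: "x \<in> Fix (umat t)"
  shows "x \<in> Fix (umat s)"
proof -
  have xG: "x \<in> carrier G" and xt: "act (umat t) x = x" using x by (auto simp: fixed_def)
  obtain n where n: "s / t = of_nat n" by (rule prime_field_of_nat[OF prime_card[folded card_field]])
  have "act (umat (of_nat n * t)) x = x" for n
  proof (induction n)
    case 0
    then show ?case using act_one[OF xG] by (simp add: mat_eq_mat2)
  next
    case (Suc n)
    have "umat (of_nat (Suc n) * t) = umat t ** umat (of_nat n * t)"
      by (simp add: algebra_simps)
    then show ?case
      using act_mult[of "umat t" "umat (of_nat n * t)" x] xG Suc xt by simp
  qed
  from this[of n] show ?thesis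
    using assms(1) xG by (simp add: fixed_def flip: n)
qed

lemma act_upper_fixed:
  assumes A: "A \<in> GL" "mob A None = None" and x: "x \<in> C"
  shows "act A x \<in> C"
proof -
  obtain a b c d where A2: "A = mat2 a b c d" by (rule mat2_exhaust)
  then have c: "c = 0"
    using A(2) by (simp add: mob_def pt_def split: if_splits)
  then have a: "a \<noteq> 0" using A(1) A2 by auto
  have xG: "x \<in> carrier G" using x by (simp add: fixed_def)
  \<comment> \<open>\<open>A\<close> rescales the unipotent entry, which
    \<open>act_umat_fixed\<close> absorbs.\<close>
  have "umat 1 ** A = A ** umat (d / a)"
    using a by (simp add: A2 c)
  then have "act (umat 1) (act A x) = act A (act (umat (d / a)) x)"
    using act_mult[of "umat 1" A x] act_mult[of A "umat (d / a)" x] A xG by simp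
  also have "\<dots> = act A x"
    using act_umat_fixed[OF _ x, of "d / a"] by (simp add: fixed_def)
  finally show ?thesis
    using act_closed[OF A(1) xG] by (simp add: fixed_def)
qed

text \<open>The subgroup attached to the point at infinity. Described by an exponent, it is visibly
  preserved by every automorphism that preserves \<open>C\<close>.\<close>

definition VI :: "'k set" where "VI = {x \<in> C. x [^]\<^bsub>G\<^esub> p = \<one>\<^bsub>G\<^esub>}"

text \<open>When \<open>C\<close> has order \<open>2 * p\<close>, a Sylow subgroup \<open>P\<close>
  of order \<open>p\<close> has index two, so squares of elements of \<open>C\<close> lie in
  \<open>P\<close>. With \<open>p = 2 * k + 1\<close>, an \<open>x\<close> whose \<open>p\<close>-th
  power is trivial is the power \<open>k + 1\<close> of its square, hence in \<open>P\<close>; so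
  \<open>VI = P\<close>.\<close>

lemma VI: "subgroup VI G" "card VI = p"
proof -
  have C: "subgroup C G" by (rule fixed_subgroup) simp
  have p0: "p > 0" using prime_card prime_gt_0_nat by blast
  have "\<exists>P. subgroup P G \<and> P \<subseteq> C \<and> card P = p \<and> VI = P"
  proof (cases "card C = p")
    case True
    then have "VI = C"
      using pow_card_subgroup[OF C finite_fixed] by (auto simp: VI_def)
    then show ?thesis using C True by auto
  next
    case False
    then have card: "card C = 2 * p" and odd: "odd p" using card_fixed by auto
    let ?C = "G\<lparr>carrier := C\<rparr>"
    interpret C: group ?C by (rule subgroup_imp_group[OF C])
    have "\<exists>P. subgroup P ?C \<and> card P = p ^ 1"
      using card finite_fixed by (intro sylow_thm[OF prime_card C.group_axioms, of 1 2]) (simp_all add: order_def)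
    then obtain P where P: "subgroup P ?C" "card P = p" by auto
    then have PG: "subgroup P G" and PC: "P \<subseteq> C"
      using incl_subgroup[OF C] subgroup.subset[OF P(1)] by auto
    have fP: "finite P" using PC finite_fixed finite_subset by blast
    have "x \<in> P" if x: "x \<in> C" "x [^] p = \<one>" for x
    proof -
      have xG: "x \<in> carrier G" using x by (simp add: fixed_def)
      have xx: "x \<otimes> x \<in> P"
        using subgroup_of_index_two_square[OF PG C finite_fixed PC] card P(2) x(1) by simp
      obtain k where k: "p = 2 * k + 1" using odd by (elim oddE)
      have "(x \<otimes> x) [^] (k + 1) = x [^] (2 * k + 1) \<otimes> x"
      proof -
        have "x \<otimes> x = x [^] (2::nat)" using xG by (simp add: numeral_2_eq_2)
        then have "(x \<otimes> x) [^] (k + 1) = x [^] (2 * k + 1 + 1)"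
          using xG nat_pow_pow[OF xG, of 2 "k + 1"] by (simp add: algebra_simps)
        then show ?thesis using xG by simp
      qed
      also have "\<dots> = x" using x xG by (simp add: k)
      finally have "x = (x \<otimes> x) [^] (k + 1)" ..
      moreover interpret P: group "G\<lparr>carrier := P\<rparr>"
        by (rule subgroup_imp_group[OF PG])
      have "(x \<otimes> x) [^] (k + 1) \<in> P"
        using P.nat_pow_closed[of "x \<otimes> x" "k + 1"] xx by (simp add: nat_pow_consistent[symmetric])
      ultimately show ?thesis by simp
    qed
    moreover have "x [^] p = \<one>" if "x \<in> P" for x
      using pow_card_subgroup[OF PG fP that] P(2) by simp
    ultimately have "VI = P" using PC by (auto simp: VI_def)
    then show ?thesis using PG PC P(2) by auto
  qed
  then show "subgroup VI G" "card VI = p" by auto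
qed

lemma VI_carrier: "VI \<subseteq> carrier G"
  using VI(1) by (rule subgroup.subset)

lemma act_pow: "A \<in> GL \<Longrightarrow> x \<in> carrier G \<Longrightarrow> act A (x [^] (n::nat)) = act A x [^] n"
  using group_hom.hom_nat_pow[OF act_group_hom, of A x n] by simp

lemma act_upper_VI:
  assumes A: "A \<in> GL" "mob A None = None"
  shows "act A ` VI = VI"
proof (rule endo_inj_surj)
  show "finite VI" using VI_carrier fin finite_subset by blast
  show "inj_on (act A) VI" using act_inj[OF A(1)] VI_carrier inj_on_subset by blast
  interpret h: group_hom G G "act A" by (rule act_group_hom[OF A(1)])
  show "act A ` VI \<subseteq> VI"
    using act_upper_fixed[OF A] act_pow[OF A(1), symmetric] by (auto simp: VI_def fixed_def)
qed

text \<open>The conjugates of \<open>VI\<close> under \<open>act\<close>, indexed by the points of the projective line.\<close>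

definition V :: "'f option \<Rightarrow> 'k set" where
  "V z = act (SOME g. g \<in> SL \<and> mob g None = z) ` VI"

lemma act_compose_image:
  assumes "A \<in> GL" "B \<in> GL" "X \<subseteq> carrier G"
  shows "act A ` act B ` X = act (A ** B) ` X"
  using assms by (auto simp: act_mult image_image subset_iff)

text \<open>Matrices with the same image of infinity differ by an upper triangular factor, which
  preserves \<open>VI\<close>; the choice in the definition of \<open>V\<close> is thus
  immaterial.\<close>

lemma V_act_VI:
  assumes A: "A \<in> GL"
  shows "act A ` VI = V (mob A None)"
proof -
  let ?Q = "\<lambda>g. g \<in> SL \<and> mob g None = mob A None"
  define g where "g = (SOME g. ?Q g)"
  have "\<exists>g. ?Q g" using mob_transitive[of "mob A None"] by blast
  then have g: "g \<in> SL" "mob g None = mob A None"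
    unfolding g_def using someI_ex[of ?Q] by auto
  then have gG: "g \<in> GL" by simp
  note ig = matrix_inv_GL(3)[OF gG]
  have B: "matrix_inv g ** A \<in> GL" "mob (matrix_inv g ** A) None = None"
    using GL_mult[OF ig A] mob_mult[OF A, of "matrix_inv g"] g(2) mob_inv(2)[OF gG]
    by (auto simp: fun_eq_iff dest: spec[of _ None])
  have "act g ` act (matrix_inv g ** A) ` VI = act (g ** (matrix_inv g ** A)) ` VI"
    by (rule act_compose_image[OF gG B(1) VI_carrier])
  also have "g ** (matrix_inv g ** A) = A"
    by (simp add: matrix_mul_assoc matrix_inv_GL[OF gG])
  finally have "act A ` VI = act g ` VI"
    by (simp only: act_upper_VI[OF B])
  then show ?thesis
    by (simp only: V_def g_def)
qed

lemma V_None: "V None = VI"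
  using V_act_VI[of "mat 1"] VI_carrier by (simp add: mat_eq_mat2 mob_def pt_def act_one[unfolded mat_eq_mat2] subset_iff)

lemma V_conj:
  obtains g where "g \<in> SL" "mob g None = z" "V z = act g ` VI"
proof -
  obtain g where g: "g \<in> SL" "mob g None = z" by (rule mob_transitive)
  moreover have "g \<in> GL" using g by simp
  from V_act_VI[OF this] have "V z = act g ` VI" by (simp add: g)
  ultimately show ?thesis by (rule that)
qed

lemma V_act:
  assumes A: "A \<in> GL"
  shows "act A ` V z = V (mob A z)"
proof -
  obtain g where g: "g \<in> SL" "mob g None = z" "V z = act g ` VI" by (rule V_conj)
  then have gG: "g \<in> GL" by simp
  show ?thesis
    using act_compose_image[OF A gG VI_carrier] V_act_VI[OF GL_mult[OF A gG]] mob_mult[OF gG, of A] g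
    by simp
qed

lemma V_subgroup: "subgroup (V z) G"
proof -
  obtain g where g: "g \<in> SL" "mob g None = z" "V z = act g ` VI" by (rule V_conj)
  then have "g \<in> GL" by simp
  from group_hom.subgroup_img_is_subgroup[OF act_group_hom[OF this] VI(1)] show ?thesis
    by (simp add: g)
qed

lemma V_carrier: "V z \<subseteq> carrier G"
  using V_subgroup subgroup.subset by blast

lemma card_V: "card (V z) = p"
proof -
  obtain g where g: "g \<in> SL" "mob g None = z" "V z = act g ` VI" by (rule V_conj)
  then have "g \<in> GL" by simp
  then show ?thesis
    using card_image[OF inj_on_subset[OF act_inj VI_carrier]] VI(2) g by simp
qed

lemma finite_V: "finite (V z)"
  using V_carrier fin finite_subset by blast

text \<open>By transitivity on pairs the points may be taken to be infinity and 0. If their groups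
  agreed, \<open>VI\<close> would be fixed by \<open>umat 1\<close> and \<open>lmat 1\<close>, which
  have fewer than \<open>p\<close> common fixed points.\<close>

lemma V_inj:
  assumes "V z = V w"
  shows "z = w"
proof (rule ccontr)
  assume "z \<noteq> w"
  then obtain g where g: "g \<in> SL" "mob g None = z" "mob g (Some 0) = w" by (rule mob_transitive2)
  then have gG: "g \<in> GL" by simp
  have "act g ` V None = act g ` V (Some 0)"
    using V_act[OF gG] g assms by simp
  then have eq: "V None = V (Some 0)"
    using inj_on_image_eq_iff[OF act_inj[OF gG] V_carrier V_carrier] by simp
  \<comment> \<open>Interchanges infinity and 0, and conjugates \<open>umat (- 1)\<close> into
    \<open>lmat 1\<close>.\<close>
  define w where "w = mat2 0 1 (-1) (0::'f)"
  have wG: "w \<in> GL" by (simp add: w_def)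
  have "V (Some 0) = act w ` VI"
    using V_act_VI[OF wG] by (simp add: w_def mob_def pt_def)
  moreover have "act w x \<in> Fix (lmat 1)" if x: "x \<in> C" for x
  proof -
    have xG: "x \<in> carrier G" using x by (simp add: fixed_def)
    have "x \<in> Fix (umat (-1))" by (rule act_umat_fixed[OF _ x]) simp
    then have xm: "act (umat (-1)) x = x" by (simp add: fixed_def)
    have "lmat 1 ** w = w ** umat (-1)" by (simp add: w_def)
    then have "act (lmat 1) (act w x) = act w x"
      using act_mult[of "lmat 1" w x] act_mult[of w "umat (-1)" x] wG xG xm by simp
    then show ?thesis
      using act_closed[OF wG xG] by (simp add: fixed_def)
  qed
  ultimately have "VI \<subseteq> Fix (lmat 1)" if "VI = act w ` VI"
    by (subst that) (auto simp: VI_def)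
  then have "VI \<subseteq> C \<inter> Fix (lmat 1)"
    using eq \<open>V (Some 0) = act w ` VI\<close> by (auto simp: V_None VI_def)
  then have "card VI \<le> card (C \<inter> Fix (lmat 1))"
    using finite_fixed by (intro card_mono) auto
  then show False
    using card_fixed2 VI(2) by simp
qed

text \<open>In the first alternative of \<open>conjugate\<close>, \<open>x\<close> would be an
  element of order \<open>p\<close> in a subgroup \<open>Fix A\<close> whose order is prime to
  \<open>p\<close>.\<close>

lemma order_p_in_V:
  assumes x: "x \<in> carrier G" "x [^] p = \<one>" "x \<noteq> \<one>"
  obtains z where "x \<in> V z"
proof -
  have "\<exists>A\<in>GL. \<exists>y\<in>C. x = act A y"
    using conjugate[OF x(1)] prime_dvd_card_subgroup[OF prime_card fixed_subgroup finite_fixed _ x(3,2)] x(1)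
    by (auto simp: fixed_def)
  then obtain A y where A: "A \<in> GL" and y: "y \<in> C" "x = act A y" by blast
  interpret h: group_hom G G "act A" by (rule act_group_hom[OF A])
  have yG: "y \<in> carrier G" using y by (simp add: fixed_def)
  have "act A (y [^] p) = act A \<one>"
    using x(2) y(2) act_pow[OF A yG] by simp
  then have "y [^] p = \<one>"
    using inj_onD[OF act_inj[OF A]] yG by simp
  then have "x \<in> act A ` VI"
    using y by (auto simp: VI_def)
  then show ?thesis
    using that V_act_VI[OF A] by blast
qed

lemma prime_subgroup_in_V:
  assumes H: "subgroup H G" "card H = p"
  obtains z where "H = V z"
proof -
  have fH: "finite H" using H fin subgroup.subset finite_subset by metis
  have "H \<noteq> {\<one>}"
    using H(2) prime_card by (auto simp: prime_nat_iff)
  then obtain h where h: "h \<in> H" "h \<noteq> \<one>"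
    using subgroup.one_closed[OF H(1)] by blast
  then obtain z where "h \<in> V z"
    using order_p_in_V[of h] pow_card_subgroup[OF H(1) fH h(1)] H subgroup.subset by (metis subsetD)
  then show ?thesis
    using that prime_subgroups_eq[OF prime_card H(1) V_subgroup H(2) card_V h(1) _ h(2)] by blast
qed

end


section \<open>The permutation representation on the projective line\<close>

definition mob_group :: "('f::field option \<Rightarrow> 'f option) set \<Rightarrow> ('f option \<Rightarrow> 'f option) monoid" where
  "mob_group R = \<lparr>carrier = R, mult = (\<circ>), one = id\<rparr>"

lemma mob_GL_factor:
  assumes B: "B \<in> GL" and eq: "mob B \<circ> f = mob A" and A: "A \<in> GL"
  shows "f = mob (matrix_inv B ** A)"
proof -
  have "f = mob (matrix_inv B) \<circ> mob B \<circ> f"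
    by (simp only: mob_inv(2)[OF B] id_comp)
  also have "\<dots> = mob (matrix_inv B) \<circ> mob A"
    by (simp only: comp_assoc eq)
  finally show ?thesis
    by (simp only: mob_mult[OF A])
qed

text \<open>Shows that unipotent matrices generate \<open>SL\<close>; the case \<open>c = 0\<close>
  is reduced to this one by a lower unipotent factor.\<close>

lemma SL_factor:
  assumes "a * d - b * c = (1::'f::field)" "c \<noteq> 0"
  shows "mat2 a b c d = umat ((a - 1) / c) ** lmat c ** umat ((d - 1) / c)"
proof -
  have "c * (1 + b * c) = c * (a * d)"
    using assms(1) by (simp add: algebra_simps)
  then show ?thesis
    using assms(2) by (simp add: field_simps)
qed

context GL2_action
begin

definition cj :: "'k \<Rightarrow> 'k \<Rightarrow> 'k" where "cj x y = x \<otimes> y \<otimes> inv x"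

lemma cj_closed [simp]: "x \<in> carrier G \<Longrightarrow> y \<in> carrier G \<Longrightarrow> cj x y \<in> carrier G"
  by (simp add: cj_def)

lemma cj_cj:
  "x \<in> carrier G \<Longrightarrow> y \<in> carrier G \<Longrightarrow> v \<in> carrier G \<Longrightarrow> cj (x \<otimes> y) v = cj x (cj y v)"
  by (simp add: cj_def inv_mult_group m_assoc)

lemma cj_group_hom:
  assumes x: "x \<in> carrier G"
  shows "group_hom G G (cj x)"
proof -
  have "cj x (a \<otimes> b) = cj x a \<otimes> cj x b" if "a \<in> carrier G" "b \<in> carrier G" for a b
  proof -
    have "cj x a \<otimes> cj x b = x \<otimes> a \<otimes> (inv x \<otimes> x) \<otimes> b \<otimes> inv x"
      unfolding cj_def using that x by (simp only: m_assoc m_closed inv_closed)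
    then show ?thesis using that x by (simp add: cj_def m_assoc)
  qed
  then show ?thesis
    using x by unfold_locales (auto simp: hom_def)
qed

lemma cj_inj: "x \<in> carrier G \<Longrightarrow> inj_on (cj x) (carrier G)"
  by (auto simp: inj_on_def cj_def)

lemma ex_rho:
  assumes x: "x \<in> carrier G"
  obtains w where "cj x ` V z = V w"
proof -
  have "subgroup (cj x ` V z) G"
    by (rule group_hom.subgroup_img_is_subgroup[OF cj_group_hom[OF x] V_subgroup])
  moreover have "card (cj x ` V z) = p"
    using card_image[OF inj_on_subset[OF cj_inj[OF x] V_carrier]] card_V by simp
  ultimately show ?thesis
    using prime_subgroup_in_V that by metis
qed

text \<open>Inner automorphisms of \<open>G\<close> permute the subgroups of order \<open>p\<close>,
  all of which are of the form \<open>V w\<close> with a unique \<open>w\<close>. Here the unknown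
  product enters.\<close>

definition rho :: "'k \<Rightarrow> 'f option \<Rightarrow> 'f option" where
  "rho x z = (THE w. cj x ` V z = V w)"

lemma rho_eqI: "cj x ` V z = V w \<Longrightarrow> rho x z = w"
  unfolding rho_def by (rule the_equality) (auto intro: V_inj)

lemma rho_eq: "x \<in> carrier G \<Longrightarrow> cj x ` V z = V (rho x z)"
  by (rule ex_rho[of x z]) (auto dest: rho_eqI)

lemma rho_mult:
  assumes "x \<in> carrier G" "y \<in> carrier G"
  shows "rho (x \<otimes> y) = rho x \<circ> rho y"
proof
  fix z
  have "cj (x \<otimes> y) ` V z = cj x ` cj y ` V z"
    unfolding image_image using assms V_carrier[of z] by (intro image_cong) (auto simp: cj_cj)
  also have "\<dots> = V (rho x (rho y z))"
    using assms by (simp add: rho_eq)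
  finally show "rho (x \<otimes> y) z = (rho x \<circ> rho y) z"
    by (simp add: rho_eqI)
qed

lemma rho_V_self:
  assumes "v \<in> V z"
  shows "rho v z = z"
proof (rule rho_eqI, rule card_subset_eq)
  have v: "v \<in> carrier G" using assms V_carrier by blast
  show "cj v ` V z \<subseteq> V z"
    using assms by (auto simp: cj_def intro: subgroup.m_closed[OF V_subgroup] subgroup.m_inv_closed[OF V_subgroup])
  show "card (cj v ` V z) = card (V z)"
    by (rule card_image[OF inj_on_subset[OF cj_inj[OF v] V_carrier]])
qed (rule finite_V)

lemma rho_one [simp]: "rho \<one> = id"
  using rho_V_self subgroup.one_closed[OF V_subgroup] by fastforce

lemma rho_inv:
  assumes x: "x \<in> carrier G"
  shows "rho x \<circ> rho (inv x) = id" "rho (inv x) \<circ> rho x = id"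
  by (simp_all add: x flip: rho_mult)

lemma rho_bij: "x \<in> carrier G \<Longrightarrow> bij (rho x)"
  by (rule o_bij[OF rho_inv(2,1)])

text \<open>\<open>act A\<close> is an automorphism for the product of \<open>G\<close>, so it
  carries inner automorphisms to inner ones while moving the index by \<open>mob A\<close>. This
  ties the unknown product to the matrices.\<close>

lemma rho_act_mob:
  assumes A: "A \<in> GL" and x: "x \<in> carrier G"
  shows "rho (act A x) \<circ> mob A = mob A \<circ> rho x"
proof
  fix z
  interpret h: group_hom G G "act A" by (rule act_group_hom[OF A])
  have "cj (act A x) ` V (mob A z) = act A ` cj x ` V z"
    unfolding V_act[OF A, symmetric] image_image
    using x V_carrier[of z] by (intro image_cong) (auto simp: cj_def subset_iff)
  also have "\<dots> = V (mob A (rho x z))"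
    by (simp add: rho_eq[OF x] V_act[OF A])
  finally show "(rho (act A x) \<circ> mob A) z = (mob A \<circ> rho x) z"
    by (simp add: rho_eqI)
qed

lemma rho_act:
  assumes A: "A \<in> GL" and x: "x \<in> carrier G"
  shows "rho (act A x) = mob A \<circ> rho x \<circ> mob (matrix_inv A)"
proof -
  have "rho (act A x) = rho (act A x) \<circ> mob A \<circ> mob (matrix_inv A)"
    by (simp only: comp_assoc mob_inv[OF A] comp_id)
  then show ?thesis
    by (simp only: rho_act_mob[OF A x])
qed

section \<open>Kernel and image of the representation\<close>

definition ker :: "'k set" where "ker = {x \<in> carrier G. rho x = id}"

lemma ker_subgroup: "subgroup ker G"
proof (rule subgroupI)
  show "ker \<noteq> {}"
    using one_closed rho_one unfolding ker_def by blast
  fix a assume "a \<in> ker"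
  then show "inv a \<in> ker"
    using rho_inv(1)[of a] by (simp add: ker_def)
qed (simp_all add: ker_def rho_mult subset_iff)

lemma ker_act: "A \<in> GL \<Longrightarrow> x \<in> ker \<Longrightarrow> act A x \<in> ker"
  by (simp add: ker_def act_closed rho_act mob_inv)

text \<open>A nontrivial element would put the whole of \<open>V z\<close>, of prime order, into the
  kernel. Then \<open>V z\<close> would normalize every \<open>V w\<close>, which
  \<open>normalizing_prime_subgroups_eq\<close> rules out.\<close>

lemma ker_V:
  assumes "v \<in> V z" "v \<in> ker"
  shows "v = \<one>"
proof (rule ccontr)
  assume v: "v \<noteq> \<one>"
  let ?H = "ker \<inter> V z"
  have s: "subgroup ?H G"
    by (rule subgroups_Inter_pair[OF ker_subgroup V_subgroup])
  have "card ?H dvd p"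
    using subgroup_card_dvd[OF s V_subgroup[of z]] card_V by simp
  moreover have "card {\<one>, v} \<le> card ?H"
    using assms subgroup.one_closed[OF s] finite_V by (intro card_mono) auto
  then have "card ?H \<noteq> 1" using v by auto
  ultimately have "card ?H = p"
    using prime_card unfolding prime_nat_iff by blast
  then have "?H = V z"
    using card_V finite_V by (intro card_subset_eq) auto
  then have sub: "V z \<subseteq> ker" by blast
  have "\<exists>w. w \<noteq> z" by (cases z) auto
  then obtain w where w: "w \<noteq> z" by blast
  have "h \<otimes> k \<otimes> inv h \<in> V w" if "h \<in> V z" "k \<in> V w" for h k
  proof -
    have h: "h \<in> carrier G" "rho h w = w"
      using that(1) sub by (auto simp: ker_def)
    have "cj h k \<in> V w"
      using rho_eq[OF h(1), of w] h(2) that(2) by (metis imageI)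
    then show ?thesis by (simp add: cj_def)
  qed
  then have "V z = V w"
    using normalizing_prime_subgroups_eq[OF prime_card V_subgroup V_subgroup card_V card_V fin not_sq]
    by blast
  then show False using V_inj w by blast
qed

lemma rho_inj_V:
  assumes v: "v \<in> V z" and v': "v' \<in> V z" and eq: "rho v = rho v'"
  shows "v = v'"
proof -
  have c: "v \<in> carrier G" "v' \<in> carrier G" using v v' V_carrier by blast+
  have "v \<otimes> inv v' = \<one>"
  proof (rule ker_V)
    show "v \<otimes> inv v' \<in> V z"
      using v v' by (simp add: subgroup.m_closed[OF V_subgroup] subgroup.m_inv_closed[OF V_subgroup])
    show "v \<otimes> inv v' \<in> ker"
      using c eq by (simp add: ker_def rho_mult rho_inv)
  qed
  then show ?thesis
    using c by (metis inv_closed inv_equality inv_inv)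
qed

text \<open>Elements of \<open>VI\<close> are fixed by all \<open>umat s\<close>, so
  \<open>rho v\<close> commutes with all translations of the affine line and is itself a
  translation.\<close>

lemma rho_VI:
  assumes v: "v \<in> VI"
  obtains t where "rho v = mob (umat t)"
proof -
  have vG: "v \<in> carrier G" using v VI_carrier by blast
  have None: "rho v None = None"
    using rho_V_self[of v None] v by (simp add: V_None)
  have comm: "rho v (mob (umat s) z) = mob (umat s) (rho v z)" for s z
  proof -
    have "v \<in> Fix (umat s)"
      using v act_umat_fixed[of 1 v s] by (simp add: VI_def)
    then have "act (umat s) v = v" by (simp add: fixed_def)
    then show ?thesis
      using fun_cong[OF rho_act_mob[of "umat s" v], of z] vG by simp
  qed
  have "rho v (Some 0) \<noteq> None"
    using None bij_is_inj[OF rho_bij[OF vG]] by (metis injD option.distinct(1))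
  then obtain t where t: "rho v (Some 0) = Some t" by blast
  have "rho v z = mob (umat t) z" for z
  proof (cases z)
    case (Some s)
    then show ?thesis
      using comm[of s "Some 0"] t by (simp add: add.commute)
  qed (simp add: None)
  then have "rho v = mob (umat t)" by (rule ext)
  then show ?thesis by (rule that)
qed

text \<open>\<open>rho\<close> embeds the \<open>p\<close> elements of \<open>VI\<close> into the
  \<open>p\<close> translations.\<close>

lemma ex_X: "\<exists>v\<in>VI. rho v = mob (umat t)"
proof -
  have "\<forall>v\<in>VI. \<exists>t. rho v = mob (umat t)"
    using rho_VI by metis
  from bchoice[OF this] obtain \<tau> where \<tau>: "\<forall>v\<in>VI. rho v = mob (umat (\<tau> v))"
    by blast
  have "inj_on \<tau> VI"
  proof
    fix v v' assume "v \<in> VI" "v' \<in> VI" "\<tau> v = \<tau> v'"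
    then show "v = v'"
      using \<tau> by (intro rho_inj_V[of v None v']) (simp_all add: V_None)
  qed
  then have "card (\<tau> ` VI) = card (UNIV :: 'f set)"
    using VI(2) card_field by (simp add: card_image)
  then have "\<tau> ` VI = UNIV"
    by (intro card_subset_eq) auto
  then obtain v where "v \<in> VI" "t = \<tau> v" by blast
  then show ?thesis using \<tau> by auto
qed

definition X :: "'f \<Rightarrow> 'k" where "X t = (SOME v. v \<in> VI \<and> rho v = mob (umat t))"

lemma X: "X t \<in> VI" "rho (X t) = mob (umat t)"
  using someI_ex[of "\<lambda>v. v \<in> VI \<and> rho v = mob (umat t)"] ex_X[of t] by (auto simp: X_def)

lemma X_closed [simp]: "X t \<in> carrier G"
  using X(1) VI_carrier by blast

lemma X_eqI: "v \<in> VI \<Longrightarrow> rho v = mob (umat t) \<Longrightarrow> v = X t"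
  using rho_inj_V[of v None "X t"] X by (simp add: V_None)

lemma rho_image_comp: "f \<in> rho ` carrier G \<Longrightarrow> g \<in> rho ` carrier G \<Longrightarrow> f \<circ> g \<in> rho ` carrier G"
  by (auto simp: rho_mult[symmetric])

lemma rho_image_conj:
  assumes "A \<in> GL" "B \<in> GL" "mob B \<in> rho ` carrier G"
  shows "mob (A ** B ** matrix_inv A) \<in> rho ` carrier G"
proof -
  obtain x where x: "x \<in> carrier G" "mob B = rho x" using assms(3) by blast
  have "mob (A ** B ** matrix_inv A) = rho (act A x)"
    using assms matrix_inv_GL(3)[OF assms(1)] by (simp add: mob_mult rho_act x)
  then show ?thesis
    using act_closed[OF assms(1) x(1)] by blast
qed

text \<open>\<open>ex_X\<close> yields the upper unipotents; by equivariance the image of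
  \<open>rho\<close> is stable under conjugation by \<open>GL\<close>, which adds the lower ones,
  and together they generate.\<close>

lemma mob_SL_subset: "mob ` SL \<subseteq> rho ` carrier G"
proof clarify
  fix A :: "'f ^ 2 ^ 2" assume A: "det A = 1"
  let ?R = "rho ` carrier G"
  have u: "mob (umat t) \<in> ?R" for t
    using X(2)[of t, symmetric] X_closed by (metis image_eqI)
  have l: "mob (lmat t) \<in> ?R" for t
  proof -
    have "matrix_inv (mat2 0 1 (-1) 0) = mat2 0 (-1) 1 (0::'f)"
      by (rule matrix_inv_eqI) (simp add: mat_eq_mat2)
    then have "mat2 0 1 (-1) 0 ** umat (- t) ** matrix_inv (mat2 0 1 (-1) 0) = lmat t"
      by simp
    then show ?thesis
      using rho_image_conj[OF _ _ u[of "- t"], of "mat2 0 1 (-1) 0"] by simp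
  qed
  have ne: "mob (mat2 a b c d) \<in> ?R" if "a * d - b * c = 1" "c \<noteq> 0" for a b c d
    unfolding SL_factor[OF that] by (simp add: mob_mult det_mul rho_image_comp u l del: mat2_mult)
  obtain a b c d where A2: "A = mat2 a b c d" by (rule mat2_exhaust)
  show "mob A \<in> ?R"
  proof (cases "c = 0")
    case False
    then show ?thesis using A ne by (simp add: A2)
  next
    case True
    then have "a \<noteq> 0" "a * d = 1" using A by (auto simp: A2)
    \<comment> \<open>Moves into the case with nonzero lower left entry, here
      \<open>a\<close>.\<close>
    have "A = lmat (- 1) ** mat2 a b a (b + d)"
      by (simp add: A2 True)
    moreover have "mob (mat2 a b a (b + d)) \<in> ?R"
      by (rule ne) (use \<open>a \<noteq> 0\<close> \<open>a * d = 1\<close> in \<open>simp_all add: algebra_simps\<close>)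
    moreover have "mat2 a b a (b + d) \<in> GL"
      using \<open>a * d = 1\<close> by (simp add: algebra_simps)
    ultimately show ?thesis
      using mob_mult[of "mat2 a b a (b + d)" "lmat (- 1)"] rho_image_comp[OF l] by metis
  qed
qed

text \<open>Conjugation by such an \<open>x\<close> preserves \<open>VI\<close>, so
  \<open>rho x\<close> conjugates translations into translations; over a prime field this makes it
  affine.\<close>

lemma rho_affine:
  assumes x: "x \<in> carrier G" and None: "rho x None = None"
  obtains B where "B \<in> GL" "rho x = mob B"
proof -
  have "\<exists>t'. rho x \<circ> mob (umat t) = mob (umat t') \<circ> rho x" for t
  proof -
    have "cj x (X t) \<in> VI"
      using rho_eq[OF x, of None] X(1) None by (auto simp: V_None)
    then obtain t' where "rho (cj x (X t)) = mob (umat t')" by (rule rho_VI)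
    moreover have "rho (cj x (X t)) \<circ> rho x = rho x \<circ> mob (umat t)"
      using x by (simp add: cj_def rho_mult X comp_assoc rho_inv)
    ultimately show ?thesis by metis
  qed
  then obtain \<kappa> where \<kappa>: "rho x (mob (umat t) z) = mob (umat (\<kappa> t)) (rho x z)" for t z
    by (metis comp_apply)
  have "rho x (Some s) \<noteq> None" for s
    using None bij_is_inj[OF rho_bij[OF x]] by (metis injD option.distinct(1))
  moreover define f where "f s = the (rho x (Some s))" for s
  ultimately have f: "rho x (Some s) = Some (f s)" for s
    by simp
  have add: "f (s + t) = f s + \<kappa> t" for s t
    using \<kappa>[of t "Some s"] by (simp add: f)
  have fn: "f (of_nat n) = of_nat n * \<kappa> 1 + f 0" for n
  proof (induction n)
    case (Suc n)
    have "of_nat (Suc n) = (of_nat n + 1 :: 'f)" by simp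
    then show ?case
      using Suc by (simp only: add) (simp add: algebra_simps)
  qed simp
  have fs: "f s = \<kappa> 1 * s + f 0" for s
  proof -
    obtain n where "s = of_nat n"
      by (rule prime_field_of_nat[OF prime_card[folded card_field]])
    then show ?thesis
      using fn[of n] by (simp add: mult.commute)
  qed
  have "f 1 \<noteq> f 0"
    using f[of 1] f[of 0] injD[OF bij_is_inj[OF rho_bij[OF x]], of "Some 1" "Some 0"] by auto
  then have "\<kappa> 1 \<noteq> 0" using fs[of 1] by auto
  moreover have "rho x = mob (mat2 (\<kappa> 1) (f 0) 0 1)"
  proof
    fix z show "rho x z = mob (mat2 (\<kappa> 1) (f 0) 0 1) z"
    proof (cases z)
      case (Some s)
      then show ?thesis by (simp add: f fs[of s] mob_def pt_def)
    qed (simp add: None mob_def pt_def)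
  qed
  ultimately show ?thesis
    by (intro that[of "mat2 (\<kappa> 1) (f 0) 0 1"]) simp_all
qed

text \<open>An element of \<open>SL\<close> brings \<open>rho x None\<close> back to infinity, and
  its fractional linear map already lies in the image, so \<open>rho_affine\<close> applies to a
  product in \<open>G\<close>.\<close>

lemma rho_image_subset: "rho ` carrier G \<subseteq> mob ` GL"
proof clarify
  fix x assume x: "x \<in> carrier G"
  obtain h where h: "h \<in> SL" "mob h None = rho x None" by (rule mob_transitive)
  then have hG: "h \<in> GL" by simp
  note ih = matrix_inv_GL[OF hG]
  have "det (matrix_inv h) = 1"
    using h(1) ih(4) by simp
  then have "mob (matrix_inv h) \<in> mob ` SL" by blast
  then obtain y where y: "y \<in> carrier G" "mob (matrix_inv h) = rho y"
    using mob_SL_subset by blast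
  have "rho (y \<otimes> x) None = None"
    using fun_cong[OF mob_inv(2)[OF hG], of None] by (simp add: rho_mult x y(1) h(2)[symmetric] flip: y(2))
  then obtain B where B: "B \<in> GL" "rho (y \<otimes> x) = mob B"
    using rho_affine x y(1) by blast
  then have "rho x = mob (matrix_inv (matrix_inv h) ** B)"
    using mob_GL_factor[OF ih(3) _ B(1)] by (simp add: rho_mult x y)
  moreover have "matrix_inv (matrix_inv h) ** B \<in> GL"
    using GL_mult[OF matrix_inv_GL(3)[OF ih(3)] B(1)] .
  ultimately show "rho x \<in> mob ` GL" by blast
qed

lemma rho_fibre:
  assumes y: "y \<in> carrier G"
  shows "{x \<in> carrier G. rho x = rho y} = (\<lambda>n. y \<otimes> n) ` ker"
proof (intro equalityI subsetI)
  fix x assume "x \<in> {x \<in> carrier G. rho x = rho y}"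
  then have x: "x \<in> carrier G" "rho x = rho y" by auto
  then have "inv y \<otimes> x \<in> ker"
    using y by (simp add: ker_def rho_mult rho_inv)
  moreover have "x = y \<otimes> (inv y \<otimes> x)"
    using x y by (simp add: m_assoc[symmetric])
  ultimately show "x \<in> (\<lambda>n. y \<otimes> n) ` ker" by blast
next
  fix x assume "x \<in> (\<lambda>n. y \<otimes> n) ` ker"
  then show "x \<in> {x \<in> carrier G. rho x = rho y}"
    using y by (auto simp: ker_def rho_mult)
qed

lemma card_rho_fibre:
  assumes y: "y \<in> carrier G"
  shows "card {x \<in> carrier G. rho x = rho y} = card ker"
proof -
  have "inj_on (\<lambda>n. y \<otimes> n) ker"
    using y by (auto simp: inj_on_def ker_def)
  then show ?thesis
    by (simp add: rho_fibre[OF y] card_image)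
qed

lemma order_eq: "order G = card ker * card (rho ` carrier G)"
  unfolding order_def using card_rho_fibre by (intro card_fibres[OF fin]) auto

lemma finite_ker: "finite ker"
  using fin by (simp add: ker_def)

lemma card_ker_pos: "card ker > 0"
  using subgroup.one_closed[OF ker_subgroup] finite_ker by (auto simp: card_gt_0_iff)

lemma rho_iso:
  assumes "ker = {\<one>}" "rho ` carrier G = R"
  shows "rho \<in> iso G (mob_group R)"
proof -
  have "inj_on rho (carrier G)"
  proof
    fix x y assume "x \<in> carrier G" "y \<in> carrier G" "rho x = rho y"
    then have "x \<in> (\<lambda>n. y \<otimes> n) ` ker"
      using rho_fibre[of y] by blast
    then show "x = y" using assms(1) \<open>y \<in> carrier G\<close> by simp
  qed
  then show ?thesis
    using assms(2) by (auto simp: iso_def hom_def bij_betw_def mob_group_def rho_mult)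
qed

lemma ker_trivialI: "card ker = 1 \<Longrightarrow> ker = {\<one>}"
  using subgroup.one_closed[OF ker_subgroup] by (auto simp: card_1_singleton_iff)

lemma iso_mob_SL:
  assumes "order G = card (mob ` (SL :: ('f ^ 2 ^ 2) set))"
  shows "rho \<in> iso G (mob_group (mob ` SL))"
proof -
  have fr: "finite (rho ` carrier G)" using fin by simp
  have le: "card (mob ` (SL :: ('f ^ 2 ^ 2) set)) \<le> card (rho ` carrier G)"
    by (rule card_mono[OF fr mob_SL_subset])
  have pos: "card (rho ` carrier G) > 0"
    using fr one_closed by (auto simp: card_gt_0_iff)
  have "card ker * card (rho ` carrier G) \<le> 1 * card (rho ` carrier G)"
    using order_eq assms le by simp
  then have "card ker = 1"
    using pos card_ker_pos by simp
  moreover from this have "mob ` SL = rho ` carrier G"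
    using order_eq assms by (intro card_subset_eq[OF fr mob_SL_subset]) simp
  ultimately show ?thesis
    by (intro rho_iso ker_trivialI) auto
qed

text \<open>The index of the image of \<open>SL\<close> in that of \<open>GL\<close> is the number
  of square roots of 1, so the kernel has at most two elements. A second one would be fixed by every
  \<open>act A\<close>, since these preserve the kernel and the neutral element.\<close>

lemma iso_mob_GL:
  assumes ord: "order G = card (mob ` (GL :: ('f ^ 2 ^ 2) set))"
    and fixed_points: "\<And>x. x \<in> carrier G \<Longrightarrow> (\<And>A. A \<in> GL \<Longrightarrow> act A x = x) \<Longrightarrow> x = \<one>"
  shows "rho \<in> iso G (mob_group (mob ` GL))"
proof -
  let ?S = "mob ` (SL :: ('f ^ 2 ^ 2) set)"
  have fr: "finite (rho ` carrier G)" using fin by simp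
  have le: "card ?S \<le> card (rho ` carrier G)"
    by (rule card_mono[OF fr mob_SL_subset])
  have pos: "card (rho ` carrier G) > 0"
    using fr one_closed by (auto simp: card_gt_0_iff)
  have "card ker * card (rho ` carrier G) = card {k :: 'f. k\<^sup>2 = 1} * card ?S"
    using order_eq ord card_mob_GL[where 'f = 'f] card_mob_SL[where 'f = 'f] by simp
  also have "\<dots> \<le> 2 * card (rho ` carrier G)"
    by (rule mult_le_mono[OF card_square_roots le])
  finally have le2: "card ker \<le> 2"
    using pos by simp
  have "ker = {\<one>}"
  proof (rule ccontr)
    assume "ker \<noteq> {\<one>}"
    then obtain z where z: "z \<in> ker" "z \<noteq> \<one>"
      using subgroup.one_closed[OF ker_subgroup] by blast
    have "card ker \<le> card {\<one>, z}" using le2 z(2) by simp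
    then have ker: "ker = {\<one>, z}"
      using z subgroup.one_closed[OF ker_subgroup] finite_ker by (intro card_seteq[symmetric]) auto
    have zG: "z \<in> carrier G" using z by (simp add: ker_def)
    have "act A z = z" if A: "A \<in> GL" for A
    proof -
      interpret h: group_hom G G "act A" by (rule act_group_hom[OF A])
      have "act A z \<noteq> \<one>"
        using inj_onD[OF act_inj[OF A], of z \<one>] zG z(2) by auto
      then show ?thesis
        using ker_act[OF A z(1)] ker by simp
    qed
    then show False
      using fixed_points[OF zG] z(2) by blast
  qed
  moreover from this have "rho ` carrier G = mob ` GL"
    using order_eq ord by (intro card_subset_eq[OF _ rho_image_subset]) auto
  ultimately show ?thesis
    by (rule rho_iso)
qed

end


section \<open>Conjugation actions on quotients of matrix groups\<close>

text \<open>All cycles have length \<open>p\<close>; the induction removes one cycle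
  \<open>Y\<close> at a time.\<close>

lemma prime_dvd_card_without_fixed_points:
  assumes p: "prime (p::nat)"
  shows "finite X \<Longrightarrow> (\<And>y. y \<in> X \<Longrightarrow> f y \<in> X) \<Longrightarrow> (\<And>y. y \<in> X \<Longrightarrow> (f ^^ p) y = y) \<Longrightarrow>
    (\<And>y. y \<in> X \<Longrightarrow> f y \<noteq> y) \<Longrightarrow> p dvd card X"
proof (induction X rule: finite_psubset_induct)
  case (psubset X)
  have p0: "p > 0" using p prime_gt_0_nat by blast
  show ?case
  proof (cases "X = {}")
    case False
    then obtain y where y: "y \<in> X" by blast
    have per: "(f ^^ p) y = y" using psubset.prems(2) y by blast
    have fX: "(f ^^ n) y \<in> X" for n
      by (induction n) (use y psubset.prems(1) in auto)
    define Y where "Y = (\<lambda>i. (f ^^ i) y) ` {..<p}"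
    have inY: "(f ^^ n) y \<in> Y" for n
    proof -
      have "(f ^^ (n mod p)) y = (f ^^ n) y" by (rule funpow_mod_eq[OF per])
      then show ?thesis
        unfolding Y_def using p0 by (intro image_eqI[of _ _ "n mod p"]) auto
    qed
    have mult: "(f ^^ (d * a)) y = y" if "(f ^^ d) y = y" for d a
      using funpow_mod_eq[OF that, of "d * a"] by simp
    have "inj_on (\<lambda>i. (f ^^ i) y) {..<p}"
    proof (rule linorder_inj_onI)
      fix i j assume ij: "i < j" "i \<in> {..<p}" "j \<in> {..<p}"
      show "(f ^^ i) y \<noteq> (f ^^ j) y"
      proof
        assume "(f ^^ i) y = (f ^^ j) y"
        then have "(f ^^ (p - i)) ((f ^^ i) y) = (f ^^ (p - i)) ((f ^^ j) y)" by simp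
        moreover have "(f ^^ (p - i)) ((f ^^ i) y) = (f ^^ p) y"
          using fun_cong[OF funpow_add[of "p - i" i f], of y] ij by simp
        moreover have "p - i + j = (j - i) + p" using ij by simp
        then have "(f ^^ (p - i)) ((f ^^ j) y) = (f ^^ ((j - i) + p)) y"
          using fun_cong[OF funpow_add[of "p - i" j f], of y] by simp
        ultimately have "(f ^^ p) y = (f ^^ ((j - i) + p)) y"
          by simp
        then have d: "(f ^^ (j - i)) y = y"
          by (simp add: funpow_add per)
        \<comment> \<open>A period \<open>j - i\<close> below \<open>p\<close> is coprime to
          \<open>p\<close>; Bezout combines the two periods into the period 1, a fixed
          point.\<close>
        have "coprime (j - i) p"
          using p ij by (metis coprime_commute dvd_imp_le lessThan_iff less_imp_diff_less not_le prime_imp_coprime zero_less_diff)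
        moreover obtain a b where "(j - i) * a = p * b + gcd (j - i) p"
          using bezout_nat[of "j - i" p] ij by auto
        ultimately have "(j - i) * a = Suc (p * b)" by simp
        then have "f ((f ^^ (p * b)) y) = y"
          using mult[OF d, of a] by simp
        then show False
          using mult[OF per, of b] psubset.prems(3)[OF y] by simp
      qed
    qed auto
    then have cY: "card Y = p"
      by (simp add: Y_def card_image)
    have "Y \<subseteq> X" "Y \<noteq> {}" using fX p0 by (auto simp: Y_def)
    then have "X - Y \<subset> X" by blast
    moreover have "f z \<in> X - Y" if z: "z \<in> X - Y" for z
    proof -
      have "f z \<notin> Y"
      proof
        assume "f z \<in> Y"
        then obtain i where "f z = (f ^^ i) y" by (auto simp: Y_def)
        then have "(f ^^ (p - 1)) (f z) = (f ^^ (p - 1 + i)) y"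
          by (simp add: funpow_add)
        moreover have "(f ^^ (p - 1)) (f z) = (f ^^ p) z"
          using p0 funpow_Suc_right[of "p - 1" f] by (simp add: fun_eq_iff)
        ultimately have "z = (f ^^ (p - 1 + i)) y"
          using psubset.prems(2) z by simp
        then show False using inY z by blast
      qed
      then show ?thesis using psubset.prems(1) z by blast
    qed
    ultimately have "p dvd card (X - Y)"
      using psubset.IH[of "X - Y"] psubset.prems by blast
    moreover have "card X = card (X - Y) + card Y"
      using \<open>Y \<subseteq> X\<close> psubset.hyps by (metis card_Diff_subset card_mono finite_subset le_add_diff_inverse2)
    ultimately show ?thesis by (simp add: cY)
  qed simp
qed

text \<open>\<open>q\<close> is the identity for \<open>SL2\<close> and the coset map for the
  quotients. The fibre condition goes in one direction here, since in \<open>SL2\<close> distinct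
  scalar multiples stay distinct.\<close>

locale matrix_group = group K for K :: "('k, 'm) monoid_scheme" (structure) +
  fixes S :: "('f::{field,finite} ^ 2 ^ 2) set" and q :: "'f ^ 2 ^ 2 \<Rightarrow> 'k" and p :: nat
  assumes card_field: "CARD('f) = p" and prime_card: "prime p"
    and S: "S = GL \<or> S = SL"
    and q_image: "q ` S = carrier K"
    and q_mult: "A \<in> S \<Longrightarrow> B \<in> S \<Longrightarrow> q (A ** B) = q A \<otimes> q B"
    and q_eqD: "A \<in> S \<Longrightarrow> B \<in> S \<Longrightarrow> q A = q B \<Longrightarrow> \<exists>k. k \<noteq> 0 \<and> A = mat k ** B"
    and not_sq: "\<not> p\<^sup>2 dvd order K"
begin

lemma S_GL: "A \<in> S \<Longrightarrow> A \<in> GL"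
  using S by auto

lemma S_SL: "A \<in> SL \<Longrightarrow> A \<in> S"
  using S by auto

lemma S_mult: "A \<in> S \<Longrightarrow> B \<in> S \<Longrightarrow> A ** B \<in> S"
  using S by (auto simp: det_mul)

lemma S_inv:
  assumes "A \<in> S"
  shows "matrix_inv A \<in> S"
  using S matrix_inv_GL(3,4)[OF S_GL[OF assms]] assms by auto

lemma S_one: "mat 1 \<in> S"
  by (rule S_SL) (simp add: mat_eq_mat2)

lemma S_conj:
  assumes "A \<in> GL" "B \<in> S"
  shows "A ** B ** matrix_inv A \<in> S"
proof -
  have "det (A ** B ** matrix_inv A) = det B"
    using matrix_inv_GL(4)[OF assms(1)] assms(1) by (simp add: det_mul)
  then show ?thesis
    using S assms(2) by auto
qed

lemma q_closed: "A \<in> S \<Longrightarrow> q A \<in> carrier K"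
  unfolding q_image[symmetric] by (rule imageI)

lemma q_one: "q (mat 1) = \<one>"
proof -
  have c: "q (mat 1) \<in> carrier K" by (rule q_closed[OF S_one])
  have "q (mat 1) \<otimes> q (mat 1) = q (mat 1 ** mat 1)"
    by (rule q_mult[OF S_one S_one, symmetric])
  then have "q (mat 1) \<otimes> q (mat 1) = q (mat 1)"
    by (simp only: matrix_mul_lid)
  then show ?thesis
    by (rule l_cancel_one[OF c c, THEN iffD1])
qed

lemma q_inv:
  assumes "A \<in> S"
  shows "q (matrix_inv A) = inv (q A)"
proof -
  have "q (matrix_inv A) \<otimes> q A = \<one>"
    unfolding q_mult[OF S_inv[OF assms] assms, symmetric] matrix_inv_GL(2)[OF S_GL[OF assms]]
    by (rule q_one)
  from inv_equality[OF this q_closed[OF assms] q_closed[OF S_inv[OF assms]]] show ?thesis ..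
qed

lemma fin: "finite (carrier K)"
  unfolding q_image[symmetric] by (rule finite_imageI) (rule finite)

definition rep :: "'k \<Rightarrow> 'f ^ 2 ^ 2" where "rep x = (SOME B. B \<in> S \<and> q B = x)"

lemma rep:
  assumes "x \<in> carrier K"
  shows "rep x \<in> S" "q (rep x) = x"
proof -
  have "x \<in> q ` S" using assms by (simp only: q_image)
  then have "\<exists>B. B \<in> S \<and> q B = x" by blast
  from someI_ex[OF this] have "rep x \<in> S \<and> q (rep x) = x"
    unfolding rep_def .
  then show "rep x \<in> S" "q (rep x) = x" by blast+
qed

text \<open>All of \<open>GL\<close> acts, also when \<open>K\<close> comes from \<open>SL\<close>;
  the outer automorphisms given by diagonal matrices are essential for the torus of
  \<open>SL2\<close>.\<close>

definition act :: "'f ^ 2 ^ 2 \<Rightarrow> 'k \<Rightarrow> 'k" where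
  "act A x = q (A ** rep x ** matrix_inv A)"

text \<open>Two representatives of an element differ by a scalar matrix, which is central and is
  sent to the neutral element.\<close>

lemma act_q:
  assumes A: "A \<in> GL" and B: "B \<in> S"
  shows "act A (q B) = q (A ** B ** matrix_inv A)"
proof -
  let ?R = "rep (q B)"
  have R: "?R \<in> S" "q ?R = q B" using rep[OF q_closed[OF B]] by auto
  obtain k where k: "k \<noteq> 0" "?R = mat k ** B" using q_eqD[OF R(1) B R(2)] by blast
  have "mat k = ?R ** matrix_inv B"
    by (simp add: k(2) matrix_mul_assoc[symmetric] matrix_inv_GL[OF S_GL[OF B]])
  then have kS: "mat k \<in> S" "q (mat k) = \<one>"
    using S_mult[OF R(1) S_inv[OF B]] q_mult[OF R(1) S_inv[OF B]] q_inv[OF B] R(2) q_closed[OF B]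
    by simp_all
  have "A ** mat k = mat k ** A"
    by (cases A rule: mat2_exhaust) (simp add: mat_eq_mat2 mult.commute)
  then have "A ** ?R ** matrix_inv A = mat k ** (A ** B ** matrix_inv A)"
    by (simp add: k(2) matrix_mul_assoc)
  then show ?thesis
    using q_mult[OF kS(1) S_conj[OF A B]] q_closed[OF S_conj[OF A B]] kS(2) by (simp add: act_def)
qed

lemma act_closed: "A \<in> GL \<Longrightarrow> x \<in> carrier K \<Longrightarrow> act A x \<in> carrier K"
  unfolding act_def by (rule q_closed[OF S_conj[OF _ rep(1)]])

lemma act_one: "x \<in> carrier K \<Longrightarrow> act (mat 1) x = x"
  using act_q[of "mat 1" "rep x"] rep[of x] S_GL[OF S_one]
    matrix_inv_eqI[of "mat 1 :: 'f ^ 2 ^ 2" "mat 1"]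
  by (simp add: matrix_mul_lid matrix_mul_rid)

lemma act_mult:
  assumes A: "A \<in> GL" and B: "B \<in> GL" and x: "x \<in> carrier K"
  shows "act (A ** B) x = act A (act B x)"
proof -
  note r = rep[OF x]
  have "act (A ** B) x = q (A ** (B ** rep x ** matrix_inv B) ** matrix_inv A)"
    using act_q[OF GL_mult[OF A B] r(1)] r(2) by (simp add: matrix_inv_mult[OF A B] matrix_mul_assoc)
  also have "\<dots> = act A (act B x)"
    using act_q[OF A S_conj[OF B r(1)]] act_q[OF B r(1)] r(2) by simp
  finally show ?thesis .
qed

lemma act_hom:
  assumes A: "A \<in> GL" and x: "x \<in> carrier K" and y: "y \<in> carrier K"
  shows "act A (x \<otimes> y) = act A x \<otimes> act A y"
proof -
  note rx = rep[OF x] and ry = rep[OF y]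
  have "act A (x \<otimes> y) = q (A ** (rep x ** rep y) ** matrix_inv A)"
    using act_q[OF A S_mult[OF rx(1) ry(1)]] q_mult[OF rx(1) ry(1)] rx(2) ry(2) by simp
  also have "A ** (rep x ** rep y) ** matrix_inv A =
      (A ** rep x ** (matrix_inv A ** A)) ** (rep y ** matrix_inv A)"
    by (simp add: matrix_inv_GL[OF A] matrix_mul_assoc)
  also have "\<dots> = (A ** rep x ** matrix_inv A) ** (A ** rep y ** matrix_inv A)"
    by (simp only: matrix_mul_assoc)
  finally show ?thesis
    by (simp add: act_def q_mult[OF S_conj[OF A rx(1)] S_conj[OF A ry(1)]])
qed

lemma act_inner:
  assumes A: "A \<in> S" and x: "x \<in> carrier K"
  shows "act A x = q A \<otimes> x \<otimes> inv (q A)"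
  unfolding act_def
  using q_mult[OF S_mult[OF A rep(1)[OF x]] S_inv[OF A]] q_mult[OF A rep(1)[OF x]] rep(2)[OF x] q_inv[OF A]
  by simp

lemma act_auto:
  assumes A: "A \<in> GL"
  shows "(\<lambda>x\<in>carrier K. act A x) \<in> auto K"
proof -
  have "bij_betw (act A) (carrier K) (carrier K)"
  proof (rule bij_betwI[of _ _ _ "act (matrix_inv A)"])
    show "act (matrix_inv A) (act A x) = x" "act A (act (matrix_inv A) x) = x" if "x \<in> carrier K" for x
      using act_mult[OF matrix_inv_GL(3)[OF A] A that] act_mult[OF A matrix_inv_GL(3)[OF A] that]
        matrix_inv_GL[OF A] act_one[OF that] by simp_all
  qed (use act_closed A matrix_inv_GL(3)[OF A] in auto)
  then have "bij_betw (\<lambda>x\<in>carrier K. act A x) (carrier K) (carrier K)"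
    by (subst bij_betw_cong[where g = "act A"]) auto
  then show ?thesis
    using act_hom[OF A] act_closed[OF A] by (auto simp: auto_def Bij_def hom_def)
qed

text \<open>If \<open>p\<close> divides the order of the centralizer of \<open>x\<close>, then the size of the conjugacy class of \<open>x\<close> is
  prime to \<open>p\<close>, so the class contains a fixed point of the unipotent matrix.\<close>

lemma stabilizer_dichotomy:
  assumes x: "x \<in> carrier K"
  shows "(\<exists>A\<in>GL. act A x = x \<and> \<not> p dvd card (fixed (carrier K) (act A))) \<or>
    (\<exists>A\<in>GL. \<exists>y\<in>fixed (carrier K) (act (umat 1)). x = act A y)"
proof (cases "p dvd card (fixed (carrier K) (act (rep x)))")
  case False
  \<comment> \<open>\<open>x\<close> commutes with itself, so it is fixed by its own
    representative.\<close>
  have "act (rep x) x = x"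
    by (simp only: act_inner[OF rep(1)[OF x] x] rep(2)[OF x] m_assoc[OF x x inv_closed[OF x]]
        r_inv[OF x] r_one[OF x])
  then show ?thesis
    using False S_GL[OF rep(1)[OF x]] by blast
next
  case True
  define \<phi> where "\<phi> = (\<lambda>g. \<lambda>h\<in>carrier K. g \<otimes> h \<otimes> inv g)"
  interpret c: group_action K "carrier K" \<phi>
    unfolding \<phi>_def by (rule action_by_conjugation)
  let ?O = "orbit K \<phi> x"
  have "stabilizer K \<phi> x = fixed (carrier K) (act (rep x))"
  proof -
    have "g \<otimes> x \<otimes> inv g = x \<longleftrightarrow> x \<otimes> g \<otimes> inv x = g" if g: "g \<in> carrier K" for g
    proof -
      have "g \<otimes> x \<otimes> inv g = x \<longleftrightarrow> g \<otimes> x = x \<otimes> g"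
        using g x by (metis inv_solve_right m_closed)
      also have "\<dots> \<longleftrightarrow> x \<otimes> g \<otimes> inv x = g"
        using g x by (metis inv_solve_right m_closed)
      finally show ?thesis .
    qed
    then show ?thesis
      using x by (auto simp: stabilizer_def fixed_def \<phi>_def act_inner[OF rep(1)[OF x]] rep(2)[OF x])
  qed
  then have card: "card ?O * card (fixed (carrier K) (act (rep x))) = order K"
    using c.orbit_stabilizer_theorem[OF x] by simp
  have np: "\<not> p dvd card ?O"
  proof
    assume "p dvd card ?O"
    then have "p * p dvd order K"
      using True card by (metis mult_dvd_mono)
    then show False using not_sq by (simp add: power2_eq_square)
  qed
  let ?u = "umat 1 :: 'f ^ 2 ^ 2"
  have uS: "?u \<in> S" by (rule S_SL) simp
  have O: "?O = {g \<otimes> x \<otimes> inv g | g. g \<in> carrier K}"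
    using x by (auto simp: orbit_def \<phi>_def)
  have OK: "?O \<subseteq> carrier K" using x by (auto simp: O)
  have "act ?u y \<in> ?O" if y: "y \<in> ?O" for y
  proof -
    obtain g where g: "g \<in> carrier K" "y = g \<otimes> x \<otimes> inv g" using y by (auto simp: O)
    have "act ?u y = (q ?u \<otimes> g) \<otimes> x \<otimes> inv (q ?u \<otimes> g)"
      using g x y OK q_closed[OF uS] by (simp add: act_inner[OF uS] inv_mult_group m_assoc)
    then show ?thesis
      using g(1) q_closed[OF uS] unfolding O by blast
  qed
  moreover have "(act ?u ^^ p) y = y" if y: "y \<in> ?O" for y
  proof -
    have yK: "y \<in> carrier K" using y OK by blast
    have "(act ?u ^^ n) y = act (umat (of_nat n)) y" for n
    proof (induction n)
      case 0
      then show ?case using act_one[OF yK] by (simp add: mat_eq_mat2)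
    next
      case (Suc n)
      have "umat (of_nat (Suc n)) = ?u ** umat (of_nat n)" by (simp add: algebra_simps)
      then show ?case
        using Suc act_mult[of ?u "umat (of_nat n)" y] yK by (simp add: add.commute)
    qed
    moreover have "of_nat p = (0 :: 'f)"
    proof -
      have "(\<Sum>x\<in>UNIV. x + 1 :: 'f) = (\<Sum>x\<in>UNIV. x)"
        by (rule sum.reindex_bij_witness[of _ "\<lambda>x. x - 1" "\<lambda>x. x + 1"]) auto
      then show ?thesis
        by (simp add: sum.distrib card_field)
    qed
    ultimately show ?thesis
      using act_one[OF yK] by (simp add: mat_eq_mat2)
  qed
  moreover have "finite ?O" using OK fin finite_subset by blast
  ultimately obtain y where y: "y \<in> ?O" "act ?u y = y"
    using prime_dvd_card_without_fixed_points[OF prime_card, of ?O "act ?u"] np by blast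
  obtain g where g: "g \<in> carrier K" "y = g \<otimes> x \<otimes> inv g" using y by (auto simp: O)
  have ig: "inv g \<in> carrier K" using g by simp
  have "act (rep (inv g)) y = x"
    using act_inner[OF rep(1)[OF ig], of y] rep(2)[OF ig] g x by (simp add: m_assoc) (simp add: m_assoc[symmetric])
  moreover have "y \<in> fixed (carrier K) (act ?u)"
    using y OK by (auto simp: fixed_def)
  ultimately show ?thesis
    using S_GL[OF rep(1)[OF ig]] by metis
qed

text \<open>Compatibility with the product of \<open>\<Lambda>\<close> comes from
  \<open>auto K \<subseteq> auto \<Lambda>\<close>; the other conditions concern the set and the
  action, which \<open>\<Lambda>\<close> shares with \<open>K\<close>.\<close>

lemma competitor_GL2_action:
  fixes \<Lambda> :: "'k monoid"
  assumes "group \<Lambda>" and car: "carrier \<Lambda> = carrier K" and sub: "auto K \<subseteq> auto \<Lambda>"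
    and c1: "card (fixed (carrier K) (act (umat 1))) = p \<or>
      card (fixed (carrier K) (act (umat 1))) = 2 * p \<and> odd p"
    and c2: "card (fixed (carrier K) (act (umat 1)) \<inter> fixed (carrier K) (act (lmat 1))) < p"
  shows "GL2_action \<Lambda> act p"
proof -
  interpret L: group \<Lambda> by fact
  show ?thesis
  proof
    fix A :: "'f ^ 2 ^ 2" and x y assume A: "A \<in> GL" and xy: "x \<in> carrier \<Lambda>" "y \<in> carrier \<Lambda>"
    have "(\<lambda>x\<in>carrier K. act A x) \<in> hom \<Lambda> \<Lambda>"
      using act_auto[OF A] sub by (auto simp: auto_def)
    from hom_mult[OF this xy] show "act A (x \<otimes>\<^bsub>\<Lambda>\<^esub> y) = act A x \<otimes>\<^bsub>\<Lambda>\<^esub> act A y"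
      using xy L.m_closed[OF xy] by (simp add: car)
  next
    show "\<not> p\<^sup>2 dvd order \<Lambda>"
      using not_sq by (simp add: order_def car)
  qed (use card_field prime_card fin act_closed act_one act_mult c1 c2 stabilizer_dichotomy in \<open>simp_all add: car\<close>)
qed

end


section \<open>Quotients in which scalar matrices become trivial\<close>

lemma card_image_eq_of_same_fibres:
  assumes "\<And>a b. a \<in> S \<Longrightarrow> b \<in> S \<Longrightarrow> f a = f b \<longleftrightarrow> g a = g b"
  shows "card (f ` S) = card (g ` S)"
proof (rule bij_betw_same_card[of "\<lambda>x. g (inv_into S f x)"])
  have inv: "inv_into S f (f a) \<in> S" "f (inv_into S f (f a)) = f a" if "a \<in> S" for a
    using that by (simp_all add: inv_into_into f_inv_into_f)
  have g: "g (inv_into S f (f a)) = g a" if "a \<in> S" for a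
    using assms[OF inv(1)[OF that] that] inv(2)[OF that] by simp
  show "bij_betw (\<lambda>x. g (inv_into S f x)) (f ` S) (g ` S)"
    unfolding bij_betw_def
  proof
    show "inj_on (\<lambda>x. g (inv_into S f x)) (f ` S)"
      using assms by (auto simp: inj_on_def g)
    show "(\<lambda>x. g (inv_into S f x)) ` f ` S = g ` S"
      unfolding image_image by (rule image_cong) (simp_all add: g)
  qed
qed

locale matrix_quotient = matrix_group K S q p
  for K :: "('k, 'm) monoid_scheme" (structure) and S :: "('f::{field,finite} ^ 2 ^ 2) set"
    and q :: "'f ^ 2 ^ 2 \<Rightarrow> 'k" and p :: nat +
  assumes q_eqI: "A \<in> S \<Longrightarrow> B \<in> S \<Longrightarrow> k \<noteq> 0 \<Longrightarrow> A = mat k ** B \<Longrightarrow> q A = q B"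
begin

text \<open>In the quotient, commuting means commuting up to a scalar, so a factor \<open>k\<close>
  enters the centralizer computations.\<close>

lemma fixed_q:
  assumes A: "A \<in> GL" and B: "B \<in> S" and fx: "act A (q B) = q B"
  obtains k where "k \<noteq> 0" "A ** B = mat k ** (B ** A)"
proof -
  have "q (A ** B ** matrix_inv A) = q B"
    using fx act_q[OF A B] by simp
  from q_eqD[OF S_conj[OF A B] B this] obtain k
    where k: "k \<noteq> 0" "A ** B ** matrix_inv A = mat k ** B" by blast
  have "A ** B = A ** B ** (matrix_inv A ** A)"
    by (simp only: matrix_inv_GL(2)[OF A] matrix_mul_rid)
  also have "\<dots> = (A ** B ** matrix_inv A) ** A"
    by (simp only: matrix_mul_assoc)
  also have "\<dots> = mat k ** (B ** A)"
    by (simp only: k(2) matrix_mul_assoc)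
  finally show ?thesis
    using that k(1) by blast
qed

lemma umat_S: "umat t \<in> S"
  by (rule S_SL) simp

lemma fixed_umat: "fixed (carrier K) (act (umat 1)) = (\<lambda>t. q (umat t)) ` UNIV"
proof (intro equalityI subsetI)
  fix x assume "x \<in> fixed (carrier K) (act (umat 1))"
  then have x: "x \<in> carrier K" "act (umat 1) x = x" by (auto simp: fixed_def)
  note r = rep[OF x(1)]
  obtain a b c d where R: "rep x = mat2 a b c d" by (rule mat2_exhaust)
  have uG: "umat 1 \<in> GL" by simp
  have "act (umat 1) (q (rep x)) = q (rep x)" using x(2) r(2) by simp
  then obtain k where k: "k \<noteq> 0" "umat 1 ** rep x = mat k ** (rep x ** umat 1)"
    by (rule fixed_q[OF uG r(1)])
  then have e: "a + c = k * a" "b + d = k * (a + b)" "c = k * c" "d = k * (c + d)"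
    by (simp_all add: R mat_eq_mat2)
  \<comment> \<open>If \<open>c \<noteq> 0\<close>, the third equation gives \<open>k = 1\<close>
    and then the first gives \<open>c = 0\<close>.\<close>
  have "c = 0"
    using e(1,3) by (cases "c = 0") auto
  then have "a \<noteq> 0" using S_GL[OF r(1)] by (auto simp: R)
  then have "k = 1" using e(1) \<open>c = 0\<close> by simp
  then have "d = a" using e(2) by (simp add: add.commute)
  have "rep x = mat a ** umat (b / a)"
    using \<open>a \<noteq> 0\<close> by (simp add: R mat_eq_mat2 \<open>c = 0\<close> \<open>d = a\<close>)
  then have "x = q (umat (b / a))"
    using q_eqI[OF r(1) umat_S \<open>a \<noteq> 0\<close>] r(2) by simp
  then show "x \<in> (\<lambda>t. q (umat t)) ` UNIV" by blast
next
  fix x assume "x \<in> (\<lambda>t. q (umat t)) ` UNIV"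
  then obtain t where x: "x = q (umat t)" by blast
  have "matrix_inv (umat 1) = umat (- 1 :: 'f)"
    by (rule matrix_inv_eqI) (simp add: mat_eq_mat2)
  then have "act (umat 1) x = x"
    using act_q[OF _ umat_S, of "umat 1" t] by (simp add: x)
  then show "x \<in> fixed (carrier K) (act (umat 1))"
    using q_closed[OF umat_S, of t] by (simp add: x fixed_def)
qed

lemma card_fixed_umat: "card (fixed (carrier K) (act (umat 1))) = p"
proof -
  have "inj (\<lambda>t. q (umat t))"
  proof
    fix s t assume "q (umat s) = q (umat t)"
    then obtain k where "umat s = mat k ** umat t"
      using q_eqD[OF umat_S umat_S] by blast
    then show "s = t" by (simp add: mat_eq_mat2)
  qed
  then show ?thesis
    using card_image[of "\<lambda>t. q (umat t)" UNIV] card_field by (simp only: fixed_umat)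
qed

lemma fixed_umat_lmat:
  assumes "x \<in> fixed (carrier K) (act (umat 1))" "x \<in> fixed (carrier K) (act (lmat 1))"
  shows "x = \<one>"
proof -
  obtain t where t: "x = q (umat t)" using assms(1) by (auto simp: fixed_umat)
  have "act (lmat 1) (q (umat t)) = q (umat t)"
    using assms(2) by (simp add: t fixed_def)
  then obtain k where "lmat 1 ** umat t = mat k ** (umat t ** lmat 1)"
    by (rule fixed_q[rotated 2]) (simp_all add: umat_S)
  \<comment> \<open>The lower left entries force \<open>k = 1\<close>.\<close>
  then have "t = 0" by (auto simp: mat_eq_mat2)
  then show ?thesis
    using q_one by (simp add: t mat_eq_mat2)
qed

lemma mob_rep: "B \<in> S \<Longrightarrow> mob (rep (q B)) = mob B"
  using q_eqD[OF rep(1)[OF q_closed] _ rep(2)[OF q_closed]] mob_eq_iff[OF S_GL S_GL] rep(1)[OF q_closed]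
  by blast

lemma iso_mob: "(\<lambda>x. mob (rep x)) \<in> iso K (mob_group (mob ` S))"
proof -
  have "(\<lambda>x. mob (rep x)) ` carrier K = mob ` S"
    unfolding q_image[symmetric] image_image by (rule image_cong) (simp_all add: mob_rep)
  moreover have "inj_on (\<lambda>x. mob (rep x)) (carrier K)"
  proof
    fix x y assume x: "x \<in> carrier K" and y: "y \<in> carrier K" and eq: "mob (rep x) = mob (rep y)"
    then obtain k where "k \<noteq> 0" "rep x = mat k ** rep y"
      using mob_eq_iff[OF S_GL[OF rep(1)[OF x]] S_GL[OF rep(1)[OF y]]] by blast
    then show "x = y"
      using q_eqI[OF rep(1)[OF x] rep(1)[OF y]] rep(2)[OF x] rep(2)[OF y] by metis
  qed
  moreover have "mob (rep (x \<otimes> y)) = mob (rep x) \<circ> mob (rep y)"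
    if x: "x \<in> carrier K" and y: "y \<in> carrier K" for x y
  proof -
    note rx = rep[OF x] and ry = rep[OF y]
    have "mob (rep (q (rep x ** rep y))) = mob (rep x ** rep y)"
      by (rule mob_rep[OF S_mult[OF rx(1) ry(1)]])
    then show ?thesis
      using q_mult[OF rx(1) ry(1)] rx(2) ry(2) mob_mult[OF S_GL[OF ry(1)]] by simp
  qed
  ultimately show ?thesis
    by (auto simp: iso_def hom_def bij_betw_def mob_group_def)
qed

text \<open>\<open>K\<close> and \<open>\<Lambda>\<close> are both identified with the group of
  fractional linear maps coming from \<open>S\<close>.\<close>

lemma rigid: "group_rigid K"
  unfolding group_rigid_def
proof (intro allI impI)
  fix \<Lambda> :: "'k monoid" assume "group \<Lambda> \<and> carrier \<Lambda> = carrier K \<and> auto K \<subseteq> auto \<Lambda>"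
  then have L: "group \<Lambda>" "carrier \<Lambda> = carrier K" "auto K \<subseteq> auto \<Lambda>" by auto
  interpret L: group \<Lambda> by fact
  have p1: "p > 1" using prime_card prime_gt_1_nat by blast
  have "fixed (carrier K) (act (umat 1)) \<inter> fixed (carrier K) (act (lmat 1)) \<subseteq> {\<one>}"
    using fixed_umat_lmat by blast
  from card_mono[OF _ this] have c2:
    "card (fixed (carrier K) (act (umat 1)) \<inter> fixed (carrier K) (act (lmat 1))) < p"
    using p1 by simp
  interpret A: GL2_action \<Lambda> act p
    by (rule competitor_GL2_action[OF L disjI1[OF card_fixed_umat] c2])
  have ord: "order \<Lambda> = card (mob ` S)"
    using bij_betw_same_card[of "\<lambda>x. mob (rep x)" "carrier K" "mob ` S"] iso_mob
    by (simp add: order_def L(2) iso_def mob_group_def)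
  have "\<exists>h. h \<in> iso \<Lambda> (mob_group (mob ` S))"
    using S
  proof
    assume "S = SL"
    then show ?thesis using A.iso_mob_SL ord by blast
  next
    assume SG: "S = GL"
    have fixK: "x = \<one>" if x: "x \<in> carrier K" "\<And>A. A \<in> GL \<Longrightarrow> act A x = x" for x
      by (rule fixed_umat_lmat) (use x in \<open>simp_all add: fixed_def\<close>)
    \<comment> \<open>The neutral element of \<open>\<Lambda>\<close> is fixed by all of
      \<open>GL\<close>, and the neutral element of \<open>K\<close> is the only such point; so the
      two agree.\<close>
    have "act A \<one>\<^bsub>\<Lambda>\<^esub> = \<one>\<^bsub>\<Lambda>\<^esub>" if "A \<in> GL" for A
      using group_hom.hom_one[OF A.act_group_hom[OF that]] .
    then have "\<one>\<^bsub>\<Lambda>\<^esub> = \<one>"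
      using fixK[of "\<one>\<^bsub>\<Lambda>\<^esub>"] L.one_closed L(2) by simp
    then show ?thesis
      using A.iso_mob_GL ord fixK SG L(2) by metis
  qed
  then have "\<Lambda> \<cong> mob_group (mob ` S)" "K \<cong> mob_group (mob ` S)"
    using iso_mob by (auto simp: is_iso_def)
  then show "K \<cong> \<Lambda>"
    using iso_trans[OF _ L.iso_sym] by blast
qed

end

text \<open>Besides the two projective groups this covers \<open>SL2\<close> over the field with two
  elements, where 1 is the only nonzero scalar.\<close>

theorem quotient_group_rigid:
  fixes K :: "('k, 'm) monoid_scheme" (structure) and q :: "'f::{field,finite} ^ 2 ^ 2 \<Rightarrow> 'k"
  assumes "group K" and prime: "prime (CARD('f))" and S: "S = GL \<or> S = SL"
    and "q ` S = carrier K"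
    and "\<And>A B. A \<in> S \<Longrightarrow> B \<in> S \<Longrightarrow> q (A ** B) = q A \<otimes> q B"
    and q: "\<And>A B. A \<in> S \<Longrightarrow> B \<in> S \<Longrightarrow> q A = q B \<longleftrightarrow> (\<exists>k. k \<noteq> 0 \<and> A = mat k ** B)"
  shows "group_rigid K"
proof -
  interpret group K by fact
  have GL: "A \<in> GL" if "A \<in> S" for A using S that by auto
  have "card (q ` S) = card (mob ` S)"
    by (rule card_image_eq_of_same_fibres) (simp only: q mob_eq_iff[OF GL GL])
  then have "order K = card (mob ` S)"
    by (simp only: order_def assms(4)[symmetric])
  then have "\<not> (CARD('f))\<^sup>2 dvd order K"
    using not_sq_dvd_card_mob[OF prime S] by simp
  then interpret matrix_quotient K S q "CARD('f)"
    using assms by unfold_locales (simp_all only: q, blast+)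
  show ?thesis by (rule rigid)
qed

section \<open>The matrix groups and their quotients by scalars\<close>

lemma matrix_group_GL2: "group (GL2 :: ('f::field ^ 2 ^ 2) monoid)"
proof (rule groupI)
  fix A :: "'f ^ 2 ^ 2" assume "A \<in> carrier GL2"
  then have "A \<in> GL" by (simp add: GL2_def invertible_iff_GL)
  then show "\<exists>B\<in>carrier GL2. B \<otimes>\<^bsub>GL2\<^esub> A = \<one>\<^bsub>GL2\<^esub>"
    using matrix_inv_GL[of A]
    by (intro bexI[of _ "matrix_inv A"]) (simp_all add: GL2_def invertible_iff_GL)
qed (simp_all add: GL2_def invertible_iff_GL det_mul matrix_mul_assoc matrix_mul_lid)

lemma matrix_group_SL2: "group (SL2 :: ('f::field ^ 2 ^ 2) monoid)"
proof (rule groupI)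
  fix A :: "'f ^ 2 ^ 2" assume A: "A \<in> carrier SL2"
  then have "A \<in> GL" by (simp add: SL2_def)
  then show "\<exists>B\<in>carrier SL2. B \<otimes>\<^bsub>SL2\<^esub> A = \<one>\<^bsub>SL2\<^esub>"
    using matrix_inv_GL[of A] A by (intro bexI[of _ "matrix_inv A"]) (simp_all add: SL2_def)
qed (simp_all add: SL2_def det_mul matrix_mul_assoc matrix_mul_lid)

lemma mod_scalars:
  fixes G :: "('f::{field,finite} ^ 2 ^ 2) monoid"
  assumes "group G" and G: "G = \<lparr>carrier = S, mult = (**), one = mat 1\<rparr>"
    and S: "S = GL \<or> S = SL" and prime: "prime (CARD('f))"
  defines "Q \<equiv> G Mod (carrier G \<inter> scalar_matrices)"
  shows "group Q" "finite (carrier Q)" "group_rigid Q"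
proof -
  interpret group G by fact
  let ?N = "carrier G \<inter> scalar_matrices"
  have car: "carrier G = S" and mul: "\<And>A B. A \<otimes>\<^bsub>G\<^esub> B = A ** B" and one: "\<one>\<^bsub>G\<^esub> = mat 1"
    by (simp_all add: G)
  have N: "A \<in> ?N \<longleftrightarrow> A \<in> S \<and> (\<exists>k. k \<noteq> 0 \<and> A = mat k)" for A
  proof -
    have "k \<noteq> 0" if "mat k \<in> S" for k :: 'f
      using S that by (auto simp: mat_eq_mat2)
    then show ?thesis by (auto simp: car scalar_matrices_def)
  qed
  have central: "A ** mat k = mat k ** A" for A :: "'f ^ 2 ^ 2" and k
    by (cases A rule: mat2_exhaust) (simp add: mat_eq_mat2 mult.commute)
  have inv_scalar: "inv\<^bsub>G\<^esub> (mat k) = mat (1 / k)" if k: "mat k \<in> S" "k \<noteq> 0" for k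
  proof -
    have "mat (1 / k) \<in> S"
      using S k by (auto simp: mat_eq_mat2 power2_eq_square divide_simps)
    moreover have "mat (1 / k) \<otimes>\<^bsub>G\<^esub> mat k = \<one>\<^bsub>G\<^esub>"
      using k(2) by (simp add: mul one mat_eq_mat2)
    ultimately show ?thesis
      using k(1) by (intro inv_equality) (simp_all add: car)
  qed
  have "subgroup ?N G"
  proof (rule subgroupI)
    show "?N \<noteq> {}" using one_closed one by (auto simp: scalar_matrices_def)
    fix a assume a: "a \<in> ?N"
    then obtain k where k: "a = mat k" "mat k \<in> S" "k \<noteq> 0" by (auto simp only: N)
    show "inv\<^bsub>G\<^esub> a \<in> ?N"
      using inv_closed[of a] a k inv_scalar[OF k(2,3)] by (auto simp: scalar_matrices_def)
    fix b assume b: "b \<in> ?N"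
    then obtain l where l: "b = mat l" by (auto simp: scalar_matrices_def)
    have "mat k ** mat l = (mat (k * l) :: 'f ^ 2 ^ 2)" by (simp add: mat_eq_mat2)
    then show "a \<otimes>\<^bsub>G\<^esub> b \<in> ?N"
      using m_closed[of a b] a b k l by (auto simp: scalar_matrices_def mul)
  qed simp
  moreover have "x \<otimes>\<^bsub>G\<^esub> h \<otimes>\<^bsub>G\<^esub> inv\<^bsub>G\<^esub> x \<in> ?N" if x: "x \<in> carrier G" and h: "h \<in> ?N" for x h
  proof -
    have "x \<otimes>\<^bsub>G\<^esub> h = h \<otimes>\<^bsub>G\<^esub> x" using h central[of x] by (auto simp: scalar_matrices_def mul)
    then have "x \<otimes>\<^bsub>G\<^esub> h \<otimes>\<^bsub>G\<^esub> inv\<^bsub>G\<^esub> x = h"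
      using x h by (simp add: m_assoc)
    then show ?thesis using h by simp
  qed
  ultimately have nrm: "?N \<lhd> G"
    by (simp add: normal_inv_iff)
  interpret N: normal ?N G by (rule nrm)
  show gQ: "group Q"
    unfolding Q_def by (rule N.factorgroup_is_group)
  let ?q = "\<lambda>A. ?N #>\<^bsub>G\<^esub> A"
  have q_image: "?q ` S = carrier Q"
    by (auto simp: Q_def FactGroup_def RCOSETS_def car)
  show "finite (carrier Q)"
    unfolding q_image[symmetric] by (rule finite_imageI) (rule finite)
  have q_mult: "?q (A ** B) = ?q A \<otimes>\<^bsub>Q\<^esub> ?q B" if "A \<in> S" "B \<in> S" for A B
    using N.rcos_sum[of A B] that by (simp add: Q_def FactGroup_def car mul)
  have q_eq: "?q A = ?q B \<longleftrightarrow> (\<exists>k. k \<noteq> 0 \<and> A = mat k ** B)" if A: "A \<in> S" and B: "B \<in> S" for A B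
  proof
    assume "?q A = ?q B"
    then have "A \<in> ?q B"
      using rcos_self[OF _ N.subgroup_axioms, of A] A car by simp
    then obtain n where n: "n \<in> ?N" "A = n ** B"
      unfolding r_coset_def mul by blast
    from n(1) obtain k where "k \<noteq> 0" "n = mat k"
      unfolding N by blast
    then show "\<exists>k. k \<noteq> 0 \<and> A = mat k ** B"
      using n(2) by blast
  next
    assume "\<exists>k. k \<noteq> 0 \<and> A = mat k ** B"
    then obtain k where k: "k \<noteq> 0" "A = mat k ** B" by blast
    then have "mat k \<in> S"
      using S A B by (auto simp: det_mul mat_eq_mat2)
    then have kN: "mat k \<in> ?N" unfolding N using k(1) by blast
    have "A \<in> ?q B"
      unfolding r_coset_def mul using k(2) by (intro UN_I[OF kN]) simp
    then show "?q A = ?q B"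
      using repr_independence[OF _ _ N.subgroup_axioms, of A B] B car by simp
  qed
  show "group_rigid Q"
    by (rule quotient_group_rigid[OF gQ prime S q_image q_mult q_eq])
qed


section \<open>The group \<open>SL\<^sub>2\<close> in odd characteristic\<close>

text \<open>Weyl elements and torus of \<open>SL2\<close>. The matrix \<open>smat a\<close> has
  determinant \<open>a\<close>, so in general it lies outside \<open>SL\<close> and enters through
  its action.\<close>

abbreviation wmat :: "'f::field \<Rightarrow> 'f ^ 2 ^ 2" where "wmat t \<equiv> mat2 0 t (- (1 / t)) 0"
abbreviation dmat :: "'f::field \<Rightarrow> 'f ^ 2 ^ 2" where "dmat a \<equiv> mat2 a 0 0 (1 / a)"
abbreviation smat :: "'f::field \<Rightarrow> 'f ^ 2 ^ 2" where "smat a \<equiv> mat2 a 0 0 1"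

lemma mob_conjI:
  assumes A: "A \<in> GL" and B: "B \<in> GL" and eq: "A ** B = C ** A"
  shows "mob A \<circ> mob B \<circ> mob (matrix_inv A) = mob C"
proof -
  have "mob A \<circ> mob B = mob C \<circ> mob A"
    using mob_mult[OF B, of A] mob_mult[OF A, of C] eq by simp
  then have "mob A \<circ> mob B \<circ> mob (matrix_inv A) = mob C \<circ> (mob A \<circ> mob (matrix_inv A))"
    by (simp only: comp_assoc)
  then show ?thesis
    by (simp only: mob_inv(1)[OF A] comp_id)
qed

lemma conj_eq_iff:
  fixes A B :: "'f::field ^ 2 ^ 2"
  assumes A: "A \<in> GL"
  shows "A ** B ** matrix_inv A = B \<longleftrightarrow> A ** B = B ** A"
proof
  assume "A ** B ** matrix_inv A = B"
  then have "A ** B ** matrix_inv A ** A = B ** A" by simp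
  then show "A ** B = B ** A"
    by (simp add: matrix_mul_assoc[symmetric] matrix_inv_GL[OF A] matrix_mul_rid)
next
  assume "A ** B = B ** A"
  then show "A ** B ** matrix_inv A = B"
    by (simp add: matrix_mul_assoc[symmetric] matrix_inv_GL[OF A] matrix_mul_rid)
qed

text \<open>Otherwise adding 1 would be an involution of the field without fixed points.\<close>

lemma odd_card_two_nonzero:
  assumes "odd (CARD('f::{field,finite}))"
  shows "(2 :: 'f) \<noteq> 0"
proof
  assume two: "(2 :: 'f) = 0"
  have "((\<lambda>x. x + 1) ^^ 2) y = y" for y :: 'f
  proof -
    have "((\<lambda>x. x + 1) ^^ 2) y = y + 2" by (simp add: numeral_2_eq_2)
    then show ?thesis using two by simp
  qed
  then have "2 dvd card (UNIV :: 'f set)"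
    using prime_dvd_card_without_fixed_points[OF two_is_prime_nat, of "UNIV :: 'f set" "\<lambda>x. x + 1"]
    by simp
  then show False using assms by simp
qed

text \<open>The elements are matrices with two products: \<open>\<otimes>\<close> is the unknown
  one, \<open>**\<close> that of matrices. \<open>act_conj\<close> refers to the second and makes
  being diagonal a property that \<open>act\<close> can see.\<close>

locale odd_SL2 = GL2_action G act p
  for G :: "('f::{field,finite} ^ 2 ^ 2) monoid" (structure)
    and act :: "'f ^ 2 ^ 2 \<Rightarrow> 'f ^ 2 ^ 2 \<Rightarrow> 'f ^ 2 ^ 2" and p +
  assumes carrier_SL: "carrier G = SL"
    and act_conj: "A \<in> GL \<Longrightarrow> B \<in> SL \<Longrightarrow> act A B = A ** B ** matrix_inv A"
    and odd_p: "odd p"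
begin

lemma two_nonzero: "(2 :: 'f) \<noteq> 0"
  by (rule odd_card_two_nonzero) (simp only: card_field odd_p not_False_eq_True)

lemma neg_eq_self: "(x :: 'f) = - x \<longleftrightarrow> x = 0"
proof
  assume "x = - x"
  then have "x + x = - x + x" by (rule arg_cong[where f = "\<lambda>y. y + x"])
  then have "2 * x = 0" by (simp only: mult_2 left_minus)
  then show "x = 0" using two_nonzero by simp
qed simp

lemma act_fixed_iff:
  assumes A: "A \<in> GL" and B: "B \<in> SL"
  shows "act A B = B \<longleftrightarrow> A ** B = B ** A"
  by (simp only: act_conj[OF A B] conj_eq_iff[OF A])

text \<open>\<open>rho x\<close> commutes with every \<open>mob A\<close>. It fixes infinity, the
  only fixed point of \<open>umat 1\<close>, hence all points by transitivity.\<close>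

lemma fixed_imp_ker:
  assumes x: "x \<in> carrier G" and fx: "\<And>A. A \<in> GL \<Longrightarrow> act A x = x"
  shows "x \<in> ker"
proof -
  have comm: "rho x (mob A z) = mob A (rho x z)" if "A \<in> GL" for A z
    using fun_cong[OF rho_act_mob[OF that x], of z] fx[OF that] by simp
  have None: "rho x None = None"
    using comm[of "umat 1" None] by (cases "rho x None") simp_all
  have "rho x z = z" for z
  proof -
    obtain g where g: "g \<in> SL" "mob g None = z" by (rule mob_transitive)
    then show ?thesis
      using comm[of g None] None by simp
  qed
  then have "rho x = id" by (simp add: fun_eq_iff)
  then show ?thesis using x by (simp add: ker_def)
qed

lemma mat_pm1_SL: "mat 1 \<in> (SL :: ('f ^ 2 ^ 2) set)" "mat (- 1) \<in> (SL :: ('f ^ 2 ^ 2) set)"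
  by (simp_all add: mat_eq_mat2)

lemma mat_fixed:
  assumes "A \<in> GL" "mat k \<in> SL"
  shows "act A (mat k) = mat k"
  unfolding act_fixed_iff[OF assms]
  by (cases A rule: mat2_exhaust) (simp add: mat_eq_mat2 mult.commute)

lemma mat_ne: "mat 1 \<noteq> (mat (- 1) :: 'f ^ 2 ^ 2)"
  using neg_eq_self[of 1] by (simp add: mat_eq_mat2)

text \<open>The scalar matrices in \<open>SL\<close> are fixed by every \<open>act A\<close> and so
  lie in the kernel; the orders allow no more than two elements.\<close>

lemma ker_eq_and_image: "ker = {mat 1, mat (- 1)}" "rho ` carrier G = mob ` SL"
proof -
  let ?S = "mob ` (SL :: ('f ^ 2 ^ 2) set)"
  have fr: "finite (rho ` carrier G)" using fin by simp
  have le: "card ?S \<le> card (rho ` carrier G)"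
    by (rule card_mono[OF fr mob_SL_subset])
  have pos: "card (rho ` carrier G) > 0"
    using fr one_closed by (auto simp: card_gt_0_iff simp del: one_closed)
  have eq: "card ker * card (rho ` carrier G) = card {k :: 'f. k\<^sup>2 = 1} * card ?S"
    using order_eq card_mob_SL[where 'f = 'f] by (simp add: order_def carrier_SL)
  also have "\<dots> \<le> 2 * card (rho ` carrier G)"
    by (rule mult_le_mono[OF card_square_roots le])
  finally have le2: "card ker \<le> 2"
    using pos by simp
  have "mat 1 \<in> ker" "mat (- 1) \<in> ker"
    using mat_pm1_SL by (simp_all only: fixed_imp_ker carrier_SL mat_fixed)
  then have sub: "{mat 1, mat (- 1)} \<subseteq> ker" by simp
  show ker: "ker = {mat 1, mat (- 1)}"
    by (rule card_seteq[OF finite_ker sub, symmetric]) (use le2 mat_ne in simp)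
  have "card ker = 2" using mat_ne by (simp add: ker)
  then have "2 * card (rho ` carrier G) \<le> 2 * card ?S"
    using eq mult_le_mono1[OF card_square_roots, of "card ?S"] by simp
  then have "?S = rho ` carrier G"
    using le by (intro card_subset_eq[OF fr mob_SL_subset]) simp
  then show "rho ` carrier G = mob ` SL" ..
qed

text \<open>The neutral element of \<open>G\<close> is one of the matrices \<open>1\<close> and \<open>-1\<close>, possibly \<open>-1\<close>; \<open>\<zeta>\<close> is the other one.\<close>

definition \<zeta> :: "'f ^ 2 ^ 2" where "\<zeta> = (if \<one> = mat 1 then mat (- 1) else mat 1)"

lemma \<zeta>: "\<zeta> \<in> ker" "\<zeta> \<noteq> \<one>" "ker = {\<one>, \<zeta>}" "\<zeta> \<in> carrier G"
proof -
  have "\<one> \<in> ker" using subgroup.one_closed[OF ker_subgroup] .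
  then have one: "\<one> = mat 1 \<or> \<one> = mat (- 1)" using ker_eq_and_image(1) by simp
  show 1: "\<zeta> \<in> ker" by (simp add: \<zeta>_def ker_eq_and_image)
  show "\<zeta> \<noteq> \<one>" using mat_ne one by (auto simp: \<zeta>_def)
  show "ker = {\<one>, \<zeta>}" using one by (auto simp: \<zeta>_def ker_eq_and_image)
  show "\<zeta> \<in> carrier G" using 1 by (simp add: ker_def)
qed

lemma \<zeta>_sq: "\<zeta> \<otimes> \<zeta> = \<one>"
proof -
  have "\<zeta> \<otimes> \<zeta> \<in> ker" using subgroup.m_closed[OF ker_subgroup \<zeta>(1) \<zeta>(1)] .
  moreover have "\<zeta> \<otimes> \<zeta> \<noteq> \<zeta>" using \<zeta>(2,4) by simp
  ultimately show ?thesis using \<zeta>(3) by blast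
qed

lemma \<zeta>_central:
  assumes x: "x \<in> carrier G"
  shows "x \<otimes> \<zeta> = \<zeta> \<otimes> x"
proof -
  interpret c: group_hom G G "cj x" by (rule cj_group_hom[OF x])
  have "cj x \<zeta> \<in> ker"
    using x \<zeta>(1,4) by (simp add: ker_def rho_mult cj_def rho_inv)
  moreover have "cj x \<zeta> \<noteq> \<one>"
    using inj_onD[OF cj_inj[OF x], of \<zeta> \<one>] \<zeta>(2,4) by auto
  ultimately have "cj x \<zeta> = \<zeta>" using \<zeta>(3) by blast
  then have "x \<otimes> \<zeta> \<otimes> inv x \<otimes> x = \<zeta> \<otimes> x" by (simp add: cj_def)
  then show ?thesis using x \<zeta>(4) by (simp add: m_assoc)
qed

section \<open>Lifts of unipotent matrices, Weyl elements and the torus\<close>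

lemma X_add: "X s \<otimes> X t = X (s + t)"
proof (rule X_eqI)
  show "X s \<otimes> X t \<in> VI" using X(1) subgroup.m_closed[OF VI(1)] by blast
  have "mob (umat (s + t)) = mob (umat s) \<circ> mob (umat t)"
    using mob_mult[of "umat t" "umat s"] by (simp add: add.commute)
  then show "rho (X s \<otimes> X t) = mob (umat (s + t))"
    by (simp only: rho_mult[OF X_closed X_closed] X)
qed

lemma X_0: "X 0 = \<one>"
proof -
  have "rho \<one> = mob (umat 0)"
    using mob_mat[of "1 :: 'f"] by (simp add: mat_eq_mat2)
  from X_eqI[OF subgroup.one_closed[OF VI(1)] this] show ?thesis ..
qed

lemma X_minus: "inv (X t) = X (- t)"
  using X_add[of "- t" t] X_0 by (intro inv_equality) simp_all

lemma act_X:
  assumes "A \<in> GL" "mob A None = None" "A ** umat s = umat t ** A"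
  shows "act A (X s) = X t"
proof (rule X_eqI)
  show "act A (X s) \<in> VI"
    using act_upper_VI[OF assms(1,2)] X(1) by blast
  show "rho (act A (X s)) = mob (umat t)"
    using rho_act[OF assms(1), of "X s"] mob_conjI[OF assms(1) _ assms(3)] by (simp add: X)
qed

text \<open>The sign occurs because \<open>wmat 1\<close> conjugates \<open>umat (- t)\<close> into
  \<open>lmat t\<close>.\<close>

definition Y :: "'f \<Rightarrow> 'f ^ 2 ^ 2" where "Y t = act (wmat 1) (X (- t))"

lemma Y: "Y t \<in> V (Some 0)" "rho (Y t) = mob (lmat t)" "Y t \<in> carrier G"
proof -
  have w: "wmat 1 \<in> (GL :: ('f ^ 2 ^ 2) set)" by simp
  have "mob (wmat 1) None = Some (0 :: 'f)" by (simp add: mob_def pt_def)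
  then show 1: "Y t \<in> V (Some 0)"
    using V_act_VI[OF w] X(1) by (auto simp: Y_def)
  then show "Y t \<in> carrier G" using V_carrier by blast
  show "rho (Y t) = mob (lmat t)"
    unfolding Y_def rho_act[OF w X_closed] X by (rule mob_conjI) simp_all
qed

lemma Y_eqI: "v \<in> V (Some 0) \<Longrightarrow> rho v = mob (lmat t) \<Longrightarrow> v = Y t"
  by (rule rho_inj_V[of v "Some 0" "Y t"]) (simp_all add: Y)

lemma Y_minus: "inv (Y t) = Y (- t)"
proof -
  have w: "wmat 1 \<in> (GL :: ('f ^ 2 ^ 2) set)" by simp
  show ?thesis
    using group_hom.hom_inv[OF act_group_hom[OF w], of "X (- t)"] X_minus[of "- t"] by (simp add: Y_def)
qed

lemma act_Y:
  assumes "A \<in> GL" "mob A (Some 0) = Some 0" "A ** lmat s = lmat t ** A"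
  shows "act A (Y s) = Y t"
proof (rule Y_eqI)
  show "act A (Y s) \<in> V (Some 0)"
    using imageI[OF Y(1), of "act A" s] by (simp only: V_act[OF assms(1)] assms(2))
  show "rho (act A (Y s)) = mob (lmat t)"
    using rho_act[OF assms(1) Y(3)] mob_conjI[OF assms(1) _ assms(3)] by (simp add: Y)
qed

text \<open>Steinberg's word for the Weyl element, evaluated at the lifts \<open>X\<close> and
  \<open>Y\<close> instead of the matrices.\<close>

definition W :: "'f \<Rightarrow> 'f ^ 2 ^ 2" where "W t = X t \<otimes> Y (- (1 / t)) \<otimes> X t"

lemma W_closed [simp]: "W t \<in> carrier G"
  by (simp add: W_def Y)

lemma rho_W:
  assumes t: "t \<noteq> 0"
  shows "rho (W t) = mob (wmat t)"
proof -
  have "rho (W t) = mob (umat t ** lmat (- (1 / t)) ** umat t)"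
    by (simp add: W_def rho_mult Y X mob_mult det_mul del: mat2_mult)
  also have "umat t ** lmat (- (1 / t)) ** umat t = wmat t"
    using t by simp
  finally show ?thesis .
qed

lemma W_minus: "inv (W t) = W (- t)"
  by (simp add: W_def inv_mult_group Y X_minus Y_minus m_assoc)

text \<open>The conjugate of \<open>X s\<close> and its expected value both lie in
  \<open>V (Some 0)\<close>, where \<open>rho\<close> is injective; the relation therefore lifts
  without a factor \<open>\<zeta>\<close>.\<close>

lemma W_X:
  assumes t: "t \<noteq> 0"
  shows "W t \<otimes> X s = Y (- (s / t\<^sup>2)) \<otimes> W t"
proof -
  have w: "wmat t \<in> GL" using t by simp
  have "cj (W t) (X s) = Y (- (s / t\<^sup>2))"
  proof (rule Y_eqI)
    have "mob (wmat t) None = Some 0" using t by (simp add: mob_def pt_def)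
    then show "cj (W t) (X s) \<in> V (Some 0)"
      using imageI[OF X(1), of "cj (W t)" s] rho_eq[OF W_closed, of t None]
      by (simp only: V_None rho_W[OF t])
    have inv: "rho (inv (W t)) = mob (matrix_inv (wmat t))"
    proof -
      have "rho (inv (W t)) = mob (matrix_inv (wmat t)) \<circ> mob (wmat t) \<circ> rho (inv (W t))"
        by (simp only: mob_inv(2)[OF w] id_comp)
      also have "\<dots> = mob (matrix_inv (wmat t)) \<circ> (rho (W t) \<circ> rho (inv (W t)))"
        by (simp only: rho_W[OF t] comp_assoc)
      finally show ?thesis
        by (simp only: rho_inv(1)[OF W_closed] comp_id)
    qed
    have "wmat t ** umat s = lmat (- (s / t\<^sup>2)) ** wmat t"
      using t by (simp add: power2_eq_square)
    then show "rho (cj (W t) (X s)) = mob (lmat (- (s / t\<^sup>2)))"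
      using mob_conjI[OF w, of "umat s"] by (simp add: cj_def rho_mult inv X rho_W[OF t])
  qed
  then have "W t \<otimes> X s \<otimes> inv (W t) \<otimes> W t = Y (- (s / t\<^sup>2)) \<otimes> W t"
    by (simp only: cj_def)
  then show ?thesis by (simp add: m_assoc)
qed

text \<open>Steinberg's torus element; the factor \<open>W (- 1)\<close> normalizes it to
  \<open>H 1 = \<one>\<close>.\<close>

definition H :: "'f \<Rightarrow> 'f ^ 2 ^ 2" where "H t = W t \<otimes> W (- 1)"

lemma H_closed [simp]: "H t \<in> carrier G"
  by (simp add: H_def)

lemma rho_H:
  assumes t: "t \<noteq> 0"
  shows "rho (H t) = mob (dmat t)"
proof -
  have "rho (H t) = mob (wmat t ** wmat (- 1))"
    using t by (simp add: H_def rho_mult rho_W mob_mult det_mul del: mat2_mult)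
  then show ?thesis using t by simp
qed

lemma H_X:
  assumes t: "t \<noteq> 0"
  shows "H t \<otimes> X s = X (t\<^sup>2 * s) \<otimes> H t"
proof -
  have w: "dmat t \<in> GL" using t by simp
  have "cj (H t) (X s) = X (t\<^sup>2 * s)"
  proof (rule X_eqI)
    have "mob (dmat t) None = None" using t by (simp add: mob_def pt_def)
    then show "cj (H t) (X s) \<in> VI"
      using imageI[OF X(1), of "cj (H t)" s] rho_eq[OF H_closed, of t None]
      by (simp only: V_None rho_H[OF t])
    have inv: "rho (inv (H t)) = mob (matrix_inv (dmat t))"
    proof -
      have "rho (inv (H t)) = mob (matrix_inv (dmat t)) \<circ> mob (dmat t) \<circ> rho (inv (H t))"
        by (simp only: mob_inv(2)[OF w] id_comp)
      also have "\<dots> = mob (matrix_inv (dmat t)) \<circ> (rho (H t) \<circ> rho (inv (H t)))"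
        by (simp only: rho_H[OF t] comp_assoc)
      finally show ?thesis
        by (simp only: rho_inv(1)[OF H_closed] comp_id)
    qed
    have "dmat t ** umat s = umat (t\<^sup>2 * s) ** dmat t"
      using t by (simp add: power2_eq_square)
    then show "rho (cj (H t) (X s)) = mob (umat (t\<^sup>2 * s))"
      using mob_conjI[OF w, of "umat s"] by (simp add: cj_def rho_mult inv X rho_H[OF t])
  qed
  then have "H t \<otimes> X s \<otimes> inv (H t) \<otimes> H t = X (t\<^sup>2 * s) \<otimes> H t"
    by (simp only: cj_def)
  then show ?thesis by (simp add: m_assoc)
qed

end


section \<open>The torus as a set of matrices and as a set of lifts\<close>

context odd_SL2
begin

definition T :: "('f ^ 2 ^ 2) set" where "T = dmat ` (- {0})"

lemma T_SL: "T \<subseteq> SL"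
  by (auto simp: T_def)

lemma dmat_T: "a \<noteq> 0 \<Longrightarrow> dmat a \<in> T"
  unfolding T_def by (rule imageI) simp

lemma TE:
  assumes "x \<in> T"
  obtains a where "a \<noteq> 0" "x = dmat a"
  using assms by (auto simp: T_def)

lemma act_smat_T:
  assumes "x \<in> T" "a \<noteq> 0"
  shows "act (smat a) x = x"
proof -
  obtain b where b: "b \<noteq> 0" "x = dmat b" by (rule TE[OF assms(1)])
  have "smat a \<in> GL" "dmat b \<in> SL" using assms(2) b(1) by simp_all
  from act_fixed_iff[OF this] show ?thesis
    by (simp add: b(2) mult.commute)
qed

text \<open>Elements of \<open>T\<close> are fixed by the diagonal \<open>smat a\<close>, so
  \<open>rho x\<close> commutes with \<open>mob (smat a)\<close>; for
  \<open>a * a \<noteq> 1\<close> this forces a diagonal map. If there is no such \<open>a\<close>,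
  then \<open>x\<close> is a scalar matrix and in the kernel.\<close>

lemma rho_T:
  assumes x: "x \<in> T"
  shows "rho x \<in> mob ` T"
proof -
  have xG: "x \<in> carrier G" using x T_SL carrier_SL by auto
  obtain A where A: "A \<in> SL" "rho x = mob A"
    using imageI[OF xG, of rho] by (auto simp only: ker_eq_and_image(2))
  obtain \<alpha> \<beta> \<gamma> \<delta> where A2: "A = mat2 \<alpha> \<beta> \<gamma> \<delta>" by (rule mat2_exhaust)
  have AG: "A \<in> GL" using A(1) by simp
  show ?thesis
  proof (cases "\<exists>a::'f. a \<noteq> 0 \<and> a * a \<noteq> 1")
    case True
    then obtain a :: 'f where a: "a \<noteq> 0" "a * a \<noteq> 1" by blast
    have sG: "smat a \<in> GL" using a by simp
    have "mob A \<circ> mob (smat a) = mob (smat a) \<circ> mob A"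
      using rho_act_mob[OF sG xG] act_smat_T[OF x a(1)] A(2) by simp
    then have "mob (A ** smat a) = mob (smat a ** A)"
      by (simp only: mob_mult[OF sG] mob_mult[OF AG])
    then obtain k where k: "A ** smat a = mat k ** (smat a ** A)"
      using mob_eq_iff[OF GL_mult[OF AG sG] GL_mult[OF sG AG]] by blast
    then have e: "\<alpha> * a = k * (a * \<alpha>)" "\<beta> = k * (a * \<beta>)" "\<gamma> * a = k * \<gamma>" "\<delta> = k * \<delta>"
      by (simp_all add: A2 mat_eq_mat2)
    \<comment> \<open>An antidiagonal \<open>A\<close> commutes with \<open>smat a\<close> up to a
      scalar only if \<open>a * a = 1\<close>.\<close>
    have "\<alpha> \<noteq> 0"
    proof
      assume "\<alpha> = 0"
      then have "\<beta> \<noteq> 0" "\<gamma> \<noteq> 0" using A(1) by (auto simp: A2)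
      then have "k = a" "k * a = 1" using e(2,3) by (auto simp: mult.commute)
      then show False using a(2) by simp
    qed
    then have "k = 1" using e(1) a(1) by (simp add: mult.commute)
    moreover have "a \<noteq> 1" using a(2) by auto
    ultimately have bc: "\<beta> = 0" "\<gamma> = 0"
      using e(2,3) by auto
    have "\<alpha> * \<delta> = 1" using A(1) by (simp add: A2 bc)
    then have "\<delta> = 1 / \<alpha>" using \<open>\<alpha> \<noteq> 0\<close> by (simp add: nonzero_eq_divide_eq mult.commute)
    then have "A \<in> T" using dmat_T[OF \<open>\<alpha> \<noteq> 0\<close>] by (simp add: A2 bc)
    then show ?thesis using A(2) by simp
  next
    case False
    obtain b where b: "b \<noteq> 0" "x = dmat b" by (rule TE[OF x])
    then have "b * b = 1" using False by blast
    then have "1 / b = b" using b(1) by (simp add: field_simps)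
    then have xb: "x = mat b" by (simp add: b(2) mat_eq_mat2)
    have "x \<in> SL" using x T_SL by blast
    then have "x \<in> ker"
      by (intro fixed_imp_ker[OF xG]) (simp only: xb mat_fixed)
    then have "rho x = mob (dmat 1)"
      using mob_mat[of "1 :: 'f"] by (simp add: ker_def mat_eq_mat2)
    moreover have "dmat 1 \<in> T" by (rule dmat_T) simp
    ultimately show ?thesis by blast
  qed
qed

text \<open>The two-to-one maps \<open>mob\<close> on \<open>T\<close> and \<open>rho\<close> on the preimage of \<open>mob ` T\<close> have the same image,
  so \<open>T\<close> is the whole preimage.\<close>

lemma rho_in_mob_T:
  assumes "x \<in> carrier G" "rho x \<in> mob ` T"
  shows "x \<in> T"
proof -
  define P where "P = {x \<in> carrier G. rho x \<in> mob ` T}"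
  have fP: "finite P" using fin by (simp add: P_def)
  have TP: "T \<subseteq> P" using T_SL rho_T carrier_SL by (auto simp: P_def)
  have "rho ` P = mob ` T"
  proof
    show "mob ` T \<subseteq> rho ` P"
    proof
      fix f assume f: "f \<in> mob ` T"
      then have "f \<in> mob ` SL" using T_SL by blast
      then have "f \<in> rho ` carrier G" by (simp only: ker_eq_and_image(2))
      then obtain y where "y \<in> carrier G" "f = rho y" by (rule imageE)
      then show "f \<in> rho ` P" using f by (simp add: P_def)
    qed
  qed (auto simp: P_def)
  moreover have "card {x \<in> P. rho x = f} = 2" if "f \<in> rho ` P" for f
  proof -
    obtain y where y: "y \<in> P" "f = rho y" using \<open>f \<in> rho ` P\<close> by (rule imageE)
    then have "{x \<in> P. rho x = f} = {x \<in> carrier G. rho x = rho y}"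
      by (auto simp: P_def)
    then show ?thesis
      using card_rho_fibre[of y] y(1) mat_ne by (simp add: P_def ker_eq_and_image(1))
  qed
  ultimately have cP: "card P = 2 * card (mob ` T)"
    using card_fibres[OF fP, of rho 2] by simp
  have "card {x \<in> T. mob x = f} = 2" if "f \<in> mob ` T" for f
  proof -
    obtain y where y: "y \<in> T" "f = mob y" using \<open>f \<in> mob ` T\<close> by (rule imageE)
    obtain b where b: "b \<noteq> 0" "y = dmat b" by (rule TE[OF y(1)])
    have "{x \<in> T. mob x = f} = {dmat b, dmat (- b)}"
    proof (intro equalityI subsetI)
      fix x assume "x \<in> {x \<in> T. mob x = f}"
      then have x: "x \<in> T" "mob x = mob (dmat b)" using y b by auto
      obtain a where a: "a \<noteq> 0" "x = dmat a" by (rule TE[OF x(1)])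
      have "dmat a \<in> GL" "dmat b \<in> GL" using a b by simp_all
      from mob_eq_iff[OF this] obtain k where "dmat a = mat k ** dmat b"
        using x(2) a(2) by blast
      then have k: "a = k * b" "1 / a = k * (1 / b)" by (auto simp: mat_eq_mat2)
      then have "(k * k) * (b * (1 / b)) = a * (1 / a)" by simp
      then have "k * k = 1" using a(1) b(1) by simp
      then have "k = 1 \<or> k = - 1" by (simp add: square_eq_1_iff)
      then show "x \<in> {dmat b, dmat (- b)}" using k(1) a(2) by auto
    next
      fix x assume "x \<in> {dmat b, dmat (- b)}"
      moreover have "mob (dmat (- b)) = mob (dmat b)"
      proof -
        have "dmat (- b) = mat (- 1) ** dmat b" by (simp add: mat_eq_mat2)
        moreover have "dmat b \<in> GL" using b by simp
        ultimately show ?thesis using mob_mult[of "dmat b" "mat (- 1)"] by simp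
      qed
      moreover have "dmat b \<in> T" "dmat (- b) \<in> T"
        using b(1) by (simp_all only: dmat_T neg_equal_0_iff_equal not_False_eq_True)
      ultimately show "x \<in> {x \<in> T. mob x = f}"
        using y(2) b(2) by auto
    qed
    moreover have "dmat b \<noteq> dmat (- b)" using neg_eq_self[of b] b(1) by simp
    ultimately show ?thesis by simp
  qed
  then have "card T = 2 * card (mob ` T)"
    by (intro card_fibres) simp_all
  then have "T = P"
    using cP by (intro card_subset_eq[OF fP TP]) simp
  moreover have "x \<in> P" using assms by (simp add: P_def)
  ultimately show ?thesis by blast
qed

lemma H_T:
  assumes t: "t \<noteq> 0"
  shows "H t \<in> T"
  by (rule rho_in_mob_T[OF H_closed]) (simp only: rho_H[OF t] imageI[OF dmat_T[OF t]])

lemma act_smat_W: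
  assumes a: "a \<noteq> 0" and t: "t \<noteq> 0"
  shows "act (smat a) (W t) = W (a * t)"
proof -
  have s: "smat a \<in> GL" using a by simp
  have "act (smat a) (X t) = X (a * t)"
    by (rule act_X[OF s]) (simp_all add: mob_def pt_def)
  moreover have "act (smat a) (Y (- (1 / t))) = Y (- (1 / (a * t)))"
    by (rule act_Y[OF s]) (use a in \<open>simp_all add: mob_def pt_def\<close>)
  ultimately show ?thesis
    by (simp add: W_def act_hom[OF s] Y)
qed

lemma W_cancel: "W (- t) \<otimes> W t = \<one>" "W t \<otimes> W (- t) = \<one>"
  using W_minus[of t] l_inv[of "W t"] r_inv[of "W t"] by simp_all

text \<open>\<open>H t\<close> is fixed by \<open>smat a\<close> while its factors are rescaled, so
  it also equals \<open>W (a * t) \<otimes> W (- a)\<close>; against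
  \<open>H a = W a \<otimes> W (- 1)\<close> the inner factors cancel.\<close>

lemma H_mult:
  assumes a: "a \<noteq> 0" and t: "t \<noteq> 0"
  shows "H t \<otimes> H a = H (a * t)"
proof -
  have s: "smat a \<in> GL" using a by simp
  have "H t = act (smat a) (H t)"
    using act_smat_T[OF H_T[OF t] a] by simp
  also have "\<dots> = W (a * t) \<otimes> W (- a)"
    using act_smat_W[OF a t] act_smat_W[OF a, of "- 1"] by (simp add: H_def act_hom[OF s])
  finally have "H t \<otimes> H a = W (a * t) \<otimes> (W (- a) \<otimes> W a) \<otimes> W (- 1)"
    by (simp add: H_def[of a] m_assoc)
  then show ?thesis
    by (simp add: W_cancel H_def)
qed

lemma H_1: "H 1 = \<one>"
  by (simp add: H_def W_cancel)

text \<open>This decides between the possible double covers of \<open>PSL2\<close>. If the square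
  were neutral, \<open>W 1\<close> would equal \<open>W (- 1)\<close> and be fixed by
  \<open>smat (- 1)\<close>, hence be a diagonal matrix and an element of \<open>T\<close>; but then
  \<open>rho (W 1)\<close> would fix infinity, whereas it sends infinity to 0.\<close>

lemma W_1_sq: "W 1 \<otimes> W 1 = \<zeta>"
proof -
  have "W 1 \<noteq> W (- 1)"
  proof
    assume eq: "W 1 = W (- 1)"
    have s: "smat (- 1 :: 'f) \<in> GL" by simp
    have W: "W 1 \<in> SL" using W_closed[of 1] by (simp only: carrier_SL)
    have "act (smat (- 1)) (W 1) = W 1"
      using act_smat_W[of "- 1" 1] eq by simp
    then have comm: "smat (- 1) ** W 1 = W 1 ** smat (- 1)"
      using act_fixed_iff[OF s W] by blast
    obtain a b c d where W2: "W 1 = mat2 a b c d" by (rule mat2_exhaust)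
    have bc: "b = 0" "c = 0"
      using comm neg_eq_self[of b] neg_eq_self[of c] by (auto simp: W2)
    then have ad: "a * d = 1" using W by (simp add: W2)
    then have a: "a \<noteq> 0" by auto
    have "d = 1 / a" using ad by (simp add: nonzero_eq_divide_eq[OF a] mult.commute)
    then have "W 1 \<in> T"
      using dmat_T[OF a] by (simp add: W2 bc)
    then obtain e where e: "e \<noteq> 0" "rho (W 1) = mob (dmat e)"
      using rho_T by (auto simp: T_def)
    have "mob (wmat 1) None = mob (dmat e) None"
      using e(2) by (simp add: rho_W)
    then show False using e(1) by (simp add: mob_def pt_def)
  qed
  then have "W 1 \<otimes> W 1 \<noteq> \<one>"
    using W_minus[of 1] inv_equality[of "W 1" "W 1"] by auto
  moreover have "rho (W 1 \<otimes> W 1) = mob (wmat 1 ** wmat 1)"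
    by (simp add: rho_mult rho_W mob_mult del: mat2_mult)
  then have "rho (W 1 \<otimes> W 1) = id"
    using mob_mat[of "- 1 :: 'f"] by (simp add: mat_eq_mat2)
  then have "W 1 \<otimes> W 1 \<in> ker" by (simp add: ker_def)
  ultimately show ?thesis using \<zeta>(3) by blast
qed

lemma H_minus_1: "H (- 1) = \<zeta>"
proof -
  have "H (- 1) = inv (W 1 \<otimes> W 1)"
    by (simp add: H_def inv_mult_group W_minus)
  also have "\<dots> = \<zeta>"
    unfolding W_1_sq using inv_equality[OF \<zeta>_sq \<zeta>(4) \<zeta>(4)] .
  finally show ?thesis .
qed

lemma H_minus: "t \<noteq> 0 \<Longrightarrow> H (- t) = \<zeta> \<otimes> H t"
  using H_mult[of t "- 1"] by (simp add: H_minus_1)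

lemma W_eq_H: "W t = H t \<otimes> W 1"
  using W_cancel(1)[of 1] by (simp add: H_def m_assoc)

text \<open>The Weyl element inverts the torus. The factor \<open>\<zeta>\<close> contained in
  \<open>W (- a)\<close> cancels against the one from the square of \<open>W 1\<close>.\<close>

lemma W_1_H:
  assumes a: "a \<noteq> 0"
  shows "W 1 \<otimes> H a = H (1 / a) \<otimes> W 1"
proof -
  have "H a \<otimes> (W 1 \<otimes> W (- a)) = W a \<otimes> (W (- 1) \<otimes> W 1) \<otimes> W (- a)"
    by (simp add: H_def m_assoc)
  also have "\<dots> = \<one>" by (simp add: W_cancel)
  finally have "H (1 / a) \<otimes> (H a \<otimes> (W 1 \<otimes> W (- a))) = H (1 / a)" by simp
  then have "H (1 / a) \<otimes> H a \<otimes> (W 1 \<otimes> W (- a)) = H (1 / a)" by (simp add: m_assoc)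
  then have "W 1 \<otimes> W (- a) = H (1 / a)"
    using H_mult[of a "1 / a"] a by (simp add: H_1)
  also have "W (- a) = \<zeta> \<otimes> H a \<otimes> W 1"
    by (simp add: W_eq_H[of "- a"] H_minus[OF a])
  finally have "H (1 / a) = W 1 \<otimes> (\<zeta> \<otimes> H a \<otimes> W 1)" ..
  then have "H (1 / a) \<otimes> W 1 = W 1 \<otimes> (\<zeta> \<otimes> H a) \<otimes> (W 1 \<otimes> W 1)"
    by (simp add: m_assoc \<zeta>(4))
  also have "\<dots> = W 1 \<otimes> H a \<otimes> (\<zeta> \<otimes> \<zeta>)"
    unfolding W_1_sq \<zeta>_central[OF H_closed, symmetric] by (simp add: m_assoc \<zeta>(4))
  finally show ?thesis
    by (simp add: \<zeta>_sq)
qed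

lemma W_1_W:
  assumes c: "c \<noteq> 0"
  shows "W 1 \<otimes> W (- (1 / c)) = H c"
proof -
  have "W 1 \<otimes> W (- (1 / c)) = W 1 \<otimes> H (- (1 / c)) \<otimes> W 1"
    by (subst W_eq_H) (simp add: m_assoc)
  also have "\<dots> = H (- c) \<otimes> (W 1 \<otimes> W 1)"
    using W_1_H[of "- (1 / c)"] c by (simp add: m_assoc)
  also have "\<dots> = H c \<otimes> (\<zeta> \<otimes> \<zeta>)"
    unfolding W_1_sq H_minus[OF c] \<zeta>_central[OF H_closed, symmetric] by (simp add: m_assoc \<zeta>(4))
  finally show ?thesis by (simp add: \<zeta>_sq)
qed

section \<open>Bruhat normal form and the isomorphism\<close>

lemma Y_eq: "t \<noteq> 0 \<Longrightarrow> Y (- t) = X (- (1 / t)) \<otimes> W (1 / t) \<otimes> X (- (1 / t))"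
proof -
  assume t: "t \<noteq> 0"
  have "X (- (1 / t)) \<otimes> W (1 / t) \<otimes> X (- (1 / t)) =
      (X (- (1 / t)) \<otimes> X (1 / t)) \<otimes> Y (- t) \<otimes> (X (1 / t) \<otimes> X (- (1 / t)))"
    using t by (simp add: W_def m_assoc Y)
  then show ?thesis by (simp add: X_add X_0 Y)
qed

text \<open>Bruhat normal form with every matrix replaced by its lift:
  \<open>umat (a * b) ** dmat a\<close> for \<open>c = 0\<close>, and
  \<open>umat (a / c) ** wmat (- (1 / c)) ** umat (d / c)\<close> otherwise.\<close>

definition F :: "'f ^ 2 ^ 2 \<Rightarrow> 'f ^ 2 ^ 2" where
  "F A = (let a = A $ 1 $ 1; b = A $ 1 $ 2; c = A $ 2 $ 1; d = A $ 2 $ 2 in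
     if c = 0 then X (a * b) \<otimes> H a else X (a / c) \<otimes> W (- (1 / c)) \<otimes> X (d / c))"

lemma F_mat2:
  "F (mat2 a b c d) = (if c = 0 then X (a * b) \<otimes> H a else X (a / c) \<otimes> W (- (1 / c)) \<otimes> X (d / c))"
  by (simp add: F_def)

lemma F_closed [simp]: "F A \<in> carrier G"
  by (simp add: F_def Let_def)

lemma F_umat:
  assumes A: "A \<in> SL"
  shows "F (umat s ** A) = X s \<otimes> F A"
proof -
  obtain a b c d where A2: "A = mat2 a b c d" by (rule mat2_exhaust)
  show ?thesis
  proof (cases "c = 0")
    case True
    then have "a * d = 1" using A by (simp add: A2)
    then have "a * (b + s * d) = s + a * b" by (simp add: distrib_left mult.left_commute)
    then show ?thesis
      using True by (simp add: A2 F_mat2 X_add m_assoc[symmetric])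
  next
    case False
    then have "(a + s * c) / c = s + a / c" by (simp add: field_simps)
    then show ?thesis
      using False by (simp add: A2 F_mat2 X_add m_assoc[symmetric])
  qed
qed

text \<open>Left multiplication by the Weyl element either exchanges the cells or stays in the big
  one. The latter case rests on \<open>Y_eq\<close>, the others on the torus relations.\<close>

lemma F_wmat:
  assumes A: "A \<in> SL"
  shows "F (wmat 1 ** A) = W 1 \<otimes> F A"
proof -
  obtain a b c d where A2: "A = mat2 a b c d" by (rule mat2_exhaust)
  have det: "a * d - b * c = 1" using A by (simp add: A2)
  have wA: "wmat 1 ** A = mat2 c d (- a) (- b)" by (simp add: A2)
  show ?thesis
  proof (cases "c = 0")
    case True
    then have a: "a \<noteq> 0" using det by auto
    have "a\<^sup>2 * (b / a) = a * b" using a by (simp add: power2_eq_square)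
    then have "W 1 \<otimes> F A = (W 1 \<otimes> H a) \<otimes> X (b / a)"
      using H_X[OF a, of "b / a"] by (simp add: A2 F_mat2 True m_assoc)
    also have "\<dots> = W (1 / a) \<otimes> X (b / a)"
      by (simp only: W_1_H[OF a] W_eq_H[of "1 / a", symmetric])
    finally show ?thesis
      unfolding wA using a by (simp add: F_mat2 True X_0)
  next
    case c: False
    show ?thesis
    proof (cases "a = 0")
      case True
      have "c * d = c\<^sup>2 * (d / c)" using c by (simp add: power2_eq_square)
      then have "X (c * d) \<otimes> H c = H c \<otimes> X (d / c)"
        using H_X[OF c, of "d / c"] by simp
      also have "\<dots> = W 1 \<otimes> W (- (1 / c)) \<otimes> X (d / c)"
        by (simp only: W_1_W[OF c])
      finally show ?thesis
        unfolding wA unfolding A2 using c True by (simp add: F_mat2 X_0 m_assoc)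
    next
      case a: False
      \<comment> \<open>\<open>W 1\<close> turns \<open>X t\<close> into \<open>Y (- t)\<close>, and
        \<open>Y_eq\<close> writes this again with a Weyl element in the middle.\<close>
      define t where "t = a / c"
      have t: "t \<noteq> 0" using a c by (simp add: t_def)
      have "W 1 \<otimes> F A = (W 1 \<otimes> X t) \<otimes> W (- (1 / c)) \<otimes> X (d / c)"
        using c by (simp add: A2 F_mat2 t_def m_assoc)
      also have "W 1 \<otimes> X t = Y (- t) \<otimes> W 1"
        using W_X[of 1 t] by simp
      also have "Y (- t) \<otimes> W 1 \<otimes> W (- (1 / c)) \<otimes> X (d / c) = Y (- t) \<otimes> H c \<otimes> X (d / c)"
        using W_1_W[OF c] by (simp add: m_assoc Y)
      also have "\<dots> = X (- (1 / t)) \<otimes> W (1 / t) \<otimes> (X (- (1 / t)) \<otimes> H c) \<otimes> X (d / c)"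
        by (simp add: Y_eq[OF t] m_assoc)
      also have "X (- (1 / t)) \<otimes> H c = H c \<otimes> X (- (1 / (t * c\<^sup>2)))"
        using H_X[OF c, of "- (1 / (t * c\<^sup>2))"] c by simp
      also have "X (- (1 / t)) \<otimes> W (1 / t) \<otimes> (H c \<otimes> X (- (1 / (t * c\<^sup>2)))) \<otimes> X (d / c) =
          X (- (1 / t)) \<otimes> (W (1 / t) \<otimes> H c) \<otimes> (X (- (1 / (t * c\<^sup>2))) \<otimes> X (d / c))"
        by (simp add: m_assoc)
      also have "W (1 / t) \<otimes> H c = W (1 / a)"
      proof -
        have "W (1 / t) \<otimes> H c = H (1 / t) \<otimes> (W 1 \<otimes> H c)"
          by (subst W_eq_H) (simp add: m_assoc)
        also have "\<dots> = (H (1 / t) \<otimes> H (1 / c)) \<otimes> W 1"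
          by (simp add: W_1_H[OF c] m_assoc)
        also have "H (1 / t) \<otimes> H (1 / c) = H (1 / a)"
          using H_mult[of "1 / c" "1 / t"] a c by (simp add: t_def)
        finally show ?thesis by (simp only: W_eq_H[of "1 / a", symmetric])
      qed
      also have "X (- (1 / (t * c\<^sup>2))) \<otimes> X (d / c) = X (b / a)"
      proof -
        have "- (1 / (t * c\<^sup>2)) + d / c = (a * d - 1) / (a * c)"
          using a c by (simp add: t_def field_simps power2_eq_square)
        also have "a * d - 1 = b * c" using det by (simp add: algebra_simps)
        finally show ?thesis using c by (simp add: X_add)
      qed
      also have "- (1 / t) = - (c / a)" by (simp add: t_def)
      finally show ?thesis
        unfolding wA using a by (simp add: F_mat2)
    qed
  qed
qed

lemma F_one: "F (mat 1) = \<one>"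
  by (simp add: mat_eq_mat2 F_mat2 X_0 H_1)

text \<open>The matrices that \<open>F\<close> multiplies correctly from the left are closed under
  products, and \<open>F_umat\<close> and \<open>F_wmat\<close> put generators of \<open>SL\<close>
  among them.\<close>

lemma F_mult:
  assumes "A \<in> SL" "B \<in> SL"
  shows "F (A ** B) = F A \<otimes> F B"
proof -
  define M where "M = {A \<in> SL. \<forall>B\<in>SL. F (A ** B) = F A \<otimes> F B}"
  have mult: "A ** A' \<in> M" if "A \<in> M" "A' \<in> M" for A A'
    using that by (simp add: M_def SL_mult[simplified] matrix_mul_assoc[symmetric] m_assoc)
  have u: "umat s \<in> M" for s
    using F_umat F_umat[of "mat 1" s] mat_pm1_SL(1) by (simp add: M_def F_one matrix_mul_rid)
  have w: "wmat 1 \<in> M"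
    using F_wmat F_wmat[of "mat 1"] mat_pm1_SL(1) by (simp add: M_def F_one matrix_mul_rid)
  have l: "lmat t \<in> M" for t
  proof -
    \<comment> \<open>The cube of \<open>wmat 1\<close> is its inverse, as its fourth power is
      1.\<close>
    have "wmat 1 ** umat (- t) ** (wmat 1 ** (wmat 1 ** wmat 1)) \<in> M"
      by (intro mult u w)
    then show ?thesis by simp
  qed
  have ne: "mat2 a b c d \<in> M" if "a * d - b * c = 1" "c \<noteq> 0" for a b c d
    unfolding SL_factor[OF that] by (intro mult u l)
  have "A \<in> M"
  proof -
    obtain a b c d where A2: "A = mat2 a b c d" by (rule mat2_exhaust)
    show ?thesis
    proof (cases "c = 0")
      case False
      then show ?thesis using assms(1) ne by (simp add: A2)
    next
      case True
      then have ad: "a * d = 1" using assms(1) by (simp add: A2)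
      have "lmat (- 1) ** mat2 a b a (b + d) \<in> M"
        by (intro mult l ne) (use ad in \<open>auto simp: algebra_simps\<close>)
      then show ?thesis by (simp add: A2 True)
    qed
  qed
  then show ?thesis using assms(2) by (simp add: M_def)
qed

lemma rho_F:
  assumes "A \<in> SL"
  shows "rho (F A) = mob A"
proof -
  obtain a b c d where A2: "A = mat2 a b c d" by (rule mat2_exhaust)
  have det: "a * d - b * c = 1" using assms by (simp add: A2)
  show ?thesis
  proof (cases "c = 0")
    case True
    then have ad: "a * d = 1" "a \<noteq> 0" using det by auto
    then have "d = 1 / a" by (simp add: nonzero_eq_divide_eq mult.commute)
    have "rho (F A) = mob (umat (a * b) ** dmat a)"
      using ad by (simp add: A2 F_mat2 True rho_mult X rho_H mob_mult del: mat2_mult)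
    also have "umat (a * b) ** dmat a = A"
      using ad(2) by (simp add: A2 True \<open>d = 1 / a\<close>)
    finally show ?thesis .
  next
    case c: False
    have "rho (F A) = mob (umat (a / c) ** wmat (- (1 / c)) ** umat (d / c))"
      using c by (simp add: A2 F_mat2 rho_mult X rho_W mob_mult det_mul del: mat2_mult)
    also have "umat (a / c) ** wmat (- (1 / c)) ** umat (d / c) = A"
    proof -
      have "b = (a * d - 1) / c"
        using det c nonzero_eq_divide_eq[OF c, of b "a * d - 1"] by (simp add: algebra_simps)
      then show ?thesis using c by (simp add: A2 diff_divide_distrib)
    qed
    finally show ?thesis .
  qed
qed

text \<open>By \<open>rho_F\<close> two matrices with the same image differ at most by a sign, and
  \<open>F\<close> sends \<open>mat (- 1)\<close> to \<open>\<zeta>\<close>, which is not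
  neutral.\<close>

lemma F_iso: "F \<in> iso SL2 G"
proof -
  have "inj_on F SL"
  proof
    fix A B :: "'f ^ 2 ^ 2" assume A: "A \<in> SL" and B: "B \<in> SL" and eq: "F A = F B"
    have "mob A = mob B" using rho_F[OF A] rho_F[OF B] eq by simp
    then obtain k where k: "A = mat k ** B"
      using mob_eq_iff[of A B] A B by auto
    have "k * k = 1" using A B by (simp add: k det_mul mat_eq_mat2)
    then have "k = 1 \<or> k = - 1" by (simp add: square_eq_1_iff)
    then show "A = B"
    proof
      assume "k = - 1"
      then have "F A = F (mat (- 1)) \<otimes> F B"
        using F_mult[OF mat_pm1_SL(2) B] k by simp
      also have "F (mat (- 1)) = \<zeta>"
        by (simp add: mat_eq_mat2 F_mat2 X_0 H_minus_1 \<zeta>(4))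
      finally have "F B = \<zeta> \<otimes> F B" unfolding eq .
      from this[symmetric] have "\<zeta> = \<one>"
        by (rule r_cancel_one[OF F_closed \<zeta>(4), THEN iffD1])
      then show ?thesis using \<zeta>(2) by blast
    qed (simp add: k matrix_mul_lid)
  qed
  moreover from this have "F ` SL = SL"
  proof (rule card_subset_eq[rotated 2, OF card_image])
    show "F ` SL \<subseteq> SL" using F_closed by (auto simp: carrier_SL)
  qed simp
  moreover have "F \<in> SL \<rightarrow> SL"
    using F_closed by (auto simp: carrier_SL)
  ultimately show ?thesis
    using F_mult by (simp add: iso_def hom_def bij_betw_def SL2_def carrier_SL)
qed

end


section \<open>The competitors of the special linear group, and the theorem\<close>

lemma SL2_odd_rigid:
  assumes prime: "prime (CARD('f::{field,finite}))" and odd: "odd (CARD('f))"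
  shows "group_rigid (SL2 :: ('f ^ 2 ^ 2) monoid)"
proof -
  let ?p = "CARD('f)" and ?G = "SL2 :: ('f ^ 2 ^ 2) monoid"
  have car: "carrier ?G = SL" and mul: "A \<otimes>\<^bsub>?G\<^esub> B = A ** B" for A B
    by (simp_all add: SL2_def)
  interpret g: group ?G by (rule matrix_group_SL2)
  interpret m: matrix_group ?G SL id ?p
  proof
    show "\<not> ?p\<^sup>2 dvd order ?G"
      using not_sq_dvd_card_SL[OF prime] by (simp only: order_def car not_False_eq_True)
    show "\<exists>k. k \<noteq> 0 \<and> A = mat k ** B" if "id A = id B" for A B :: "'f ^ 2 ^ 2"
      using that by (intro exI[of _ 1]) (simp add: matrix_mul_lid)
  qed (simp_all add: prime car mul)
  have act: "m.act A B = A ** B ** matrix_inv A" if "A \<in> GL" "B \<in> SL" for A B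
    using m.act_q[OF that] by simp
  have fixed: "B \<in> fixed (carrier ?G) (m.act A) \<longleftrightarrow> B \<in> SL \<and> A ** B = B ** A" if A: "A \<in> GL" for A B
    using act[OF A] conj_eq_iff[OF A, of B] by (auto simp: fixed_def car)
  have ne: "(1 :: 'f) \<noteq> - 1"
  proof
    assume "(1 :: 'f) = - 1"
    then have "(1 :: 'f) + 1 = - 1 + 1" by (rule arg_cong[where f = "\<lambda>y. y + 1"])
    then show False using odd_card_two_nonzero[OF odd] by simp
  qed
  \<comment> \<open>Both signs of the identity matrix are fixed by \<open>umat 1\<close> and by
    \<open>lmat 1\<close>, so \<open>card_fixed2\<close> calls for \<open>p > 2\<close>.\<close>
  have ge3: "?p > 2"
    using prime_ge_2_nat[OF prime] odd by (cases "?p = 2") auto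
  let ?C = "fixed (carrier ?G) (m.act (umat 1))"
  \<comment> \<open>The sign doubles the centralizer of a unipotent matrix, in contrast to the
    quotients by scalars.\<close>
  have C: "?C = (\<lambda>(s, t). mat2 s t 0 s) ` ({1, - 1} \<times> UNIV)"
  proof (intro equalityI subsetI)
    fix B assume "B \<in> ?C"
    then have B: "B \<in> SL" "umat 1 ** B = B ** umat 1" using fixed[of "umat 1" B] by auto
    obtain a b c d where B2: "B = mat2 a b c d" by (rule mat2_exhaust)
    have cd: "c = 0" "d = a"
      using B(2) by (auto simp: B2)
    then have "a * a = 1" using B(1) by (simp add: B2)
    then have "a = 1 \<or> a = - 1" by (simp add: square_eq_1_iff)
    then show "B \<in> (\<lambda>(s, t). mat2 s t 0 s) ` ({1, - 1} \<times> UNIV)"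
      by (intro image_eqI[of _ _ "(a, b)"]) (auto simp: B2 cd)
  next
    fix B assume "B \<in> (\<lambda>(s, t). mat2 s t 0 s) ` ({1, - 1 :: 'f} \<times> UNIV)"
    then obtain s t where "B = mat2 s t 0 s" "s = 1 \<or> s = - 1" by auto
    then show "B \<in> ?C"
      using fixed[of "umat 1" B] by (auto simp: add.commute)
  qed
  have c1: "card ?C = 2 * ?p"
  proof -
    have "inj_on (\<lambda>(s, t). mat2 s t 0 s) ({1, - 1 :: 'f} \<times> UNIV)"
      by (auto simp: inj_on_def)
    then show ?thesis
      unfolding C by (simp only: card_image card_cartesian_product) (use ne in simp)
  qed
  have "?C \<inter> fixed (carrier ?G) (m.act (lmat 1)) \<subseteq> {mat 1, mat (- 1)}"
  proof
    fix B assume "B \<in> ?C \<inter> fixed (carrier ?G) (m.act (lmat 1))"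
    then have B: "B \<in> ?C" "lmat 1 ** B = B ** lmat 1"
      using fixed[of "lmat 1" B] by auto
    then obtain s t where st: "B = mat2 s t 0 s" "s = 1 \<or> s = - 1" by (auto simp: C)
    moreover have "t = 0" using B(2) by (simp add: st(1))
    ultimately show "B \<in> {mat 1, mat (- 1)}" by (auto simp: mat_eq_mat2)
  qed
  from card_mono[OF _ this] have
    "card (?C \<inter> fixed (carrier ?G) (m.act (lmat 1))) \<le> card {mat 1, mat (- 1) :: 'f ^ 2 ^ 2}"
    by simp
  also have "\<dots> \<le> 2" by (simp add: card_insert_if)
  finally have c2: "card (?C \<inter> fixed (carrier ?G) (m.act (lmat 1))) < ?p"
    using ge3 by simp
  show ?thesis
    unfolding group_rigid_def
  proof (intro allI impI)
    fix \<Lambda> :: "('f ^ 2 ^ 2) monoid"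
    assume "group \<Lambda> \<and> carrier \<Lambda> = carrier ?G \<and> auto ?G \<subseteq> auto \<Lambda>"
    then have L: "group \<Lambda>" "carrier \<Lambda> = carrier ?G" "auto ?G \<subseteq> auto \<Lambda>" by auto
    interpret L: GL2_action \<Lambda> m.act ?p
      by (rule m.competitor_GL2_action[OF L disjI2[OF conjI[OF c1 odd]] c2])
    interpret O: odd_SL2 \<Lambda> m.act ?p
      by unfold_locales (simp_all only: L(2) car act odd not_False_eq_True)
    show "?G \<cong> \<Lambda>"
      using O.F_iso by (rule is_isoI)
  qed
qed

lemma SL2_two_rigid:
  assumes two: "CARD('f::{field,finite}) = 2"
  shows "group_rigid (SL2 :: ('f ^ 2 ^ 2) monoid)"
proof -
  have one: "k = 1" if "k \<noteq> 0" for k :: 'f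
  proof (rule ccontr)
    assume "k \<noteq> 1"
    then have "card {0, 1, k} = 3" using that by simp
    moreover have "card {0, 1, k} \<le> CARD('f)" by (intro card_mono) auto
    ultimately show False using two by simp
  qed
  have car: "carrier (SL2 :: ('f ^ 2 ^ 2) monoid) = SL"
    by (simp add: SL2_def)
  have prime: "prime (CARD('f))" by (simp only: two two_is_prime_nat)
  show ?thesis
  proof (rule quotient_group_rigid[OF matrix_group_SL2 prime disjI2[OF refl], of id])
    show "id A = id B \<longleftrightarrow> (\<exists>k. k \<noteq> 0 \<and> A = mat k ** B)" for A B :: "'f ^ 2 ^ 2"
    proof
      assume "id A = id B"
      then show "\<exists>k. k \<noteq> 0 \<and> A = mat k ** B"
        by (intro exI[of _ 1]) (simp add: matrix_mul_lid)
    next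
      assume "\<exists>k. k \<noteq> 0 \<and> A = mat k ** B"
      then obtain k where "k \<noteq> 0" "A = mat k ** B" by blast
      then show "id A = id B" using one[of k] by (simp add: matrix_mul_lid)
    qed
  qed (simp_all add: SL2_def)
qed

theorem theorem3p8:
  fixes p :: nat
  assumes "prime p" and "CARD('f::{field,finite}) = p"
  shows "rigid_relative_to_Aut TYPE('j) (SL2 :: ('f ^ 2 ^ 2) monoid)
       \<and> rigid_relative_to_Aut TYPE('j) (PSL2 :: ('f ^ 2 ^ 2) set monoid)
       \<and> rigid_relative_to_Aut TYPE('j) (PGL2 :: ('f ^ 2 ^ 2) set monoid)"
proof (intro conjI)
  have prime: "prime (CARD('f))" using assms by simp
  have SL2: "(SL2 :: ('f ^ 2 ^ 2) monoid) = \<lparr>carrier = SL, mult = (**), one = mat 1\<rparr>"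
    by (simp add: SL2_def)
  have GL2: "(GL2 :: ('f ^ 2 ^ 2) monoid) = \<lparr>carrier = GL, mult = (**), one = mat 1\<rparr>"
    by (simp add: GL2_def invertible_det_nz)
  have "group_rigid (SL2 :: ('f ^ 2 ^ 2) monoid)"
  proof (cases "odd (CARD('f))")
    case True
    then show ?thesis by (rule SL2_odd_rigid[OF prime])
  next
    case False
    then have "CARD('f) = 2" using prime primes_dvd_imp_eq two_is_prime_nat by metis
    then show ?thesis by (rule SL2_two_rigid)
  qed
  moreover have "finite (carrier (SL2 :: ('f ^ 2 ^ 2) monoid))" by (rule finite)
  ultimately show "rigid_relative_to_Aut TYPE('j) (SL2 :: ('f ^ 2 ^ 2) monoid)"
    by (intro group_rigid_imp_rigid matrix_group_SL2)
  show "rigid_relative_to_Aut TYPE('j) (PSL2 :: ('f ^ 2 ^ 2) set monoid)"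
    unfolding PSL2_def
    by (intro group_rigid_imp_rigid mod_scalars[OF matrix_group_SL2 SL2 disjI2[OF refl] prime])
  show "rigid_relative_to_Aut TYPE('j) (PGL2 :: ('f ^ 2 ^ 2) set monoid)"
    unfolding PGL2_def
    by (intro group_rigid_imp_rigid mod_scalars[OF matrix_group_GL2 GL2 disjI1[OF refl] prime])
qed

end
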